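(* Let $T>0$, let $f\in C^1([0,T])$ with $f(0)=0$. Then the problem \[ \theta_t(x,t)=\int_0^t N(t-s)\,\theta_{xx}(x,s)\,ds,\quad x\in(0,\pi),\ t\in(0,T],\qquad \theta(x,0)=0,\quad \theta(0,t)=f(t),\quad \theta(\pi,t)=0, \] admits a unique solution $\theta\in C([0,T];L^2(0,\pi))$, where "solution" means the following: the function $\eta(x,t):=\theta(x,t)-\frac{\pi-x}{\pi}f(t)$ belongs to $C([0,T];L^2(0,\pi))$, satisfies $A\int_0^t a(t-s)\eta(s)\,ds\in C([0,T];L^2(0,\pi))$ and \[ \eta(t)=A\int_0^t a(t-s)\eta(s)\,ds-\frac{\pi-x}{\pi}f(t),\qquad t\in[0,T]. \]
   Context: Standing assumptions on the relaxation kernel $N:(0,+\infty)\to\mathbb R$: (a) $N\in L^1(0,T)$ for every $T>0$; its Laplace transform $\hat N(\lambda)$ is defined and holomorphic on $\Pi_0=\{\lambda\in\mathbb C:\operatorname{Re}\lambda>0\}$ and maps $\Pi_0$ into itself (i.e. $\hat N$ is a positive real function); (b) on $\Pi_0$, $\hat N(\lambda)=\alpha\lambda^{-\gamma}+\lambda^{-\gamma-\sigma}N_1(\lambda)$ with $\alpha>0$, $\gamma\in(0,1)$, $\sigma>0$, $N_1$ holomorphic and bounded on $\Pi_0$, and $\operatorname{Re}\big(N_1(\lambda)\lambda^{-\sigma}\big)\ge 0$ on $\Pi_0$ (principal branches of powers); (c) there is a polynomial $p$ with $\int_0^t|N(s)|\,ds<p(t)$ for all $t>0$. $A$ denotes the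 operator $A\phi=\phi''$ in $L^2(0,\pi)$ with domain $\{\phi\in H^2(0,\pi):\phi(0)=\phi(\pi)=0\}$, and $a(t)=\int_0^tN(s)\,ds$. *)

theory Defs
  imports "HOL-Analysis.Analysis"
begin

definition Pi0 :: "complex set" where
  "Pi0 = {z. 0 < Re z}"

definition laplace :: "(real \<Rightarrow> real) \<Rightarrow> complex \<Rightarrow> complex" where
  "laplace N z = (LINT t:{0<..}|lborel. exp (- (z * complex_of_real t)) * complex_of_real (N t))"

definition kernel_assms :: "(real \<Rightarrow> real) \<Rightarrow> bool" where
  "kernel_assms N \<longleftrightarrow>
     \<comment> \<open>(a)\<close>
     (\<forall>T>0. set_integrable lborel {0<..<T} N) \<and>
     (\<forall>z\<in>Pi0. set_integrable lborel {0<..}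
          (\<lambda>t. exp (- (z * complex_of_real t)) * complex_of_real (N t))) \<and>
     laplace N holomorphic_on Pi0 \<and>
     (\<forall>z\<in>Pi0. 0 < Re (laplace N z)) \<and>
     \<comment> \<open>(b)\<close>
     (\<exists>\<alpha> \<gamma> \<sigma> (N1 :: complex \<Rightarrow> complex).
        0 < \<alpha> \<and> 0 < \<gamma> \<and> \<gamma> < 1 \<and> 0 < \<sigma> \<and>
        N1 holomorphic_on Pi0 \<and> bounded (N1 ` Pi0) \<and>
        (\<forall>z\<in>Pi0. laplace N z =
            complex_of_real \<alpha> * z powr (- complex_of_real \<gamma>)
            + z powr (- complex_of_real \<gamma> - complex_of_real \<sigma>) * N1 z) \<and>
        (\<forall>z\<in>Pi0. 0 \<le> Re (N1 z * z powr (- complex_of_real \<sigma>)))) \<and>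
     \<comment> \<open>(c): a polynomial bound\<close>
     (\<exists>(n::nat) (c :: nat \<Rightarrow> real). \<forall>t>0.
        (LINT s:{0..t}|lborel. \<bar>N s\<bar>) < (\<Sum>i\<le>n. c i * t ^ i))"

definition kernel_a :: "(real \<Rightarrow> real) \<Rightarrow> real \<Rightarrow> real" where
  "kernel_a N t = (LINT s:{0..t}|lborel. N s)"

definition L2 :: "(real \<Rightarrow> real) \<Rightarrow> bool" where
  "L2 u \<longleftrightarrow> set_borel_measurable lborel {0<..<pi} u \<and>
            set_integrable lborel {0<..<pi} (\<lambda>x. (u x)\<^sup>2)"

definition L2_eq :: "(real \<Rightarrow> real) \<Rightarrow> (real \<Rightarrow> real) \<Rightarrow> bool" where
  "L2_eq u v \<longleftrightarrow> (AE x in lborel. x \<in> {0<..<pi} \<longrightarrow> u x = v x)"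

definition L2_dist2 :: "(real \<Rightarrow> real) \<Rightarrow> (real \<Rightarrow> real) \<Rightarrow> real" where
  "L2_dist2 u v = (LINT x:{0<..<pi}|lborel. (u x - v x)\<^sup>2)"

definition CL2 :: "real \<Rightarrow> (real \<Rightarrow> real \<Rightarrow> real) \<Rightarrow> bool" where
  "CL2 T u \<longleftrightarrow> (\<forall>t\<in>{0..T}. L2 (\<lambda>x. u x t)) \<and>
     (\<forall>t\<in>{0..T}. ((\<lambda>s. L2_dist2 (\<lambda>x. u x s) (\<lambda>x. u x t)) \<longlongrightarrow> 0) (at t within {0..T}))"

definition test_fun :: "(real \<Rightarrow> real) \<Rightarrow> bool" where
  "test_fun \<psi> \<longleftrightarrow> (\<forall>k x. ((deriv ^^ k) \<psi>) differentiable (at x)) \<and>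
     (\<exists>a b. 0 < a \<and> b < pi \<and> (\<forall>x. x \<notin> {a..b} \<longrightarrow> \<psi> x = 0))"

definition weak_deriv :: "(real \<Rightarrow> real) \<Rightarrow> (real \<Rightarrow> real) \<Rightarrow> bool" where
  "weak_deriv u g \<longleftrightarrow> (\<forall>\<psi>. test_fun \<psi> \<longrightarrow>
     (LINT x:{0<..<pi}|lborel. u x * deriv \<psi> x) = - (LINT x:{0<..<pi}|lborel. g x * \<psi> x))"

text \<open>\<open>A_graph \<phi> ch\<close>: \<open>\<phi> \<in> D(A) = {\<phi> \<in> H^2(0,\<pi>). \<phi>(0) = \<phi>(\<pi>) = 0}\<close> and \<open>A\<phi> = ch\<close>
  (in \<open>L^2\<close>). Boundary values are those of the continuous representative.\<close>
definition A_graph :: "(real \<Rightarrow> real) \<Rightarrow> (real \<Rightarrow> real) \<Rightarrow> bool" where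
  "A_graph \<phi> ch \<longleftrightarrow> L2 \<phi> \<and> L2 ch \<and>
     (\<exists>\<phi>1. L2 \<phi>1 \<and> weak_deriv \<phi> \<phi>1 \<and> weak_deriv \<phi>1 ch) \<and>
     (\<exists>\<phi>c. continuous_on {0..pi} \<phi>c \<and> L2_eq \<phi> \<phi>c \<and> \<phi>c 0 = 0 \<and> \<phi>c pi = 0)"

text \<open>\<open>w = \<integral>_0^t a(t-s) \<eta>(s) ds\<close> as a (Bochner) integral in \<open>L^2(0,\<pi>)\<close>, characterised by
  \<open>w \<in> L^2\<close> and \<open>\<langle>w,g\<rangle> = \<integral>_0^t a(t-s) \<langle>\<eta>(s),g\<rangle> ds\<close> for all \<open>g \<in> L^2\<close>.\<close>
definition is_conv_integral ::
    "(real \<Rightarrow> real) \<Rightarrow> (real \<Rightarrow> real \<Rightarrow> real) \<Rightarrow> real \<Rightarrow> (real \<Rightarrow> real) \<Rightarrow> bool" where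
  "is_conv_integral a \<eta> t w \<longleftrightarrow> L2 w \<and>
     (\<forall>g. L2 g \<longrightarrow> (LINT x:{0<..<pi}|lborel. w x * g x) =
        (LINT s:{0..t}|lborel. a (t - s) * (LINT x:{0<..<pi}|lborel. \<eta> x s * g x)))"

definition is_solution ::
    "(real \<Rightarrow> real) \<Rightarrow> (real \<Rightarrow> real) \<Rightarrow> real \<Rightarrow> (real \<Rightarrow> real \<Rightarrow> real) \<Rightarrow> bool" where
  "is_solution N f T \<theta> \<longleftrightarrow>
     (let \<eta> = (\<lambda>x t. \<theta> x t - (pi - x) / pi * f t) in
       CL2 T \<eta> \<and>
       (\<exists>W AW. (\<forall>t\<in>{0..T}. is_conv_integral (kernel_a N) \<eta> t (\<lambda>x. W x t)) \<and>
               (\<forall>t\<in>{0..T}. A_graph (\<lambda>x. W x t) (\<lambda>x. AW x t)) \<and>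
               CL2 T AW \<and>
               (\<forall>t\<in>{0..T}. L2_eq (\<lambda>x. \<eta> x t) (\<lambda>x. AW x t - (pi - x) / pi * f t))))"

end

(*
  Expand in the sine basis of L^2(0,pi). With g_n = 2/(pi n) the sine coefficients of (pi-x)/pi, the
  n-th coefficient of eta solves the scalar Volterra equation y = - n^2 (a * y) - g_n f, that is
  y' = - n^2 (N * y) - g_n f' and y(0) = 0. The point is a bound on y that does not depend on n beyond the
  factor g_n. The positive real part of the Laplace transform of N on the line Re z = 1 says that
  K(t) = exp(-t) N(t) is a kernel of positive type, so multiplying the equation for u = exp(-t) y by u and
  integrating discards the term with n^2 and leaves u(t)^2 <= 2 g_n int |f'| |u|. Hence |y| <= C g_n; since
  the g_n are square summable, the sine series of eta converges in L^2 uniformly in t. For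
  uniqueness, test functions approximating sin(n x) show that the coefficients of any solution solve the
  same Volterra equations; by the a priori bound the coefficients of a difference vanish.
*)
theory Submission
  imports Defs "HOL-Probability.Probability" "HOL-Computational_Algebra.Polynomial"
begin

section \<open>Kernels of positive type\<close>

text \<open>The kernel is only locally integrable and its transform is controlled only in the open
  half plane. Damping by \<open>exp (- t)\<close> yields an integrable kernel with an honest Fourier
  transform; the price is the factor \<open>exp T\<close> in the final bound. Positivity of the
  quadratic form is needed for functions truncated at a time x, hence with a jump, so it is proved
  by Gaussian regularisation, using only Fubini and dominated convergence. The scalar equations are
  kept in integrated form, with the continuous kernel \<open>a\<close>, when they are solved; only
  the energy estimate differentiates them. Membership in the domain of A comes from reading the
  equation backwards: A applied to the convolution W is eta plus the lift, that is theta itself. The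
  coefficients of W are therefore minus those of theta divided by n^2, of order n^-3, which makes
  the series of W and of its first derivative uniformly convergent, while the second derivative
  exists in L^2 only. In the uniqueness part the obstacle sits at the endpoints: weak derivatives
  are tested with functions supported inside (0,pi), whereas the cosines met after one integration
  by parts do not vanish at 0 and pi.\<close>

lemma (in pair_sigma_finite)
  fixes f :: "'a \<Rightarrow> 'c::{real_normed_field, banach, second_countable_topology}"
  assumes f: "integrable M1 f" and g: "integrable M2 g"
  shows integrable_pair_mult: "integrable (M1 \<Otimes>\<^sub>M M2) (\<lambda>(x, y). f x * g y)"
    and integral_pair_mult:
      "integral\<^sup>L (M1 \<Otimes>\<^sub>M M2) (\<lambda>(x, y). f x * g y) = integral\<^sup>L M1 f * integral\<^sup>L M2 g"
proof -
  have [measurable]: "f \<in> borel_measurable M1" "g \<in> borel_measurable M2"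
    using f g by auto
  show *: "integrable (M1 \<Otimes>\<^sub>M M2) (\<lambda>(x, y). f x * g y)"
  proof (rule Fubini_integrable)
    show "integrable M1 (\<lambda>x. \<integral>y. norm (case (x, y) of (x, y) \<Rightarrow> f x * g y) \<partial>M2)"
      using f by (auto simp: norm_mult)
  qed (use g in auto)
  show "integral\<^sup>L (M1 \<Otimes>\<^sub>M M2) (\<lambda>(x, y). f x * g y) = integral\<^sup>L M1 f * integral\<^sup>L M2 g"
    using integral_fst'[OF *] by simp
qed

lemma integral_std_normal_iexp:
  "(CLINT w|std_normal_distribution. iexp (w * x)) = complex_of_real (exp (- (x\<^sup>2) / 2))"
  using char_std_normal_distribution[THEN fun_cong, of x]
  unfolding char_def by (simp add: mult.commute)

text \<open>A normal variable divided by n+1 tends to 0 pointwise, and B dominates. Continuity is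
  asked at the single point y because the functions averaged later are truncated and have
  jumps.\<close>

lemma gaussian_average_tendsto:
  fixes v :: "real \<Rightarrow> real"
  assumes [measurable]: "v \<in> borel_measurable borel" and B: "\<And>x. \<bar>v x\<bar> \<le> B" and c: "isCont v y"
  shows "(\<lambda>n. LINT z|std_normal_distribution. v (y - z / real (Suc n))) \<longlonglongrightarrow> v y"
proof -
  interpret real_distribution std_normal_distribution by (rule real_dist_normal_dist)
  have "(\<lambda>n. LINT z|std_normal_distribution. v (y - z / real (Suc n)))
      \<longlonglongrightarrow> (LINT z|std_normal_distribution. v y)"
  proof (rule integral_dominated_convergence[where w = "\<lambda>_. B"])
    show "AE z in std_normal_distribution. (\<lambda>n. v (y - z / real (Suc n))) \<longlonglongrightarrow> v y"
    proof (rule AE_I2, rule isCont_tendsto_compose[OF c])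
      fix z :: real
      have "(\<lambda>n. z * inverse (real (Suc n))) \<longlonglongrightarrow> z * 0"
        by (intro tendsto_mult tendsto_const LIMSEQ_inverse_real_of_nat)
      then have "(\<lambda>n. y - z * inverse (real (Suc n))) \<longlonglongrightarrow> y - z * 0"
        by (intro tendsto_diff tendsto_const)
      then show "(\<lambda>n. y - z / real (Suc n)) \<longlonglongrightarrow> y" by (simp add: divide_inverse)
    qed
    show "AE z in std_normal_distribution. norm (v (y - z / real (Suc n))) \<le> B" for n
      using B by auto
  qed (auto intro: integrable_const)
  then show ?thesis using prob_space by simp
qed

text \<open>The substitution z = R (y - s) turns the expectation into a convolution with the
  unnormalised Gaussian, the form in which \<open>gaussian_form_nonneg\<close> provides
  positivity.\<close>

lemma gaussian_average_eq:
  fixes v :: "real \<Rightarrow> real"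
  assumes [measurable]: "v \<in> borel_measurable borel" and R: "0 < R"
  shows "(LINT z|std_normal_distribution. v (y - z / R))
    = R / sqrt (2 * pi) * (LINT s|lborel. v s * exp (- ((R * (y - s))\<^sup>2) / 2))"
proof -
  have "(LINT z|std_normal_distribution. v (y - z / R))
      = (LINT z|lborel. std_normal_density z * v (y - z / R))"
    by (subst integral_density) (auto simp: normal_density_nonneg)
  also have "\<dots> = R * (LINT s|lborel. std_normal_density (R * y + (- R) * s) * v s)"
    using R by (subst lborel_integral_real_affine[where c = "- R" and t = "R * y"])
      (auto simp: diff_divide_distrib field_simps)
  also have "\<dots> = R / sqrt (2 * pi) * (LINT s|lborel. v s * exp (- ((R * (y - s))\<^sup>2) / 2))"
    unfolding std_normal_density_def mult.assoc
    by (subst (1) integral_mult_right_zero) (simp add: algebra_simps)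
  finally show ?thesis .
qed

text \<open>The Gaussian is the average of the characters \<open>iexp (w * R * x)\<close> over normally distributed \<open>w\<close>, and
  on each character the form factors as \<open>\<bar>v^\<bar>\<^sup>2\<close> times the Fourier transform of \<open>K\<close>. As \<open>R\<close> grows, the
  rescaled Gaussian is an approximate identity.\<close>
lemma gaussian_form_nonneg:
  fixes K v :: "real \<Rightarrow> real"
  assumes K: "integrable lborel K"
    and pos: "\<And>w. 0 \<le> Re (LINT r|lborel. iexp (- (w * r)) * complex_of_real (K r))"
    and v: "integrable lborel v"
  shows "0 \<le> (LINT p|(lborel \<Otimes>\<^sub>M lborel). v (fst p) * K (snd p) *
      (LINT s|lborel. v s * exp (- ((R * (fst p - snd p - s))\<^sup>2) / 2)))"
proof -
  let ?G = "std_normal_distribution"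
  let ?L2 = "lborel \<Otimes>\<^sub>M lborel :: (real \<times> real) measure"
  let ?L3 = "?L2 \<Otimes>\<^sub>M (lborel :: real measure)"
  interpret G: real_distribution ?G by (rule real_dist_normal_dist)
  interpret L2: pair_sigma_finite "lborel :: real measure" "lborel :: real measure" ..
  interpret L3: pair_sigma_finite ?L2 "lborel :: real measure" ..
  interpret LG: pair_sigma_finite ?L3 ?G ..
  have [measurable]: "K \<in> borel_measurable borel" "v \<in> borel_measurable borel"
    using K v by auto
  let ?F = "\<lambda>((t, r), s). complex_of_real (v t) * complex_of_real (K r) * complex_of_real (v s)"
  let ?e = "\<lambda>w ((t, r), s). iexp (w * (R * (t - r - s)))"
  have F: "integrable ?L3 ?F"
    using L3.integrable_pair_mult[OF lborel_pair.integrable_pair_mult, of "\<lambda>x. complex_of_real (v x)"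
        "\<lambda>x. complex_of_real (K x)" "\<lambda>x. complex_of_real (v x)"] K v
    by (simp add: case_prod_beta')
  \<comment> \<open>Characters have modulus one and the normal law has total mass one, so
    \<open>?F\<close> alone dominates; this licenses exchanging the average over w with the triple
    integral.\<close>
  have int: "integrable (?L3 \<Otimes>\<^sub>M ?G) (\<lambda>(p, w). ?F p * ?e w p)"
  proof (rule Bochner_Integration.integrable_bound)
    show "integrable (?L3 \<Otimes>\<^sub>M ?G) (\<lambda>(p, w). ?F p * 1)"
      by (rule LG.integrable_pair_mult[OF F]) simp
  qed (auto simp: norm_mult case_prod_unfold)
  have inner: "(CLINT p|?L3. ?F p * ?e w p) =
      (norm (LINT t|lborel. v t * iexp (w * R * t)))\<^sup>2
        * (LINT r|lborel. iexp (- (w * R * r)) * complex_of_real (K r))" (is "?l = ?r") for w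
  proof -
    let ?v = "\<lambda>t. v t * iexp (w * R * t)"
    let ?v' = "\<lambda>t. v t * iexp (- (w * R * t))"
    let ?K = "\<lambda>r. iexp (- (w * R * r)) * complex_of_real (K r)"
    have iv: "integrable lborel ?v" "integrable lborel ?v'"
      using v by (auto intro: Bochner_Integration.integrable_bound[OF v] simp: norm_mult)
    have iK: "integrable lborel ?K"
      by (rule Bochner_Integration.integrable_bound[OF K]) (auto simp: norm_mult)
    have "?l = (CLINT p|?L3. (case p of (q, s) \<Rightarrow> (case q of (t, r) \<Rightarrow> ?v t * ?K r) * ?v' s))"
      by (intro Bochner_Integration.integral_cong)
        (auto simp: exp_add[symmetric] exp_diff[symmetric] algebra_simps simp flip: exp_minus)
    also have "\<dots> = (CLINT t|lborel. ?v t) * (CLINT r|lborel. ?K r) * (CLINT s|lborel. ?v' s)"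
      using L3.integral_pair_mult[OF lborel_pair.integrable_pair_mult[OF iv(1) iK] iv(2)]
        lborel_pair.integral_pair_mult[OF iv(1) iK] by simp
    \<comment> \<open>Since v is real, the factor in s is the conjugate of the factor in t, and
      together they form a squared modulus.\<close>
    also have "(CLINT s|lborel. ?v' s) = cnj (CLINT s|lborel. ?v s)"
      using integral_bounded_linear[OF bounded_linear_cnj iv(1)] by (simp add: exp_cnj)
    finally show ?thesis
      unfolding complex_norm_square by (simp only: mult_ac)
  qed
  have "0 \<le> (LINT w|?G. Re (CLINT p|?L3. ?F p * ?e w p))"
  proof (rule integral_nonneg_AE, rule AE_I2)
    fix w show "0 \<le> Re (CLINT p|?L3. ?F p * ?e w p)"
      unfolding inner using pos[of "w * R"] by (simp add: Re_complex_of_real)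
  qed
  also have "\<dots> = Re (CLINT w|?G. CLINT p|?L3. ?F p * ?e w p)"
    by (rule integral_Re) (use LG.integrable_snd[OF int] in auto)
  also have "(CLINT w|?G. CLINT p|?L3. ?F p * ?e w p) = (CLINT p|?L3. CLINT w|?G. ?F p * ?e w p)"
    by (rule LG.Fubini_integral[OF int])
  also have "\<dots> = (CLINT p|?L3. complex_of_real (case p of ((t, r), s) \<Rightarrow>
      v t * K r * (v s * exp (- ((R * (t - r - s))\<^sup>2) / 2))))"
    by (intro Bochner_Integration.integral_cong)
      (auto simp: integral_std_normal_iexp simp del: of_real_mult of_real_diff,
        simp only: of_real_mult mult.assoc)
  also have "Re \<dots> = (LINT p|?L3. (case p of ((t, r), s) \<Rightarrow>
      v t * K r * (v s * exp (- ((R * (t - r - s))\<^sup>2) / 2))))"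
    by (simp only: integral_complex_of_real Re_complex_of_real)
  also have "\<dots> = (LINT q|?L2. LINT s|lborel. (case q of (t, r) \<Rightarrow>
      v t * K r * (v s * exp (- ((R * (t - r - s))\<^sup>2) / 2))))"
  proof (subst L3.integral_fst'[symmetric])
    show "integrable ?L3 (\<lambda>p. (case p of ((t, r), s) \<Rightarrow>
      v t * K r * (v s * exp (- ((R * (t - r - s))\<^sup>2) / 2))))"
      by (rule Bochner_Integration.integrable_bound[OF F])
        (auto simp: norm_mult abs_mult case_prod_unfold mult.assoc intro!: AE_I2 mult_left_mono mult_left_le)
  qed (simp add: case_prod_beta)
  also have "\<dots> = (LINT p|?L2. v (fst p) * K (snd p) *
      (LINT s|lborel. v s * exp (- ((R * (fst p - snd p - s))\<^sup>2) / 2)))"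
    by (simp add: case_prod_beta)
  finally show ?thesis .
qed

text \<open>Replace the factor \<open>v (t - r)\<close> by its Gaussian averages, for which the form
  is nonnegative, and let the averages concentrate. They converge wherever t - r avoids the finite
  set S of possible jumps.\<close>

lemma positive_type_kernel:
  fixes K v :: "real \<Rightarrow> real"
  assumes K: "integrable lborel K"
    and pos: "\<And>w. 0 \<le> Re (LINT r|lborel. iexp (- (w * r)) * complex_of_real (K r))"
    and v: "integrable lborel v" and B: "\<And>x. \<bar>v x\<bar> \<le> B"
    and S: "finite S" "\<And>x. x \<notin> S \<Longrightarrow> isCont v x"
  shows "0 \<le> (LINT t|lborel. v t * (LINT r|lborel. K r * v (t - r)))"
proof -
  let ?L2 = "lborel \<Otimes>\<^sub>M lborel :: (real \<times> real) measure"
  have [measurable]: "K \<in> borel_measurable borel" "v \<in> borel_measurable borel"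
    using K v by auto
  let ?f = "\<lambda>p. v (fst p) * K (snd p)"
  have f: "integrable ?L2 ?f"
    using lborel_pair.integrable_pair_mult[OF v K] by (simp add: case_prod_beta')
  let ?a = "\<lambda>n y. LINT z|std_normal_distribution. v (y - z / real (Suc n))"
  interpret G: real_distribution std_normal_distribution by (rule real_dist_normal_dist)
  have nonneg: "0 \<le> (LINT p|?L2. ?f p * ?a n (fst p - snd p))" for n
  proof -
    let ?R = "real (Suc n)"
    have "(LINT p|?L2. ?f p * ?a n (fst p - snd p)) = ?R / sqrt (2 * pi) *
       (LINT p|?L2. ?f p * (LINT s|lborel. v s * exp (- ((?R * (fst p - snd p - s))\<^sup>2) / 2)))"
      by (subst integral_mult_right_zero[symmetric], intro Bochner_Integration.integral_cong refl,
          subst gaussian_average_eq) (simp_all del: of_nat_Suc add: mult_ac)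
    then show ?thesis using gaussian_form_nonneg[OF K pos v, of ?R] by simp
  qed
  have bound: "\<bar>?a n y\<bar> \<le> B" for n y
  proof -
    have "\<bar>?a n y\<bar> \<le> (LINT z|std_normal_distribution. B)"
      by (rule order_trans[OF integral_abs_bound], rule integral_mono)
        (auto intro!: G.integrable_const_bound[where B = B] simp: B)
    then show ?thesis using G.prob_space by simp
  qed
  have "(\<lambda>n. LINT p|?L2. ?f p * ?a n (fst p - snd p)) \<longlonglongrightarrow> (LINT p|?L2. ?f p * v (fst p - snd p))"
  proof (rule integral_dominated_convergence[where w = "\<lambda>p. \<bar>?f p\<bar> * B"])
    have [measurable]: "S \<in> sets borel"
      using S(1) by (intro borel_closed finite_imp_closed)
    have m: "{p \<in> space ?L2. fst p - snd p \<notin> S} \<in> sets ?L2"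
      by measurable
    \<comment> \<open>For fixed t only finitely many r are bad; Fubini for null sets then handles
      pairs.\<close>
    have "AE r in lborel. t - r \<notin> S" for t
    proof -
      have "AE r in lborel. r \<notin> (\<lambda>x. t - x) ` S"
        using S(1) by (intro AE_not_in finite_imp_null_set_lborel) auto
      then show ?thesis by eventually_elim force
    qed
    then have "AE p in ?L2. fst p - snd p \<notin> S"
      using m by (intro lborel_pair.AE_pair_measure) auto
    then show "AE p in ?L2. (\<lambda>n. ?f p * ?a n (fst p - snd p)) \<longlonglongrightarrow> ?f p * v (fst p - snd p)"
      by eventually_elim
        (intro tendsto_mult tendsto_const gaussian_average_tendsto[where B = B] B S(2), auto)
    show "AE p in ?L2. norm (?f p * ?a n (fst p - snd p)) \<le> \<bar>?f p\<bar> * B" for n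
      using bound by (auto simp: abs_mult intro!: mult_left_mono)
  qed (use f in auto)
  then have "0 \<le> (LINT p|?L2. ?f p * v (fst p - snd p))"
    by (rule LIMSEQ_le_const) (use nonneg in auto)
  also have "\<dots> = (LINT t|lborel. LINT r|lborel. v t * K r * v (t - r))"
  proof (subst lborel_pair.integral_fst'[symmetric])
    show "integrable ?L2 (\<lambda>p. ?f p * v (fst p - snd p))"
      by (rule Bochner_Integration.integrable_bound[OF integrable_mult_left[OF f, of B]])
        (auto simp: abs_mult intro!: mult_left_mono order_trans[OF B])
  qed simp
  finally show ?thesis by (simp add: mult.assoc)
qed

section \<open>The weighted relaxation kernel\<close>

text \<open>Extension by 0 to the whole line makes the kernel causal, so a convolution over the line
  with a function vanishing on the negative axis is a Volterra integral.\<close>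

definition weighted_kernel :: "(real \<Rightarrow> real) \<Rightarrow> real \<Rightarrow> real" where
  "weighted_kernel N r = (if 0 < r then exp (- r) * N r else 0)"

lemma kernel_assmsD:
  assumes "kernel_assms N"
  shows "0 < Re z \<Longrightarrow> set_integrable lborel {0<..} (\<lambda>t. exp (- (z * complex_of_real t)) * complex_of_real (N t))"
    and "0 < Re z \<Longrightarrow> 0 < Re (laplace N z)"
    and "0 < T \<Longrightarrow> set_integrable lborel {0<..<T} N"
  using assms unfolding kernel_assms_def Pi0_def mem_Collect_eq Ball_def by simp_all

lemma integrable_weighted_kernel:
  assumes "kernel_assms N"
  shows "integrable lborel (weighted_kernel N)"
proof -
  have "set_integrable lborel {0<..} (\<lambda>t. exp (- (1 * complex_of_real t)) * complex_of_real (N t))"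
    using kernel_assmsD(1)[OF assms, of 1] by simp
  then have "integrable lborel (\<lambda>t. Re (indicator {0<..} t *\<^sub>R
      (exp (- (1 * complex_of_real t)) * complex_of_real (N t))))"
    unfolding set_integrable_def by (rule integrable_Re)
  also have "(\<lambda>t. Re (indicator {0<..} t *\<^sub>R
      (exp (- (1 * complex_of_real t)) * complex_of_real (N t)))) = weighted_kernel N"
    by (auto simp: weighted_kernel_def indicator_def Re_exp)
  finally show ?thesis .
qed

lemma fourier_weighted_kernel_nonneg:
  assumes "kernel_assms N"
  shows "0 \<le> Re (LINT r|lborel. iexp (- (w * r)) * complex_of_real (weighted_kernel N r))"
proof -
  have "laplace N (1 + \<i> * w) = (LINT r|lborel. iexp (- (w * r)) * complex_of_real (weighted_kernel N r))"
    unfolding laplace_def set_lebesgue_integral_def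
    by (intro Bochner_Integration.integral_cong)
      (auto simp: weighted_kernel_def indicator_def algebra_simps exp_diff exp_minus field_simps
        simp flip: exp_of_real)
  moreover have "0 < Re (laplace N (1 + \<i> * w))"
    using kernel_assmsD(2)[OF assms, of "1 + \<i> * w"] by simp
  ultimately show ?thesis by simp
qed

text \<open>The assumption concerns the open interval, while \<open>kernel_a\<close> integrates over
  the closed one; the endpoint values are supplied by indicators of single points.\<close>

lemma kernel_set_integrable:
  assumes "kernel_assms N"
  shows "set_integrable lborel {0..t} N"
proof (cases "0 < t")
  case True
  then have "integrable lborel (\<lambda>x. indicator {0<..<t} x *\<^sub>R N x)"
    using kernel_assmsD(3)[OF assms] unfolding set_integrable_def by simp
  then have "integrable lborel (\<lambda>x. indicator {0<..<t} x *\<^sub>R N x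
      + (indicator {0} x * N 0 + indicator {t} x * N t))"
    by (intro Bochner_Integration.integrable_add integrable_mult_left)
      (auto intro!: integrable_real_indicator)
  also have "(\<lambda>x. indicator {0<..<t} x *\<^sub>R N x + (indicator {0} x * N 0 + indicator {t} x * N t))
      = (\<lambda>x. indicator {0..t} x *\<^sub>R N x)"
    using True by (intro ext) (auto simp: indicator_def)
  finally show ?thesis unfolding set_integrable_def .
next
  case False
  then have "{0..t} = {} \<or> {0..t} = {0}" by auto
  then show ?thesis
  proof
    assume *: "{0..t} = {0}"
    have **: "(\<lambda>x. indicator {0} x *\<^sub>R N x) = (\<lambda>x. indicator {0} x * N 0)"
      by (auto simp: indicator_def)
    show ?thesis unfolding set_integrable_def * **
      by (intro integrable_mult_left integrable_real_indicator) auto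
  qed (simp add: set_integrable_def)
qed

text \<open>Undoes the weight, since \<open>exp r * weighted_kernel N r\<close> is N for r > 0. The
  cut at T is invisible for x \<le> T and keeps the unweighted kernel integrable on the line, as
  Fubini will require.\<close>

lemma kernel_a_eq:
  assumes "kernel_assms N" "x \<le> T"
  shows "kernel_a N x = (LINT r|lborel. indicator {..x} r * (indicator {..T} r * (exp r * weighted_kernel N r)))"
    (is "_ = integral\<^sup>L _ ?g")
proof (cases "0 \<le> x")
  case True
  have i: "integrable lborel (\<lambda>r. indicator {0..x} r *\<^sub>R N r)"
    using kernel_set_integrable[OF assms(1)] unfolding set_integrable_def .
  \<comment> \<open>The integrands can differ only at r = 0, where N is arbitrary and the weighted
    kernel is set to 0.\<close>
  have AE: "AE r in lborel. indicator {0..x} r *\<^sub>R N r = ?g r"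
  proof -
    have "AE r in lborel. r \<noteq> (0::real)" by (rule AE_lborel_singleton)
    then show ?thesis
      by eventually_elim (use assms(2) in \<open>auto simp: indicator_def weighted_kernel_def exp_minus field_simps\<close>)
  qed
  show ?thesis unfolding kernel_a_def set_lebesgue_integral_def
  proof (rule integral_cong_AE[OF _ _ AE])
    show "(\<lambda>r. indicator {0..x} r *\<^sub>R N r) \<in> borel_measurable lborel" using i by auto
    show "?g \<in> borel_measurable lborel"
      using integrable_weighted_kernel[OF assms(1)] by auto
  qed
next
  case False
  then have "?g = (\<lambda>_. 0)" by (auto simp: indicator_def weighted_kernel_def)
  moreover have "{0..x} = {}" using False by simp
  ultimately show ?thesis by (simp only: kernel_a_def set_lebesgue_integral_def) simp
qed

lemma kernel_a_neg: "x < 0 \<Longrightarrow> kernel_a N x = 0"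
  by (simp add: kernel_a_def set_lebesgue_integral_def)

text \<open>Indefinite integrals are continuous on each [0,t]; precomposition with
  \<open>max 0\<close> carries this across the origin, because the primitive vanishes at 0 and on
  the negative axis.\<close>

lemma continuous_on_kernel_a:
  assumes "kernel_assms N"
  shows "continuous_on S (kernel_a N)"
proof -
  have HK: "kernel_a N t = integral {0..t} N" for t
    unfolding kernel_a_def by (rule set_borel_integral_eq_integral(2)[OF kernel_set_integrable[OF assms]])
  have c: "continuous_on {0..t} (kernel_a N)" for t
    unfolding HK
    by (rule indefinite_integral_continuous_1)
      (rule set_borel_integral_eq_integral(1)[OF kernel_set_integrable[OF assms]])
  have "isCont (kernel_a N) x" for x
  proof -
    have "continuous_on {x - 1<..<x + 1} (\<lambda>t. kernel_a N (max 0 t))"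
      by (rule continuous_on_compose2[OF c[of "max 0 (x + 1)"]])
        (auto intro!: continuous_intros)
    then have "isCont (\<lambda>t. kernel_a N (max 0 t)) x"
      by (subst (asm) continuous_on_eq_continuous_at) auto
    moreover have "kernel_a N (max 0 t) = kernel_a N t" for t
      by (cases "t < 0") (auto simp: kernel_a_neg max_def HK)
    ultimately show ?thesis by simp
  qed
  then show ?thesis by (simp add: continuous_at_imp_continuous_on)
qed

text \<open>Both sides integrate k r * y s over the region r + s \<le> t; the shift x = r + s and
  Fubini do the rest. The right side is a primitive in t, so the equation can be differentiated
  without touching the possibly singular kernel.\<close>

lemma convolution_primitive:
  fixes k y :: "real \<Rightarrow> real"
  assumes k: "integrable lborel k" "\<And>r. r \<le> 0 \<Longrightarrow> k r = 0"
    and y: "y \<in> borel_measurable borel" "\<And>s. \<bar>y s\<bar> \<le> B" "\<And>s. s \<le> 0 \<Longrightarrow> y s = 0"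
  shows "(LINT s:{0..t}|lborel. (LINT r|lborel. indicator {..t - s} r * k r) * y s)
    = (LINT x:{0..t}|lborel. (LINT r|lborel. k r * y (x - r)))"
proof -
  have [measurable]: "k \<in> borel_measurable borel" "y \<in> borel_measurable borel" using k y by auto
  have B: "0 \<le> B" using order_trans[OF abs_ge_zero y(2)] .
  let ?b = "\<lambda>s::real. indicator {0..t} s * B"
  have b: "integrable lborel ?b"
    by (intro integrable_mult_left integrable_real_indicator) (auto simp: emeasure_lborel_Icc_eq)
  \<comment> \<open>Where neither factor vanishes, r and s are positive, so r + s \<le> t confines s
    to [0,t] and a product function dominates.\<close>
  have i1: "integrable (lborel \<Otimes>\<^sub>M lborel) (\<lambda>(s, r). indicator {..t} (r + s) * k r * y s)"
  proof (rule Bochner_Integration.integrable_bound[OF lborel_pair.integrable_pair_mult[OF b k(1)]])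
    show "AE p in lborel \<Otimes>\<^sub>M lborel. norm (case p of (s, r) \<Rightarrow> indicator {..t} (r + s) * k r * y s)
      \<le> norm (case p of (s, r) \<Rightarrow> ?b s * k r)"
    proof (rule AE_I2, clarify)
      fix s r :: real
      show "norm (indicator {..t} (r + s) * k r * y s) \<le> norm (?b s * k r)"
        using y(2)[of s] y(3)[of s] k(2)[of r] B
        by (cases "s \<le> 0"; cases "r \<le> 0")
          (auto simp: indicator_def abs_mult mult.commute[of B] intro!: mult_left_mono)
    qed
  qed measurable
  have i2: "integrable (lborel \<Otimes>\<^sub>M lborel) (\<lambda>(r, x). indicator {..t} x * k r * y (x - r))"
  proof (rule Bochner_Integration.integrable_bound[OF lborel_pair.integrable_pair_mult[OF k(1) b]])
    show "AE p in lborel \<Otimes>\<^sub>M lborel. norm (case p of (r, x) \<Rightarrow> indicator {..t} x * k r * y (x - r))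
      \<le> norm (case p of (r, x) \<Rightarrow> k r * ?b x)"
    proof (rule AE_I2, clarify)
      fix x r :: real
      show "norm (indicator {..t} x * k r * y (x - r)) \<le> norm (k r * ?b x)"
        using y(2)[of "x - r"] y(3)[of "x - r"] k(2)[of r] B
        by (cases "x - r \<le> 0"; cases "r \<le> 0")
          (auto simp: indicator_def abs_mult mult.commute[of B] intro!: mult_left_mono)
    qed
  qed measurable
  have "(LINT s:{0..t}|lborel. (LINT r|lborel. indicator {..t - s} r * k r) * y s)
      = (LINT s|lborel. LINT r|lborel. indicator {..t} (r + s) * k r * y s)"
    unfolding set_lebesgue_integral_def
  proof (intro Bochner_Integration.integral_cong refl)
    fix s :: real
    have "indicator {..t} (r + s) * k r * y s = (indicator {..t - s} r * k r) * (indicator {0..t} s * y s)" for r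
      using y(3)[of s] k(2)[of r]
      by (cases "s \<le> 0"; cases "r \<le> 0") (auto simp: indicator_def)
    then show "indicator {0..t} s *\<^sub>R ((LINT r|lborel. indicator {..t - s} r * k r) * y s)
        = (LINT r|lborel. indicator {..t} (r + s) * k r * y s)"
      by (simp only: integral_mult_left_zero) simp
  qed
  also have "\<dots> = (LINT r|lborel. LINT s|lborel. indicator {..t} (r + s) * k r * y s)"
    by (rule lborel_pair.Fubini_integral[OF i1, symmetric])
  also have "\<dots> = (LINT r|lborel. LINT x|lborel. indicator {..t} x * k r * y (x - r))"
  proof (rule Bochner_Integration.integral_cong[OF refl])
    fix r :: real
    show "(LINT s|lborel. indicator {..t} (r + s) * k r * y s)
        = (LINT x|lborel. indicator {..t} x * k r * y (x - r))"
      using lborel_integral_real_affine[of 1 "\<lambda>x. indicator {..t} x * k r * y (x - r)" r] by simp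
  qed
  also have "\<dots> = (LINT x|lborel. LINT r|lborel. indicator {..t} x * k r * y (x - r))"
    by (rule lborel_pair.Fubini_integral[OF i2, symmetric])
  also have "\<dots> = (LINT x:{0..t}|lborel. (LINT r|lborel. k r * y (x - r)))"
    unfolding set_lebesgue_integral_def
  proof (intro Bochner_Integration.integral_cong refl)
    fix x :: real
    have "indicator {..t} x * k r * y (x - r) = indicator {0..t} x * (k r * y (x - r))" for r
      using y(3)[of "x - r"] k(2)[of r]
      by (cases "x - r \<le> 0"; cases "r \<le> 0") (auto simp: indicator_def)
    then show "(LINT r|lborel. indicator {..t} x * k r * y (x - r))
        = indicator {0..t} x *\<^sub>R (LINT r|lborel. k r * y (x - r))"
      by (simp only: integral_mult_right_zero real_scaleR_def)
  qed
  finally show ?thesis .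
qed

section \<open>Energy estimate for the damped Volterra equation\<close>

lemma continuous_convolution:
  fixes k u :: "real \<Rightarrow> real"
  assumes k: "integrable lborel k" and u: "\<And>s. \<bar>u s\<bar> \<le> B" "continuous_on UNIV u"
  shows "continuous_on UNIV (\<lambda>x. LINT r|lborel. k r * u (x - r))"
proof (rule continuous_at_imp_continuous_on, intro ballI, unfold continuous_at_sequentially, safe)
  have [measurable]: "k \<in> borel_measurable borel" "u \<in> borel_measurable borel"
    using k u by (auto intro: borel_measurable_continuous_onI)
  fix X and x :: real assume X: "X \<longlonglongrightarrow> x"
  show "((\<lambda>x. LINT r|lborel. k r * u (x - r)) \<circ> X) \<longlonglongrightarrow> (LINT r|lborel. k r * u (x - r))"
    unfolding comp_def
  proof (rule integral_dominated_convergence[where w = "\<lambda>r. \<bar>k r\<bar> * B"])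
    have "(\<lambda>n. u (X n - r)) \<longlonglongrightarrow> u (x - r)" for r
      using continuous_on_tendsto_compose[OF u(2), of "\<lambda>n. X n - r" "x - r"] X
      by (simp add: tendsto_diff)
    then show "AE r in lborel. (\<lambda>n. k r * u (X n - r)) \<longlonglongrightarrow> k r * u (x - r)"
      by (intro AE_I2 tendsto_mult tendsto_const)
    show "AE r in lborel. norm (k r * u (X n - r)) \<le> \<bar>k r\<bar> * B" for n
      using u(1) by (auto simp: abs_mult intro!: mult_left_mono)
  qed (use k in auto)
qed

text \<open>The energy identity is integrated up to a point \<open>t1\<close> where |u| attains its
  maximum M. This gives M^2 \<le> (2 |c| T F) M, and dividing by M replaces a Gronwall argument;
  \<open>exp T\<close> undoes the damping.\<close>

lemma volterra_a_priori_bound: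
  fixes y f f' :: "real \<Rightarrow> real"
  assumes N: "kernel_assms N" and T: "0 \<le> T" and lam: "0 \<le> lam"
    and y: "continuous_on {0..T} y"
    and f': "continuous_on {0..T} f'" "\<And>t. t \<in> {0..T} \<Longrightarrow> \<bar>f' t\<bar> \<le> F"
    and f: "\<And>t. t \<in> {0..T} \<Longrightarrow> (f has_real_derivative f' t) (at t within {0..T})" "f 0 = 0"
    and eq: "\<And>t. t \<in> {0..T} \<Longrightarrow>
      y t = - lam * (LINT s:{0..t}|lborel. kernel_a N (t - s) * y s) - c * f t"
    and t: "t \<in> {0..T}"
  shows "\<bar>y t\<bar> \<le> 2 * exp T * T * F * \<bar>c\<bar>"
proof -
  define K where "K = weighted_kernel N"
  note K_int = integrable_weighted_kernel[OF N, folded K_def]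
  have K0: "K r = 0" if "r \<le> 0" for r using that by (simp add: K_def weighted_kernel_def)
  have y0: "y 0 = 0"
  proof -
    have "(LINT s:{0..0}|lborel. kernel_a N (0 - s) * y s) = 0"
      unfolding set_lebesgue_integral_def
      by (rule integral_eq_zero_AE, rule AE_mp[OF AE_lborel_singleton[of 0]]) auto
    then show ?thesis using eq[of 0] T f(2) by simp
  qed
  text \<open>The clamped extension keeps \<open>y\<close> bounded and, since \<open>y 0 = 0\<close>, continuous on the line.\<close>
  define Y where "Y s = y (min T (max 0 s))" for s
  have Y_eq: "Y s = y s" if "s \<in> {0..T}" for s using that by (simp add: Y_def)
  have Y_neg: "Y s = 0" if "s \<le> 0" for s using that T y0 by (simp add: Y_def min_def max_def)
  have Y_cont: "continuous_on UNIV Y"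
    unfolding Y_def
    by (rule continuous_on_compose2[OF y]) (use T in \<open>auto intro!: continuous_intros\<close>)
  define u where "u s = exp (- s) * Y s" for s
  have u_cont: "continuous_on A u" for A
    unfolding u_def by (intro continuous_intros continuous_on_subset[OF Y_cont]) auto
  obtain t1 where t1: "t1 \<in> {0..T}" "\<And>s. s \<in> {0..T} \<Longrightarrow> \<bar>u s\<bar> \<le> \<bar>u t1\<bar>"
    using continuous_attains_sup[of "{0..T}" "\<lambda>s. \<bar>u s\<bar>"] T
      continuous_on_rabs[OF u_cont] by auto
  define M where "M = \<bar>u t1\<bar>"
  obtain B where B: "\<And>s. \<bar>Y s\<bar> \<le> B"
  proof -
    have "bounded (y ` {0..T})" by (rule compact_imp_bounded[OF compact_continuous_image[OF y]]) simp
    then obtain B where "\<forall>x\<in>y ` {0..T}. norm x \<le> B" unfolding bounded_iff by blast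
    then show ?thesis using T by (intro that[of B]) (simp add: Y_def)
  qed
  have u_bound: "\<bar>u s\<bar> \<le> B" for s
  proof (cases "s \<le> 0")
    case True then show ?thesis using B[of s] Y_neg[of s] by (simp add: u_def)
  next
    case False
    then have "\<bar>u s\<bar> \<le> \<bar>Y s\<bar>" by (simp add: u_def abs_mult mult_left_le_one_le)
    then show ?thesis using B[of s] by simp
  qed
  define C where "C x = (LINT r|lborel. K r * u (x - r))" for x
  have C_cont: "continuous_on A C" for A
    unfolding C_def
    using continuous_on_subset[OF continuous_convolution[OF K_int u_bound u_cont]] by auto
  have conv: "(LINT s:{0..x}|lborel. kernel_a N (x - s) * y s) = integral {0..x} (\<lambda>s. exp s * C s)"
    if x: "x \<in> {0..T}" for x
  proof -
    let ?k = "\<lambda>r. indicator {..T} r * (exp r * K r)"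
    have k: "integrable lborel ?k"
    proof (rule Bochner_Integration.integrable_bound[OF integrable_mult_right[OF K_int, of "exp T"]])
      show "?k \<in> borel_measurable lborel" using K_int by auto
    qed (auto simp: indicator_def abs_mult intro!: mult_right_mono)
    have "(LINT s:{0..x}|lborel. kernel_a N (x - s) * y s)
        = (LINT s:{0..x}|lborel. (LINT r|lborel. indicator {..x - s} r * ?k r) * Y s)"
      using x by (intro set_lebesgue_integral_cong) (auto simp: kernel_a_eq[OF N, of _ T] K_def Y_eq)
    also have "\<dots> = (LINT s:{0..x}|lborel. (LINT r|lborel. ?k r * Y (s - r)))"
      by (rule convolution_primitive[OF k _ _ B])
        (auto simp: K0 Y_neg intro: borel_measurable_continuous_onI[OF Y_cont])
    also have "\<dots> = (LINT s:{0..x}|lborel. exp s * C s)"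
    proof (intro set_lebesgue_integral_cong ballI allI impI)
      fix s assume s: "s \<in> {0..x}"
      \<comment> \<open>Splitting exp r as exp s * exp (- (s - r)) conjugates the undamped
        convolution into the damped one. Beyond the cut, r > T \<ge> s, and Y vanishes at s -
        r.\<close>
      have "?k r * Y (s - r) = exp s * (K r * u (s - r))" for r
        using x s Y_neg[of "s - r"] by (auto simp: indicator_def u_def exp_diff exp_minus field_simps)
      then show "(LINT r|lborel. ?k r * Y (s - r)) = exp s * C s"
        unfolding C_def by (simp only: integral_mult_right_zero)
    qed simp
    also have "\<dots> = integral {0..x} (\<lambda>s. exp s * C s)"
      by (intro set_borel_integral_eq_integral(2) borel_integrable_atLeastAtMost')
        (intro continuous_intros C_cont)
    finally show ?thesis .
  qed
  \<comment> \<open>The integral term is a primitive of the continuous function exp s * C s, so the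
    fundamental theorem applies; the term - u x comes from differentiating the weight.\<close>
  have u_deriv: "(u has_real_derivative - u x - lam * C x - c * exp (- x) * f' x) (at x within {0..T})"
    if x: "x \<in> {0..T}" for x
  proof -
    have "((\<lambda>x. integral {0..x} (\<lambda>s. exp s * C s)) has_real_derivative exp x * C x) (at x within {0..T})"
      by (intro integral_has_real_derivative continuous_intros C_cont x)
    then have "((\<lambda>x. exp (- x) * (- lam * integral {0..x} (\<lambda>s. exp s * C s) - c * f x)) has_real_derivative
        exp (- x) * (- lam * (exp x * C x) - c * f' x)
         + (exp (- x) * (- 1)) * (- lam * integral {0..x} (\<lambda>s. exp s * C s) - c * f x)) (at x within {0..T})"
      using f(1)[OF x] by (auto intro!: derivative_eq_intros)
    moreover have *: "exp (- z) * (- lam * integral {0..z} (\<lambda>s. exp s * C s) - c * f z) = u z"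
      if "z \<in> {0..T}" for z
      using eq[OF that] conv[OF that] Y_eq[OF that] by (simp add: u_def)
    moreover have "exp (- x) * (- lam * (exp x * C x) - c * f' x)
         + (exp (- x) * (- 1)) * (- lam * integral {0..x} (\<lambda>s. exp s * C s) - c * f x)
        = - u x - lam * C x - c * exp (- x) * f' x"
      unfolding *[OF x, symmetric] by (simp add: algebra_simps exp_minus)
    ultimately show ?thesis
      using has_field_derivative_transform_within[OF _ zero_less_one x] by force
  qed
  \<comment> \<open>Truncate u to [0,x]. By causality the convolution of K with the truncated
    function still equals C at times up to x, and later times are multiplied by zero.\<close>
  have pos: "0 \<le> integral {0..x} (\<lambda>s. u s * C s)" if x: "x \<in> {0..T}" for x
  proof -
    let ?v = "\<lambda>s. indicator {0..x} s * u s"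
    have "0 \<le> (LINT t|lborel. ?v t * (LINT r|lborel. K r * ?v (t - r)))"
    proof (rule positive_type_kernel[OF K_int])
      show "0 \<le> Re (LINT r|lborel. iexp (- (w * r)) * complex_of_real (K r))" for w
        unfolding K_def by (rule fourier_weighted_kernel_nonneg[OF N])
      show "integrable lborel ?v"
        using borel_integrable_atLeastAtMost'[OF u_cont] unfolding set_integrable_def by simp
      show "\<bar>?v s\<bar> \<le> B" for s using u_bound[of s] by (auto simp: indicator_def)
      show "isCont ?v s" if "s \<notin> {0, x}" for s
      proof -
        have "isCont (indicator {0..x} :: real \<Rightarrow> real) s"
          using that by (auto simp: isCont_indicator frontier_def)
        moreover have "isCont u s" using u_cont[of UNIV] by (simp add: continuous_on_eq_continuous_at)
        ultimately show ?thesis by (rule isCont_mult)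
      qed
    qed simp
    also have "\<dots> = (LINT t:{0..x}|lborel. u t * C t)"
      unfolding set_lebesgue_integral_def
    proof (intro Bochner_Integration.integral_cong refl)
      fix s :: real
      have "K r * ?v (s - r) = K r * u (s - r)" if "s \<le> x" for r
        using that K0[of r] Y_neg[of "s - r"] by (cases "r \<le> 0"; cases "s - r \<le> 0") (auto simp: indicator_def u_def)
      then have "(LINT r|lborel. K r * ?v (s - r)) = C s" if "s \<le> x"
        using that unfolding C_def by (simp only:)
      then show "?v s * (LINT r|lborel. K r * ?v (s - r)) = indicator {0..x} s *\<^sub>R (u s * C s)"
        by (cases "s \<le> x") (simp_all add: C_def)
    qed
    also have "\<dots> = integral {0..x} (\<lambda>s. u s * C s)"
      by (intro set_borel_integral_eq_integral(2) borel_integrable_atLeastAtMost')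
        (intro continuous_intros C_cont u_cont)
    finally show ?thesis .
  qed
  have F: "0 \<le> F" using f'(2)[of 0] T by (auto intro: order_trans[OF abs_ge_zero])
  have "(u t1)\<^sup>2 \<le> 2 * \<bar>c\<bar> * T * F * M"
  proof -
    let ?D = "\<lambda>s. 2 * u s * (- u s - lam * C s - c * exp (- s) * f' s)"
    let ?g = "\<lambda>s. - 2 * (c * exp (- s) * f' s * u s)"
    have t1T: "{0..t1} \<subseteq> {0..T}" using t1 by auto
    have cg: "continuous_on {0..t1} ?g"
      by (intro continuous_intros u_cont continuous_on_subset[OF f'(1) t1T])
    have gi: "?g integrable_on {0..t1}" by (rule integrable_continuous_interval[OF cg])
    have uCi: "(\<lambda>s. u s * C s) integrable_on {0..t1}"
      by (intro integrable_continuous_interval continuous_intros u_cont C_cont)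
    have "(?D has_integral (u t1)\<^sup>2 - (u 0)\<^sup>2) {0..t1}"
    proof (rule fundamental_theorem_of_calculus)
      fix s assume s: "s \<in> {0..t1}"
      have "((\<lambda>s. (u s)\<^sup>2) has_real_derivative ?D s) (at s within {0..T})"
        using t1T s by (auto intro!: derivative_eq_intros u_deriv)
      then show "((\<lambda>s. (u s)\<^sup>2) has_vector_derivative ?D s) (at s within {0..t1})"
        using DERIV_subset[OF _ t1T] has_real_derivative_iff_has_vector_derivative by blast
    qed (use t1 in auto)
    moreover have "u 0 = 0" using Y_neg[of 0] by (simp add: u_def)
    ultimately have "(?D has_integral (u t1)\<^sup>2) {0..t1}" by simp
    moreover have "((\<lambda>s. ?g s - 2 * lam * (u s * C s)) has_integral
        integral {0..t1} ?g - 2 * lam * integral {0..t1} (\<lambda>s. u s * C s)) {0..t1}"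
      by (intro has_integral_diff has_integral_mult_right integrable_integral gi uCi)
    \<comment> \<open>The damping contributes \<open>- 2 * (u s)\<^sup>2\<close>, which has the
      favourable sign and is dropped here.\<close>
    moreover have "?D s \<le> ?g s - 2 * lam * (u s * C s)" for s
      by (simp add: algebra_simps)
    ultimately have "(u t1)\<^sup>2 \<le> integral {0..t1} ?g - 2 * lam * integral {0..t1} (\<lambda>s. u s * C s)"
      by (rule has_integral_le)
    also have "\<dots> \<le> integral {0..t1} ?g" using pos[OF t1(1)] lam by simp
    also have "\<dots> \<le> integral {0..t1} (\<lambda>s. 2 * \<bar>c\<bar> * F * M)"
    proof (rule integral_le[OF gi])
      fix s assume s: "s \<in> {0..t1}"
      have "\<bar>?g s\<bar> = 2 * \<bar>c\<bar> * (exp (- s) * \<bar>f' s\<bar> * \<bar>u s\<bar>)" by (simp add: abs_mult)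
      also have "\<dots> \<le> 2 * \<bar>c\<bar> * (1 * F * M)"
        using s t1T F unfolding M_def by (intro mult_left_mono mult_mono f' t1) auto
      finally have "\<bar>?g s\<bar> \<le> 2 * \<bar>c\<bar> * F * M" by (simp only: mult_1 mult.assoc)
      then show "?g s \<le> 2 * \<bar>c\<bar> * F * M" by (rule order_trans[OF abs_ge_self])
    qed auto
    also have "\<dots> = t1 * (2 * \<bar>c\<bar> * F * M)" using t1 by simp
    also have "\<dots> \<le> T * (2 * \<bar>c\<bar> * F * M)"
      using t1 F by (intro mult_right_mono) (auto simp: M_def)
    finally show ?thesis by (simp add: mult_ac)
  qed
  then have "M * M \<le> (2 * \<bar>c\<bar> * T * F) * M"
    unfolding M_def by (simp add: power2_eq_square abs_mult_self_eq)
  moreover have "0 \<le> M" "0 \<le> 2 * \<bar>c\<bar> * T * F" using F T by (auto simp: M_def)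
  \<comment> \<open>Cancelling M requires M nonzero; for M = 0 the claim is the nonnegativity of the
    right side.\<close>
  ultimately have M: "M \<le> 2 * \<bar>c\<bar> * T * F"
    by (cases "M = 0") (auto intro: mult_right_le_imp_le)
  have "\<bar>y t\<bar> = exp t * \<bar>u t\<bar>" using Y_eq[OF t] by (simp add: u_def abs_mult exp_minus)
  also have "\<dots> \<le> exp T * M" unfolding M_def using t by (intro mult_mono t1) auto
  also have "\<dots> \<le> exp T * (2 * \<bar>c\<bar> * T * F)" using M by simp
  finally show ?thesis by (simp add: mult_ac)
qed

section \<open>Scalar Volterra equations\<close>

lemma integral_power_atLeastAtMost:
  fixes t :: real assumes "0 \<le> t"
  shows "integral {0..t} (\<lambda>s. s ^ k) = t ^ Suc k / real (Suc k)"
proof -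
  have "((\<lambda>s. s ^ k) has_integral t ^ Suc k / real (Suc k) - 0 ^ Suc k / real (Suc k)) {0..t}"
    by (rule fundamental_theorem_of_calculus[OF assms])
      (auto intro!: derivative_eq_intros simp del: power_Suc
        simp flip: has_real_derivative_iff_has_vector_derivative)
  then show ?thesis by (simp add: integral_unique)
qed

text \<open>Neumann series: \<open>u k\<close> is the k-th iterate of -lam times the Volterra
  operator, applied to F. Its convergence is not uniform in lam; uniformity over the modes is left
  to the energy estimate.\<close>

lemma volterra_solution_exists:
  fixes a F :: "real \<Rightarrow> real"
  assumes T: "0 \<le> T" and lam: "0 \<le> lam"
    and a: "continuous_on UNIV a" "\<And>x. x < 0 \<Longrightarrow> a x = 0" and F: "continuous_on {0..T} F"
  shows "\<exists>y. continuous_on {0..T} y \<and>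
    (\<forall>t\<in>{0..T}. y t = - lam * (LINT s:{0..t}|lborel. a (t - s) * y s) + F t)"
proof -
  \<comment> \<open>Since a vanishes on the negative axis, the integral can run over the fixed
    interval [0,T]. This makes continuity in t an instance of continuity of a parameter
    integral.\<close>
  define J where "J y t = integral {0..T} (\<lambda>s. a (t - s) * y s)" for y t
  define u where "u = rec_nat F (\<lambda>_ v t. - lam * J v t)"
  have u0: "u 0 = F" and u_Suc: "u (Suc k) = (\<lambda>t. - lam * J (u k) t)" for k
    by (simp_all add: u_def)
  have a_cont: "continuous_on S (\<lambda>s. a (h s))" if "continuous_on S h" for S and h :: "'b::topological_space \<Rightarrow> real"
    by (rule continuous_on_compose2[OF a(1) that]) auto
  have J_eq: "J y t = integral {0..t} (\<lambda>s. a (t - s) * y s)"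
    if "continuous_on {0..T} y" "t \<in> {0..T}" for y t
  proof -
    have i: "(\<lambda>s. a (t - s) * y s) integrable_on {0..T}"
      by (intro integrable_continuous_interval continuous_intros a_cont that)
    have "integral {t..T} (\<lambda>s. a (t - s) * y s) = integral {t..T} (\<lambda>s. 0)"
      by (rule integral_spike[of "{t}"]) (auto simp: a(2))
    then show ?thesis
      using Henstock_Kurzweil_Integration.integral_combine[of 0 t T "\<lambda>s. a (t - s) * y s"] that i
      by (simp add: J_def)
  qed
  have J_cont: "continuous_on {0..T} (J y)" if "continuous_on {0..T} y" for y
  proof -
    have "continuous_on ({0..T} \<times> cbox 0 T) (\<lambda>(t, s). a (t - s) * y s)"
      unfolding case_prod_unfold
      by (intro continuous_intros a_cont continuous_on_compose2[OF that]) auto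
    then have "continuous_on {0..T} (\<lambda>t. integral (cbox 0 T) (\<lambda>s. a (t - s) * y s))"
      by (rule integral_continuous_on_param)
    then show ?thesis by (simp add: J_def[abs_def])
  qed
  have u_cont: "continuous_on {0..T} (u k)" for k
    by (induction k) (auto simp: u0 u_Suc F intro!: continuous_intros J_cont)
  obtain A where A: "\<And>x. x \<in> {0..T} \<Longrightarrow> \<bar>a x\<bar> \<le> A"
  proof -
    have "bounded (a ` {0..T})"
      by (intro compact_imp_bounded compact_continuous_image continuous_on_subset[OF a(1)]) auto
    then obtain B where "\<forall>x\<in>a ` {0..T}. norm x \<le> B" unfolding bounded_iff by blast
    then show ?thesis by (intro that[of B]) auto
  qed
  obtain U where U: "\<And>x. x \<in> {0..T} \<Longrightarrow> \<bar>F x\<bar> \<le> U"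
  proof -
    have "bounded (F ` {0..T})"
      by (intro compact_imp_bounded compact_continuous_image F) auto
    then obtain B where "\<forall>x\<in>F ` {0..T}. norm x \<le> B" unfolding bounded_iff by blast
    then show ?thesis by (intro that[of B]) auto
  qed
  have AU: "0 \<le> A" "0 \<le> U" using A[of 0] U[of 0] T by auto
  \<comment> \<open>Bounding each iteration by a constant would give a geometric series, convergent
    only for small lam * A * T. Carrying the power of t through the integration produces the
    factorial.\<close>
  have u_bound: "\<bar>u k t\<bar> \<le> U * ((lam * A * t) ^ k / fact k)" if "t \<in> {0..T}" for k t
    using that
  proof (induction k arbitrary: t)
    case 0 then show ?case using U by (simp add: u0)
  next
    case (Suc k)
    have sub: "{0..t} \<subseteq> {0..T}" using Suc.prems by auto
    have "\<bar>J (u k) t\<bar> = norm (integral {0..t} (\<lambda>s. a (t - s) * u k s))"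
      using J_eq[OF u_cont Suc.prems] by simp
    also have "\<dots> \<le> integral {0..t} (\<lambda>s. (A * (U * ((lam * A) ^ k / fact k))) * s ^ k)"
    proof (rule integral_norm_bound_integral)
      show "(\<lambda>s. a (t - s) * u k s) integrable_on {0..t}"
        by (intro integrable_continuous_interval continuous_intros a_cont continuous_on_subset[OF u_cont sub])
      show "(\<lambda>s. (A * (U * ((lam * A) ^ k / fact k))) * s ^ k) integrable_on {0..t}"
        by (intro integrable_continuous_interval continuous_intros)
      fix s assume s: "s \<in> {0..t}"
      have "norm (a (t - s) * u k s) \<le> A * (U * ((lam * A * s) ^ k / fact k))"
        unfolding real_norm_def abs_mult
        using s Suc.prems AU by (intro mult_mono A Suc.IH) auto
      then show "norm (a (t - s) * u k s) \<le> (A * (U * ((lam * A) ^ k / fact k))) * s ^ k"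
        by (simp add: power_mult_distrib mult_ac)
    qed
    also have "\<dots> = A * (U * ((lam * A) ^ k / fact k)) * (t ^ Suc k / real (Suc k))"
      using Suc.prems by (subst integral_mult_right) (simp add: integral_power_atLeastAtMost)
    finally have *: "\<bar>J (u k) t\<bar> \<le> A * (U * ((lam * A) ^ k / fact k)) * (t ^ Suc k / real (Suc k))" .
    have "\<bar>u (Suc k) t\<bar> \<le> lam * (A * (U * ((lam * A) ^ k / fact k)) * (t ^ Suc k / real (Suc k)))"
      using mult_left_mono[OF * lam] lam by (simp only: u_Suc abs_mult) simp
    also have "\<dots> = U * ((lam * A * t) ^ Suc k / fact (Suc k))"
      by (simp add: power_mult_distrib field_simps)
    finally show ?case .
  qed
  define Mk where "Mk k = U * ((lam * A * T) ^ k / fact k)" for k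
  have Mk_sum: "summable Mk"
    unfolding Mk_def using summable_exp[of "lam * A * T"] by (intro summable_mult) (simp add: field_simps)
  have u_Mk: "norm (u k t) \<le> Mk k" if "t \<in> {0..T}" for k t
  proof -
    have "U * ((lam * A * t) ^ k / fact k) \<le> Mk k"
      unfolding Mk_def using that AU lam by (intro mult_left_mono divide_right_mono power_mono) auto
    then show ?thesis using u_bound[OF that, of k] by simp
  qed
  define y where "y t = (\<Sum>k. u k t)" for t
  have unif: "uniform_limit {0..T} (\<lambda>n t. \<Sum>k<n. u k t) y sequentially"
    unfolding y_def by (rule Weierstrass_m_test[OF u_Mk Mk_sum])
  have S_cont: "continuous_on {0..T} (\<lambda>t. \<Sum>k<n. u k t)" for n
    by (intro continuous_intros u_cont)
  have y_cont: "continuous_on {0..T} y"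
    by (rule uniform_limit_theorem[OF _ unif]) (auto intro!: always_eventually S_cont)
  have lim: "(\<lambda>n. \<Sum>k<n. u k t) \<longlonglongrightarrow> y t" if "t \<in> {0..T}" for t
    by (rule tendsto_uniform_limitI[OF unif that])
  have S_bound: "\<bar>\<Sum>k<n. u k t\<bar> \<le> suminf Mk" if "t \<in> {0..T}" for n t
  proof -
    have "\<bar>\<Sum>k<n. u k t\<bar> \<le> (\<Sum>k<n. Mk k)"
      using u_Mk[OF that] by (intro sum_abs[THEN order_trans] sum_mono) auto
    also have "\<dots> \<le> suminf Mk"
      using AU lam T by (intro sum_le_suminf Mk_sum) (auto simp: Mk_def)
    finally show ?thesis .
  qed
  have eq: "y t = - lam * J y t + F t" if t: "t \<in> {0..T}" for t
  proof -
    have a_bound: "\<bar>a (t - s)\<bar> \<le> A" if "s \<in> {0..T}" for s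
      using A[of "t - s"] a(2)[of "t - s"] AU that t by (cases "t - s < 0") auto
    have "(\<lambda>n. integral {0..T} (\<lambda>s. a (t - s) * (\<Sum>k<n. u k s))) \<longlonglongrightarrow> J y t"
      unfolding J_def
    proof (rule dominated_convergence(2)[where h = "\<lambda>_. A * suminf Mk"])
      show "(\<lambda>s. a (t - s) * (\<Sum>k<n. u k s)) integrable_on {0..T}" for n
        by (intro integrable_continuous_interval continuous_intros a_cont u_cont)
      show "norm (a (t - s) * (\<Sum>k<n. u k s)) \<le> A * suminf Mk" if "s \<in> {0..T}" for n s
        unfolding real_norm_def abs_mult using AU by (intro mult_mono a_bound S_bound that) auto
      show "(\<lambda>n. a (t - s) * (\<Sum>k<n. u k s)) \<longlonglongrightarrow> a (t - s) * y s" if "s \<in> {0..T}" for s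
        by (intro tendsto_intros lim that)
    qed auto
    moreover have "integral {0..T} (\<lambda>s. a (t - s) * (\<Sum>k<n. u k s)) = (\<Sum>k<n. J (u k) t)" for n
      unfolding J_def sum_distrib_left
      by (intro integral_sum integrable_continuous_interval continuous_intros a_cont u_cont) auto
    ultimately have "(\<lambda>n. - lam * (\<Sum>k<n. J (u k) t) + F t) \<longlonglongrightarrow> - lam * J y t + F t"
      by (intro tendsto_intros) simp
    \<comment> \<open>Applying the operator to the first n terms yields terms 1 to n, and F is term
      0: a partial sum with n + 1 terms, hence the shifted limit below.\<close>
    also have "(\<lambda>n. - lam * (\<Sum>k<n. J (u k) t) + F t) = (\<lambda>n. \<Sum>k<Suc n. u k t)"
      by (subst sum.lessThan_Suc_shift) (simp add: u0 u_Suc sum_distrib_left sum_negf)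
    finally show ?thesis
      using LIMSEQ_unique LIMSEQ_Suc[OF lim[OF t]] by blast
  qed
  show ?thesis
  proof (intro exI[of _ y] conjI ballI y_cont)
    fix t assume t: "t \<in> {0..T}"
    have "(LINT s:{0..t}|lborel. a (t - s) * y s) = J y t"
      unfolding J_eq[OF y_cont t] using t
      by (intro set_borel_integral_eq_integral(2) borel_integrable_atLeastAtMost' continuous_intros
          a_cont continuous_on_subset[OF y_cont]) auto
    then show "y t = - lam * (LINT s:{0..t}|lborel. a (t - s) * y s) + F t"
      using eq[OF t] by simp
  qed
qed

section \<open>Square integrable functions\<close>

definition square_integrable :: "'a measure \<Rightarrow> ('a \<Rightarrow> real) \<Rightarrow> bool" where
  "square_integrable M u \<longleftrightarrow> u \<in> borel_measurable M \<and> integrable M (\<lambda>x. (u x)\<^sup>2)"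

lemma square_integrable_mult:
  assumes "square_integrable M u" "square_integrable M v"
  shows "integrable M (\<lambda>x. u x * v x)"
proof (rule Bochner_Integration.integrable_bound)
  show "integrable M (\<lambda>x. (u x)\<^sup>2 + (v x)\<^sup>2)"
    using assms by (auto simp: square_integrable_def)
  have "2 * \<bar>a * b\<bar> \<le> a\<^sup>2 + b\<^sup>2" for a b :: real
    using sum_squares_bound[of "\<bar>a\<bar>" "\<bar>b\<bar>"] by (simp add: abs_mult)
  then have "\<bar>a * b\<bar> \<le> a\<^sup>2 + b\<^sup>2" for a b :: real
    using abs_ge_zero[of "a * b"] by (smt (verit))
  then show "AE x in M. norm (u x * v x) \<le> norm ((u x)\<^sup>2 + (v x)\<^sup>2)"
    by (auto simp: abs_of_nonneg)
qed (use assms in \<open>auto simp: square_integrable_def\<close>)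

lemma square_integrable_cmult:
  "square_integrable M u \<Longrightarrow> square_integrable M (\<lambda>x. c * u x)"
  by (auto simp: square_integrable_def power_mult_distrib)

lemma square_integrable_add:
  assumes "square_integrable M u" "square_integrable M v"
  shows "square_integrable M (\<lambda>x. u x + v x)"
proof -
  have "integrable M (\<lambda>x. (u x)\<^sup>2 + (v x)\<^sup>2 + 2 * (u x * v x))"
    using square_integrable_mult[OF assms] assms by (auto simp: square_integrable_def)
  then show ?thesis using assms by (auto simp: square_integrable_def power2_sum mult.assoc)
qed

lemma square_integrable_diff:
  assumes "square_integrable M u" "square_integrable M v"
  shows "square_integrable M (\<lambda>x. u x - v x)"
  using square_integrable_add[OF assms(1) square_integrable_cmult[OF assms(2), of "- 1"]] by simp

lemma square_integrable_sum:
  assumes "\<And>i. i \<in> I \<Longrightarrow> square_integrable M (u i)"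
  shows "square_integrable M (\<lambda>x. \<Sum>i\<in>I. u i x)"
  using assms
proof (induction I rule: infinite_finite_induct)
  case (insert i I)
  then show ?case by (simp add: square_integrable_add)
qed (auto simp: square_integrable_def)

text \<open>The norm of u - t v gives a quadratic in t that is never negative; its minimiser t = I /
  V yields the inequality when V is nonzero.\<close>

lemma square_integrable_Cauchy_Schwarz:
  assumes u: "square_integrable M u" and v: "square_integrable M v"
  shows "(\<integral>x. u x * v x \<partial>M)\<^sup>2 \<le> (\<integral>x. (u x)\<^sup>2 \<partial>M) * (\<integral>x. (v x)\<^sup>2 \<partial>M)"
proof -
  let ?U = "\<integral>x. (u x)\<^sup>2 \<partial>M" and ?V = "\<integral>x. (v x)\<^sup>2 \<partial>M" and ?I = "\<integral>x. u x * v x \<partial>M"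
  have q: "0 \<le> ?U - 2 * t * ?I + t\<^sup>2 * ?V" for t
  proof -
    have "0 \<le> (\<integral>x. (u x - t * v x)\<^sup>2 \<partial>M)" by simp
    also have "\<dots> = (\<integral>x. (u x)\<^sup>2 - (2 * t) * (u x * v x) + t\<^sup>2 * (v x)\<^sup>2 \<partial>M)"
      by (intro Bochner_Integration.integral_cong refl) (simp add: power2_eq_square algebra_simps)
    also have "\<dots> = ?U - (2 * t) * ?I + t\<^sup>2 * ?V"
      using square_integrable_mult[OF u v] u v by (simp add: square_integrable_def)
    finally show ?thesis .
  qed
  show ?thesis
  proof (cases "?V = 0")
    case False
    then have V: "0 < ?V" by (simp add: order_less_le)
    have "0 \<le> (?U - 2 * (?I / ?V) * ?I + (?I / ?V)\<^sup>2 * ?V) * ?V" by (intro mult_nonneg_nonneg q) simp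
    also have "\<dots> = ?U * ?V - ?I\<^sup>2" using V by (simp add: field_simps power2_eq_square)
    finally show ?thesis by simp
  next
    case True
    have "?I = 0"
    proof (rule ccontr)
      assume "?I \<noteq> 0"
      \<comment> \<open>With V = 0 the quadratic is linear in t, and this t makes its value
        -1.\<close>
      then show False using q[of "(?U + 1) / (2 * ?I)"] True by simp
    qed
    then show ?thesis using True by simp
  qed
qed

text \<open>Cauchy-Schwarz bounds the difference. A general filter is kept because the limit is
  taken both along partial sums and along times s tending to t.\<close>

lemma square_integrable_tendsto_inner:
  assumes S: "\<forall>\<^sub>F n in F. square_integrable M (S n)" and u: "square_integrable M u" and v: "square_integrable M v"
    and lim: "((\<lambda>n. \<integral>x. (S n x - u x)\<^sup>2 \<partial>M) \<longlongrightarrow> 0) F"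
  shows "((\<lambda>n. \<integral>x. S n x * v x \<partial>M) \<longlongrightarrow> (\<integral>x. u x * v x \<partial>M)) F"
proof -
  have lim0: "((\<lambda>n. sqrt ((\<integral>x. (S n x - u x)\<^sup>2 \<partial>M) * (\<integral>x. (v x)\<^sup>2 \<partial>M))) \<longlongrightarrow> 0) F"
    using tendsto_real_sqrt[OF tendsto_mult_right[OF lim, of "\<integral>x. (v x)\<^sup>2 \<partial>M"]]
    by (simp add: mult.commute)
  have "((\<lambda>n. (\<integral>x. S n x * v x \<partial>M) - (\<integral>x. u x * v x \<partial>M)) \<longlongrightarrow> 0) F"
  proof (rule Lim_null_comparison[OF eventually_mono[OF S]])
    fix n assume Sn: "square_integrable M (S n)"
    have "(\<integral>x. S n x * v x \<partial>M) - (\<integral>x. u x * v x \<partial>M) = (\<integral>x. (S n x - u x) * v x \<partial>M)"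
      unfolding left_diff_distrib
      by (rule Bochner_Integration.integral_diff[symmetric])
        (rule square_integrable_mult[OF Sn v] square_integrable_mult[OF u v])+
    then show "norm ((\<integral>x. S n x * v x \<partial>M) - (\<integral>x. u x * v x \<partial>M))
      \<le> sqrt ((\<integral>x. (S n x - u x)\<^sup>2 \<partial>M) * (\<integral>x. (v x)\<^sup>2 \<partial>M))"
      using real_sqrt_le_mono[OF square_integrable_Cauchy_Schwarz[OF square_integrable_diff[OF Sn u] v]]
      by (simp only: real_sqrt_abs real_norm_def)
  qed (fact lim0)
  then show ?thesis by (rule LIM_zero_cancel)
qed

lemma square_integrable_tendsto_norm:
  assumes S: "\<And>n. square_integrable M (S n)" and u: "square_integrable M u"
    and lim: "((\<lambda>n. \<integral>x. (S n x - u x)\<^sup>2 \<partial>M) \<longlongrightarrow> 0) F"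
  shows "((\<lambda>n. \<integral>x. (S n x)\<^sup>2 \<partial>M) \<longlongrightarrow> (\<integral>x. (u x)\<^sup>2 \<partial>M)) F"
proof -
  have "(\<integral>x. (S n x)\<^sup>2 \<partial>M) = (\<integral>x. (S n x - u x)\<^sup>2 \<partial>M) + 2 * (\<integral>x. S n x * u x \<partial>M) - (\<integral>x. u x * u x \<partial>M)" for n
  proof -
    have "(\<integral>x. (S n x)\<^sup>2 \<partial>M) = (\<integral>x. (S n x - u x)\<^sup>2 + 2 * (S n x * u x) - u x * u x \<partial>M)"
      by (simp add: power2_eq_square algebra_simps)
    then show ?thesis
      using square_integrable_mult[OF S u, of n] square_integrable_mult[OF u u]
        square_integrable_diff[OF S u, of n] unfolding square_integrable_def by simp
  qed
  moreover have "((\<lambda>n. (\<integral>x. (S n x - u x)\<^sup>2 \<partial>M) + 2 * (\<integral>x. S n x * u x \<partial>M) - (\<integral>x. u x * u x \<partial>M))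
      \<longlongrightarrow> 0 + 2 * (\<integral>x. u x * u x \<partial>M) - (\<integral>x. u x * u x \<partial>M)) F"
    by (intro tendsto_intros lim square_integrable_tendsto_inner[OF always_eventually[OF allI[OF S]] u u])
  ultimately show ?thesis by (simp add: power2_eq_square)
qed

text \<open>Riesz-Fischer. Finite mass makes an L^2 Cauchy sequence Cauchy in L^1, so a subsequence
  converges almost everywhere; Fatou's lemma then bounds the L^2 distance of every late term to that
  limit.\<close>

lemma (in finite_measure) square_integrable_complete:
  assumes S: "\<And>n. square_integrable M (S n)"
    and cauchy: "\<And>e. 0 < e \<Longrightarrow> \<exists>N. \<forall>i\<ge>N. \<forall>j\<ge>N. (\<integral>x. (S i x - S j x)\<^sup>2 \<partial>M) < e"
  obtains u where "square_integrable M u" "(\<lambda>n. \<integral>x. (S n x - u x)\<^sup>2 \<partial>M) \<longlonglongrightarrow> 0"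
proof -
  have [measurable]: "S n \<in> borel_measurable M" for n using S by (simp add: square_integrable_def)
  have S_int: "integrable M (S n)" for n
    using S[of n] unfolding square_integrable_def by (blast intro: square_integrable_imp_integrable)
  let ?m = "measure M (space M)"
  have L1: "(\<integral>x. norm (S i x - S j x) \<partial>M)\<^sup>2 \<le> (\<integral>x. (S i x - S j x)\<^sup>2 \<partial>M) * ?m" for i j
  proof -
    have "square_integrable M (\<lambda>x. norm (S i x - S j x))"
      using square_integrable_diff[OF S S, of i j] by (auto simp: square_integrable_def)
    moreover have "square_integrable M (\<lambda>x. 1)" by (simp add: square_integrable_def)
    ultimately show ?thesis
      using square_integrable_Cauchy_Schwarz[of M "\<lambda>x. norm (S i x - S j x)" "\<lambda>x. 1"] by simp
  qed
  obtain r where r: "strict_mono r" "AE x in M. Cauchy (\<lambda>i. S (r i) x)"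
  proof (rule cauchy_L1_AE_cauchy_subseq[OF S_int])
    fix e :: real assume e: "0 < e"
    \<comment> \<open>The added 1 covers a space of total mass zero.\<close>
    have "0 < e\<^sup>2 / (?m + 1)" using e by (intro divide_pos_pos) (auto intro: add_nonneg_pos)
    from cauchy[OF this] obtain N where N: "\<And>i j. i \<ge> N \<Longrightarrow> j \<ge> N \<Longrightarrow> (\<integral>x. (S i x - S j x)\<^sup>2 \<partial>M) < e\<^sup>2 / (?m + 1)"
      by blast
    have "(\<integral>x. norm (S i x - S j x) \<partial>M) < e" if "i \<ge> N" "j \<ge> N" for i j
    proof (rule power2_less_imp_less)
      have "(\<integral>x. (S i x - S j x)\<^sup>2 \<partial>M) * ?m \<le> (\<integral>x. (S i x - S j x)\<^sup>2 \<partial>M) * (?m + 1)"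
        by (intro mult_left_mono) auto
      also have "\<dots> < e\<^sup>2"
        using N[OF that] by (simp add: pos_less_divide_eq add_nonneg_pos)
      finally show "(\<integral>x. norm (S i x - S j x) \<partial>M)\<^sup>2 < e\<^sup>2" using L1[of i j] by simp
    qed (use e in simp)
    then show "\<exists>N. \<forall>i\<ge>N. \<forall>j\<ge>N. (\<integral>x. norm (S i x - S j x) \<partial>M) < e" by blast
  qed blast
  define u where "u x = lim (\<lambda>i. S (r i) x)" for x
  have u_meas[measurable]: "u \<in> borel_measurable M" unfolding u_def by measurable
  have u_lim: "AE x in M. (\<lambda>i. S (r i) x) \<longlonglongrightarrow> u x"
    using r(2) by eventually_elim (auto simp: u_def Cauchy_convergent_iff convergent_LIMSEQ_iff)
  have bound: "integrable M (\<lambda>x. (S n x - u x)\<^sup>2) \<and> (\<integral>x. (S n x - u x)\<^sup>2 \<partial>M) \<le> e"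
    if e: "0 < e" and N: "\<And>j. j \<ge> N \<Longrightarrow> (\<integral>x. (S n x - S j x)\<^sup>2 \<partial>M) < e" for n N e
  proof -
    have "(\<integral>\<^sup>+x. ennreal ((S n x - u x)\<^sup>2) \<partial>M) = (\<integral>\<^sup>+x. liminf (\<lambda>i. ennreal ((S n x - S (r i) x)\<^sup>2)) \<partial>M)"
    proof (rule nn_integral_cong_AE)
      show "AE x in M. ennreal ((S n x - u x)\<^sup>2) = liminf (\<lambda>i. ennreal ((S n x - S (r i) x)\<^sup>2))"
        using u_lim
      proof eventually_elim
        case (elim x)
        then have "(\<lambda>i. ennreal ((S n x - S (r i) x)\<^sup>2)) \<longlonglongrightarrow> ennreal ((S n x - u x)\<^sup>2)"
          by (intro tendsto_intros)
        then show ?case by (rule lim_imp_Liminf[OF trivial_limit_sequentially, symmetric])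
      qed
    qed
    also have "\<dots> \<le> liminf (\<lambda>i. \<integral>\<^sup>+x. ennreal ((S n x - S (r i) x)\<^sup>2) \<partial>M)"
      by (rule nn_integral_liminf) simp
    also have "\<dots> \<le> ennreal e"
    proof (rule Liminf_le)
      show "\<forall>\<^sub>F i in sequentially. (\<integral>\<^sup>+x. ennreal ((S n x - S (r i) x)\<^sup>2) \<partial>M) \<le> ennreal e"
        using eventually_ge_at_top[of N]
      proof eventually_elim
        case (elim i)
        then have "N \<le> r i" using strict_mono_imp_increasing[OF r(1), of i] by simp
        then show ?case
          using N[of "r i"] square_integrable_diff[OF S S, of n "r i"]
          by (subst nn_integral_eq_integral) (auto simp: square_integrable_def intro!: ennreal_leI)
      qed
    qed simp
    finally have *: "(\<integral>\<^sup>+x. ennreal ((S n x - u x)\<^sup>2) \<partial>M) \<le> ennreal e" .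
    then have i: "integrable M (\<lambda>x. (S n x - u x)\<^sup>2)"
      by (intro integrableI_nonneg AE_I2 le_less_trans[OF *]) simp_all
    then show ?thesis using * e by (simp add: nn_integral_eq_integral)
  qed
  show ?thesis
  proof
    obtain N where "\<forall>i\<ge>N. \<forall>j\<ge>N. (\<integral>x. (S i x - S j x)\<^sup>2 \<partial>M) < 1" using cauchy[of 1] by auto
    then have "square_integrable M (\<lambda>x. S N x - u x)"
      using bound[of 1 N N] by (auto simp: square_integrable_def)
    from square_integrable_diff[OF S[of N] this] show "square_integrable M u" by simp
    show "(\<lambda>n. \<integral>x. (S n x - u x)\<^sup>2 \<partial>M) \<longlonglongrightarrow> 0"
    proof (rule LIMSEQ_I)
      fix e :: real assume e: "0 < e"
      obtain N where N: "\<forall>i\<ge>N. \<forall>j\<ge>N. (\<integral>x. (S i x - S j x)\<^sup>2 \<partial>M) < e / 2"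
        using cauchy[of "e / 2"] e by auto
      have "norm ((\<integral>x. (S n x - u x)\<^sup>2 \<partial>M) - 0) < e" if "n \<ge> N" for n
      proof -
        have "(\<integral>x. (S n x - u x)\<^sup>2 \<partial>M) \<le> e / 2"
          using bound[of "e / 2" N n] e N that by simp
        then show ?thesis using e by simp
      qed
      then show "\<exists>N. \<forall>n\<ge>N. norm ((\<integral>x. (S n x - u x)\<^sup>2 \<partial>M) - 0) < e" by blast
    qed
  qed
qed

section \<open>The sine system on (0,pi)\<close>

abbreviation Mpi :: "real measure" where
  "Mpi \<equiv> restrict_space lborel {0<..<pi}"

lemma set_integral_Mpi: "(LINT x:{0<..<pi}|lborel. h x) = integral\<^sup>L Mpi h" for h :: "real \<Rightarrow> real"
  by (subst integral_restrict_space) (auto simp: set_lebesgue_integral_def)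

lemma L2_iff: "L2 u \<longleftrightarrow> square_integrable Mpi u"
  unfolding L2_def square_integrable_def set_borel_measurable_def set_integrable_def
  by (simp add: integrable_restrict_space borel_measurable_restrict_space_iff)

lemma L2_eq_iff: "L2_eq u v \<longleftrightarrow> (AE x in Mpi. u x = v x)"
  unfolding L2_eq_def by (subst AE_restrict_space_iff) auto

lemma L2_dist2_eq: "L2_dist2 u v = (\<integral>x. (u x - v x)\<^sup>2 \<partial>Mpi)"
  unfolding L2_dist2_def by (rule set_integral_Mpi)

interpretation Mpi: finite_measure Mpi
  by (rule finite_measureI) (simp add: space_restrict_space emeasure_restrict_space)

lemma measurable_Mpi: "u \<in> borel_measurable borel \<Longrightarrow> u \<in> borel_measurable Mpi"
  by (rule measurable_restrict_space1) simp

lemma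
  fixes h :: "real \<Rightarrow> real"
  assumes h: "continuous_on {0..pi} h"
  shows integrable_Mpi_continuous: "integrable Mpi h"
    and integral_Mpi_continuous: "integral\<^sup>L Mpi h = integral {0..pi} h"
proof -
  have i: "set_integrable lborel {0<..<pi} h"
    by (rule set_integrable_subset[OF borel_integrable_atLeastAtMost'[OF h]]) auto
  then show "integrable Mpi h"
    unfolding set_integrable_def by (subst integrable_restrict_space) auto
  show "integral\<^sup>L Mpi h = integral {0..pi} h"
    using set_borel_integral_eq_integral(2)[OF i] set_integral_Mpi[of h] integral_open_interval_real[of 0 pi h]
    by simp
qed

lemma square_integrable_continuous:
  assumes h: "continuous_on {0..pi} h"
  shows "square_integrable Mpi h"
  unfolding square_integrable_def
  using integrable_Mpi_continuous[OF h] integrable_Mpi_continuous[OF continuous_on_power[OF h, of 2]] by auto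

text \<open>The frequency is shifted by one so that the natural numbers enumerate exactly the
  Dirichlet eigenfunctions; the eigenvalue of index n is
  \<open>- (real (Suc n))\<^sup>2\<close>.\<close>

definition sine :: "nat \<Rightarrow> real \<Rightarrow> real" where
  "sine n x = sin (real (Suc n) * x)"

lemma continuous_on_sine: "continuous_on A (sine n)"
  unfolding sine_def by (intro continuous_intros)

lemma square_integrable_sine: "square_integrable Mpi (sine n)"
  by (rule square_integrable_continuous[OF continuous_on_sine])

lemma integral_cos_pi:
  assumes "k \<noteq> 0" "k \<in> \<int>"
  shows "((\<lambda>x. cos (k * x)) has_integral 0) {0..pi}"
proof -
  have "((\<lambda>x. cos (k * x)) has_integral sin (k * pi) / k - sin (k * 0) / k) {0..pi}"
    using assms(1) by (intro fundamental_theorem_of_calculus)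
      (auto intro!: derivative_eq_intros simp flip: has_real_derivative_iff_has_vector_derivative)
  moreover have "sin (k * pi) = 0" using assms(2) by (simp only: sin_times_pi_eq_0)
  ultimately show ?thesis by simp
qed

lemma integral_sine_sine: "(\<integral>x. sine m x * sine n x \<partial>Mpi) = (if m = n then pi / 2 else 0)"
proof -
  have eq: "sine m x * sine n x = (cos ((real m - real n) * x) - cos ((real m + real n + 2) * x)) / 2" for x
    unfolding sine_def by (simp add: sin_times_sin algebra_simps)
  have 2: "((\<lambda>x. cos ((real m + real n + 2) * x)) has_integral 0) {0..pi}"
    by (rule integral_cos_pi) (auto intro: Ints_add)
  have "((\<lambda>x. sine m x * sine n x) has_integral (if m = n then pi / 2 else 0)) {0..pi}"
  proof (cases "m = n")
    case True
    have "((\<lambda>x. (1 - cos ((real m + real n + 2) * x)) / 2) has_integral ((pi - 0) - 0) / 2) {0..pi}"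
      using has_integral_const_real[of "1::real" 0 pi] by (intro has_integral_divide has_integral_diff 2) simp
    then show ?thesis using True unfolding eq by simp
  next
    case False
    have "((\<lambda>x. (cos ((real m - real n) * x) - cos ((real m + real n + 2) * x)) / 2) has_integral (0 - 0) / 2) {0..pi}"
      using False by (intro has_integral_divide has_integral_diff 2 integral_cos_pi) auto
    then show ?thesis using False unfolding eq by simp
  qed
  then have "integral {0..pi} (\<lambda>x. sine m x * sine n x) = (if m = n then pi / 2 else 0)"
    by (rule integral_unique)
  then show ?thesis
    by (subst integral_Mpi_continuous) (intro continuous_intros continuous_on_sine)
qed

text \<open>\<open>sgn k\<close> is an almost everywhere limit of continuous functions bounded by 1; test against these.\<close>
lemma AE_eq_0_if_orthogonal_continuous:
  fixes k :: "real \<Rightarrow> real"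
  assumes k: "integrable Mpi k"
    and orth: "\<And>\<phi>. continuous_on UNIV \<phi> \<Longrightarrow> (\<integral>x. k x * \<phi> x \<partial>Mpi) = 0"
  shows "AE x in Mpi. k x = 0"
proof -
  let ?s = "\<lambda>x. indicator {0<..<pi} x * sgn (k x)"
  have k_meas: "(\<lambda>x. indicator {0<..<pi} x *\<^sub>R k x) \<in> borel_measurable lborel"
    using k by (subst borel_measurable_restrict_space_iff[symmetric]) auto
  have "(\<lambda>x. sgn (indicator {0<..<pi} x *\<^sub>R k x)) \<in> borel_measurable lborel"
    using k_meas by measurable
  also have "(\<lambda>x. sgn (indicator {0<..<pi} x *\<^sub>R k x)) = ?s" by (auto simp: indicator_def)
  finally have "?s \<in> borel_measurable lebesgue" by (intro measurable_completion) simp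
  then have "?s measurable_on UNIV" by (rule lebesgue_measurable_imp_measurable_on) simp
  then obtain D g where D: "negligible D" and g: "\<And>n. continuous_on UNIV (g n)"
    and lim: "\<And>x. x \<notin> D \<Longrightarrow> (\<lambda>n. g n x) \<longlonglongrightarrow> ?s x"
    unfolding measurable_on_def by auto
  \<comment> \<open>Clamping to [-1,1] makes |k| a dominating function and does not move the limit,
    whose values already lie there.\<close>
  define h where "h n x = max (- 1) (min 1 (g n x))" for n and x :: real
  have h_cont: "continuous_on UNIV (h n)" for n
    unfolding h_def by (intro continuous_intros g)
  have h_lim: "(\<lambda>n. h n x) \<longlonglongrightarrow> ?s x" if "x \<notin> D" for x
  proof -
    have "(\<lambda>n. h n x) \<longlonglongrightarrow> max (- 1) (min 1 (?s x))"
      unfolding h_def by (intro tendsto_intros lim that)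
    moreover have "max (- 1) (min 1 (?s x)) = ?s x" by (auto simp: indicator_def sgn_real_def)
    ultimately show ?thesis by simp
  qed
  have "AE x in lborel. x \<notin> D"
    using D AE_not_in[of D lebesgue] by (simp add: negligible_iff_null_sets AE_completion_iff)
  then have AE: "AE x in Mpi. x \<notin> D" by (subst AE_restrict_space_iff) auto
  have "(\<lambda>n. \<integral>x. k x * h n x \<partial>Mpi) \<longlonglongrightarrow> (\<integral>x. \<bar>k x\<bar> \<partial>Mpi)"
  proof (rule integral_dominated_convergence[where w = "\<lambda>x. \<bar>k x\<bar>"])
    show "AE x in Mpi. (\<lambda>n. k x * h n x) \<longlonglongrightarrow> \<bar>k x\<bar>"
      using AE AE_space
    proof eventually_elim
      case (elim x)
      then have "(\<lambda>n. k x * h n x) \<longlonglongrightarrow> k x * ?s x" by (intro tendsto_intros h_lim)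
      moreover have "k x * ?s x = \<bar>k x\<bar>"
        using elim by (auto simp: space_restrict_space sgn_real_def)
      ultimately show ?case by simp
    qed
    show "AE x in Mpi. norm (k x * h n x) \<le> \<bar>k x\<bar>" for n
      by (auto simp: abs_mult h_def intro!: mult_left_le)
    show "(\<lambda>x. k x * h n x) \<in> borel_measurable Mpi" for n
      by (intro borel_measurable_times borel_measurable_integrable[OF k] measurable_Mpi
          borel_measurable_continuous_onI h_cont)
  qed (use k in auto)
  then have "(\<integral>x. \<bar>k x\<bar> \<partial>Mpi) = 0"
    using LIMSEQ_unique[OF _ tendsto_const] by (simp add: orth[OF h_cont])
  then show ?thesis
    using k by (subst (asm) integral_nonneg_eq_0_iff_AE) auto
qed

text \<open>\<open>sin x * cos x ^ j\<close> is a combination of sines, so \<open>u * sin\<close> is orthogonal to all polynomials in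
  \<open>cos x\<close>, which are uniformly dense in the continuous functions on \<open>[0, pi]\<close>.\<close>
lemma sine_system_complete:
  assumes u: "square_integrable Mpi u" and orth: "\<And>n. (\<integral>x. u x * sine n x \<partial>Mpi) = 0"
  shows "AE x in Mpi. u x = 0"
proof -
  have int: "integrable Mpi (\<lambda>x. u x * \<phi> x)" if "continuous_on {0..pi} \<phi>" for \<phi>
    by (rule square_integrable_mult[OF u square_integrable_continuous[OF that]])
  \<comment> \<open>The frequency m must stay general: the product formula trades one factor cos x
    for the average of the frequencies m + 1 and m - 1.\<close>
  have pow: "(\<integral>x. u x * (sin (real m * x) * cos x ^ j) \<partial>Mpi) = 0" for m j
  proof (induction j arbitrary: m)
    case 0
    show ?case using orth by (cases m) (auto simp: sine_def)
  next
    case (Suc j)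
    note IH = Suc.IH
    show ?case
    proof (cases m)
      case (Suc l)
      have "sin (real m * x) * cos x = (sin (real (Suc m) * x) + sin (real l * x)) / 2" for x
        unfolding sin_times_cos using Suc by (simp add: algebra_simps)
      then have eq: "u x * (sin (real m * x) * cos x ^ Suc j)
        = (u x * (sin (real (Suc m) * x) * cos x ^ j) + u x * (sin (real l * x) * cos x ^ j)) / 2" for x
        by (simp add: algebra_simps) (simp flip: distrib_left mult.assoc)
      have "(\<integral>x. u x * (sin (real m * x) * cos x ^ Suc j) \<partial>Mpi)
         = ((\<integral>x. u x * (sin (real (Suc m) * x) * cos x ^ j) \<partial>Mpi)
            + (\<integral>x. u x * (sin (real l * x) * cos x ^ j) \<partial>Mpi)) / 2"
        unfolding eq by (subst Bochner_Integration.integral_add[symmetric])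
          (auto intro!: int continuous_intros)
      then show ?thesis unfolding IH by simp
    qed simp
  qed
  let ?k = "\<lambda>x. u x * sin x"
  have k_int: "integrable Mpi (\<lambda>x. ?k x * \<phi> x)" if "continuous_on {0..pi} \<phi>" for \<phi>
    using int[of "\<lambda>x. sin x * \<phi> x"] that by (simp add: mult.assoc continuous_intros)
  have "AE x in Mpi. ?k x = 0"
  proof (rule AE_eq_0_if_orthogonal_continuous)
    show "integrable Mpi ?k" by (intro int continuous_intros)
    fix \<phi> :: "real \<Rightarrow> real" assume \<phi>: "continuous_on UNIV \<phi>"
    let ?A = "\<integral>x. \<bar>?k x\<bar> \<partial>Mpi"
    have "\<bar>\<integral>x. ?k x * \<phi> x \<partial>Mpi\<bar> \<le> 0 + e" if e: "0 < e" for e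
    proof -
      \<comment> \<open>Chosen so that an approximation error d, integrated against |u sin|, costs
        at most e; the added 1 keeps the denominator positive.\<close>
      define d where "d = e / (?A + 1)"
      have A: "0 < ?A + 1" by (rule add_nonneg_pos) auto
      then have d: "0 < d" using e by (simp add: d_def)
      \<comment> \<open>In the variable y = cos x, which maps [0,pi] bijectively onto [-1,1], the
        test function becomes continuous on [-1,1], where polynomials are dense.\<close>
      have "continuous_on {- 1..1} (\<lambda>y. \<phi> (arccos y))"
        by (rule continuous_on_compose2[OF \<phi> continuous_on_arccos']) auto
      then obtain p where p: "real_polynomial_function p" "\<And>y. y \<in> {- 1..1} \<Longrightarrow> \<bar>\<phi> (arccos y) - p y\<bar> < d"
        using Stone_Weierstrass_real_polynomial_function[OF compact_Icc _ d] by blast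
      obtain a n where a: "p = (\<lambda>y. \<Sum>i\<le>n. a i * y ^ i)"
        using p(1) unfolding real_polynomial_function_iff_sum by auto
      have "(\<integral>x. ?k x * p (cos x) \<partial>Mpi) = (\<integral>x. (\<Sum>i\<le>n. a i * (u x * (sin (real 1 * x) * cos x ^ i))) \<partial>Mpi)"
        by (simp add: a sum_distrib_left mult_ac)
      also have "\<dots> = (\<Sum>i\<le>n. a i * (\<integral>x. u x * (sin (real 1 * x) * cos x ^ i) \<partial>Mpi))"
        by (subst Bochner_Integration.integral_sum) (auto intro!: integrable_mult_right int continuous_intros)
      finally have 0: "(\<integral>x. ?k x * p (cos x) \<partial>Mpi) = 0" unfolding pow by simp
      have p_cont: "continuous_on {0..pi} (\<lambda>x. p (cos x))" unfolding a by (intro continuous_intros)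
      have \<phi>_cont: "continuous_on {0..pi} \<phi>" using \<phi> by (rule continuous_on_subset) simp
      have "\<bar>\<integral>x. ?k x * \<phi> x \<partial>Mpi\<bar> = \<bar>\<integral>x. ?k x * \<phi> x - ?k x * p (cos x) \<partial>Mpi\<bar>"
        using k_int[OF p_cont] k_int[OF \<phi>_cont] 0 by simp
      also have "\<dots> \<le> (\<integral>x. \<bar>?k x * \<phi> x - ?k x * p (cos x)\<bar> \<partial>Mpi)"
        by (rule integral_abs_bound)
      also have "\<dots> \<le> (\<integral>x. \<bar>?k x\<bar> * d \<partial>Mpi)"
      proof (rule integral_mono)
        show "integrable Mpi (\<lambda>x. \<bar>?k x * \<phi> x - ?k x * p (cos x)\<bar>)"
          by (rule integrable_abs[OF Bochner_Integration.integrable_diff[OF k_int[OF \<phi>_cont] k_int[OF p_cont]]])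
        show "integrable Mpi (\<lambda>x. \<bar>?k x\<bar> * d)"
          using k_int[of "\<lambda>_. 1"] by (intro integrable_mult_left integrable_abs) simp
        fix x assume "x \<in> space Mpi"
        then have x: "x \<in> {0<..<pi}" by (simp add: space_restrict_space)
        have "\<bar>?k x * \<phi> x - ?k x * p (cos x)\<bar> = \<bar>?k x\<bar> * \<bar>\<phi> (arccos (cos x)) - p (cos x)\<bar>"
          using x by (simp add: arccos_cos abs_mult flip: right_diff_distrib)
        also have "\<dots> \<le> \<bar>?k x\<bar> * d"
          using p(2)[of "cos x"] by (intro mult_left_mono) auto
        finally show "\<bar>?k x * \<phi> x - ?k x * p (cos x)\<bar> \<le> \<bar>?k x\<bar> * d" .
      qed
      also have "\<dots> = ?A * d" by simp
      also have "\<dots> \<le> (?A + 1) * d" using d by (intro mult_right_mono) auto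
      also have "\<dots> = e" using A by (simp add: d_def)
      finally show ?thesis by simp
    qed
    then have "\<bar>\<integral>x. ?k x * \<phi> x \<partial>Mpi\<bar> \<le> 0" by (rule field_le_epsilon)
    then show "(\<integral>x. ?k x * \<phi> x \<partial>Mpi) = 0" by simp
  qed
  \<comment> \<open>The extra factor sin x can be divided out because it is positive on
    (0,pi).\<close>
  with AE_space show ?thesis
  proof eventually_elim
    case (elim x)
    then have "0 < sin x" by (intro sin_gt_zero) (auto simp: space_restrict_space)
    then show ?case using elim by auto
  qed
qed

section \<open>Parseval's identity and L^2-convergent sine series\<close>

lemma sine_sum_norm: "finite I \<Longrightarrow> (\<integral>x. (\<Sum>k\<in>I. c k * sine k x)\<^sup>2 \<partial>Mpi) = pi / 2 * (\<Sum>k\<in>I. (c k)\<^sup>2)"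
proof -
  assume I: "finite I"
  have i: "integrable Mpi (\<lambda>x. sine k x * sine l x)" for k l
    by (rule square_integrable_mult[OF square_integrable_sine square_integrable_sine])
  have "(\<integral>x. (\<Sum>k\<in>I. c k * sine k x)\<^sup>2 \<partial>Mpi) = (\<integral>x. (\<Sum>k\<in>I. \<Sum>l\<in>I. (c k * c l) * (sine k x * sine l x)) \<partial>Mpi)"
    by (simp add: power2_eq_square sum_product mult_ac)
  also have "\<dots> = (\<Sum>k\<in>I. \<Sum>l\<in>I. (c k * c l) * (\<integral>x. sine k x * sine l x \<partial>Mpi))"
    using i by (simp add: Bochner_Integration.integral_sum)
  also have "\<dots> = pi / 2 * (\<Sum>k\<in>I. (c k)\<^sup>2)"
    using I by (simp add: integral_sine_sine if_distrib[of "\<lambda>z. _ * z"] sum.delta sum_distrib_left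
        power2_eq_square mult_ac cong: if_cong)
  finally show ?thesis .
qed

definition sine_limit :: "(nat \<Rightarrow> real) \<Rightarrow> (real \<Rightarrow> real) \<Rightarrow> bool" where
  "sine_limit c u \<longleftrightarrow> square_integrable Mpi u \<and>
     (\<lambda>n. \<integral>x. ((\<Sum>k<n. c k * sine k x) - u x)\<^sup>2 \<partial>Mpi) \<longlonglongrightarrow> 0"

lemma square_integrable_sine_sum: "square_integrable Mpi (\<lambda>x. \<Sum>k<n. c k * sine k x)"
  by (intro square_integrable_sum square_integrable_cmult square_integrable_sine)

text \<open>Orthogonality turns the distance of two partial sums into a block of the series of
  squared coefficients, so the Cauchy criterion carries over and completeness applies.\<close>

lemma sine_limit_exists:
  assumes c: "summable (\<lambda>k. (c k)\<^sup>2)"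
  shows "\<exists>u. sine_limit c u"
proof -
  let ?S = "\<lambda>n x. \<Sum>k<n. c k * sine k x"
  have dist: "(\<integral>x. (?S i x - ?S j x)\<^sup>2 \<partial>Mpi) = pi / 2 * norm (sum (\<lambda>k. (c k)\<^sup>2) {min i j..<max i j})" for i j
  proof -
    have "(?S i x - ?S j x)\<^sup>2 = (\<Sum>k\<in>{min i j..<max i j}. c k * sine k x)\<^sup>2" for x
    proof (cases "i \<le> j")
      case True
      then have "?S j x - ?S i x = (\<Sum>k\<in>{i..<j}. c k * sine k x)"
        using sum_diff_nat_ivl[of 0 i j "\<lambda>k. c k * sine k x"] by (simp add: lessThan_atLeast0)
      then show ?thesis using True by (subst power2_commute) simp
    next
      case False
      then have "?S i x - ?S j x = (\<Sum>k\<in>{j..<i}. c k * sine k x)"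
        using sum_diff_nat_ivl[of 0 j i "\<lambda>k. c k * sine k x"] by (simp add: lessThan_atLeast0)
      then show ?thesis using False by (simp add: min_def max_def)
    qed
    then show ?thesis by (simp add: sine_sum_norm sum_nonneg)
  qed
  obtain u where "square_integrable Mpi u" "(\<lambda>n. \<integral>x. (?S n x - u x)\<^sup>2 \<partial>Mpi) \<longlonglongrightarrow> 0"
  proof (rule Mpi.square_integrable_complete[of ?S])
    fix e :: real assume e: "0 < e"
    then have "0 < e / pi" by simp
    then obtain N where N: "\<And>m n. m \<ge> N \<Longrightarrow> norm (sum (\<lambda>k. (c k)\<^sup>2) {m..<n}) < e / pi"
      using c unfolding summable_Cauchy by blast
    show "\<exists>N. \<forall>i\<ge>N. \<forall>j\<ge>N. (\<integral>x. (?S i x - ?S j x)\<^sup>2 \<partial>Mpi) < e"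
    proof (intro exI allI impI)
      fix i j assume "N \<le> i" "N \<le> j"
      then have "norm (sum (\<lambda>k. (c k)\<^sup>2) {min i j..<max i j}) < e / pi" by (intro N) simp
      then have "pi / 2 * norm (sum (\<lambda>k. (c k)\<^sup>2) {min i j..<max i j}) < pi / 2 * (e / pi)"
        by (intro mult_strict_left_mono) auto
      then show "(\<integral>x. (?S i x - ?S j x)\<^sup>2 \<partial>Mpi) < e" unfolding dist using e by simp
    qed
  qed (rule square_integrable_sine_sum, blast)
  then show ?thesis by (auto simp: sine_limit_def)
qed

lemma sine_limit_inner:
  assumes "sine_limit c u" and v: "square_integrable Mpi v"
  shows "(\<lambda>k. c k * (\<integral>x. sine k x * v x \<partial>Mpi)) sums (\<integral>x. u x * v x \<partial>Mpi)"
proof -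
  have "(\<lambda>n. \<integral>x. (\<Sum>k<n. c k * sine k x) * v x \<partial>Mpi) \<longlonglongrightarrow> (\<integral>x. u x * v x \<partial>Mpi)"
    using assms unfolding sine_limit_def
    by (intro square_integrable_tendsto_inner always_eventually allI square_integrable_sine_sum) auto
  moreover have "(\<integral>x. (\<Sum>k<n. c k * sine k x) * v x \<partial>Mpi) = (\<Sum>k<n. c k * (\<integral>x. sine k x * v x \<partial>Mpi))" for n
    using square_integrable_mult[OF square_integrable_sine v]
    by (simp add: sum_distrib_right mult.assoc Bochner_Integration.integral_sum)
  ultimately show ?thesis by (simp add: sums_def)
qed

lemma sine_limit_coeff:
  assumes "sine_limit c u"
  shows "(\<integral>x. u x * sine n x \<partial>Mpi) = pi / 2 * c n"
proof -
  have "(\<lambda>k. if k = n then pi / 2 * c n else 0) sums (\<integral>x. u x * sine n x \<partial>Mpi)"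
    using sine_limit_inner[OF assms square_integrable_sine[of n]]
    by (simp add: integral_sine_sine if_distrib[of "\<lambda>z. _ * z"] mult.commute cong: if_cong)
  then show ?thesis using sums_single[of n "\<lambda>_. pi / 2 * c n"] sums_unique2 by blast
qed

text \<open>Needed to apply Parseval's identity to the difference of two time slices; the error is
  split by (p - q)^2 \<le> 2 p^2 + 2 q^2.\<close>

lemma sine_limit_diff:
  assumes u: "sine_limit c u" and v: "sine_limit d v"
  shows "sine_limit (\<lambda>k. c k - d k) (\<lambda>x. u x - v x)"
proof -
  let ?S = "\<lambda>c n x. \<Sum>k<n. c k * sine k x"
  have s: "square_integrable Mpi u" "square_integrable Mpi v"
    and l: "(\<lambda>n. \<integral>x. (?S c n x - u x)\<^sup>2 \<partial>Mpi) \<longlonglongrightarrow> 0" "(\<lambda>n. \<integral>x. (?S d n x - v x)\<^sup>2 \<partial>Mpi) \<longlonglongrightarrow> 0"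
    using u v by (auto simp: sine_limit_def)
  have "(\<lambda>n. \<integral>x. (?S (\<lambda>k. c k - d k) n x - (u x - v x))\<^sup>2 \<partial>Mpi) \<longlonglongrightarrow> 0"
  proof (rule tendsto_sandwich[OF _ _ tendsto_const])
    let ?B = "\<lambda>n. 2 * (\<integral>x. (?S c n x - u x)\<^sup>2 \<partial>Mpi) + 2 * (\<integral>x. (?S d n x - v x)\<^sup>2 \<partial>Mpi)"
    show "?B \<longlonglongrightarrow> 0" using tendsto_add[OF tendsto_mult_left[OF l(1), of 2] tendsto_mult_left[OF l(2), of 2]] by simp
    show "\<forall>\<^sub>F n in sequentially. (\<integral>x. (?S (\<lambda>k. c k - d k) n x - (u x - v x))\<^sup>2 \<partial>Mpi) \<le> ?B n"
    proof (intro always_eventually allI)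
      fix n
      let ?a = "\<lambda>x. ?S c n x - u x" and ?b = "\<lambda>x. ?S d n x - v x"
      have ab: "square_integrable Mpi ?a" "square_integrable Mpi ?b"
        by (intro square_integrable_diff square_integrable_sine_sum s)+
      have "(\<integral>x. (?S (\<lambda>k. c k - d k) n x - (u x - v x))\<^sup>2 \<partial>Mpi) = (\<integral>x. (?a x - ?b x)\<^sup>2 \<partial>Mpi)"
        by (simp add: left_diff_distrib sum_subtractf algebra_simps)
      also have "\<dots> \<le> (\<integral>x. 2 * (?a x)\<^sup>2 + 2 * (?b x)\<^sup>2 \<partial>Mpi)"
      proof (rule integral_mono)
        have sq: "(p - q)\<^sup>2 \<le> 2 * p\<^sup>2 + 2 * q\<^sup>2" for p q :: real
          using zero_le_power2[of "p + q"] by (simp add: power2_eq_square algebra_simps)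
        show "(?a x - ?b x)\<^sup>2 \<le> 2 * (?a x)\<^sup>2 + 2 * (?b x)\<^sup>2" for x
          using sq .
      qed (use ab square_integrable_diff[OF ab] in \<open>auto simp: square_integrable_def\<close>)
      also have "\<dots> = ?B n" using ab by (simp add: square_integrable_def)
      finally show "(\<integral>x. (?S (\<lambda>k. c k - d k) n x - (u x - v x))\<^sup>2 \<partial>Mpi) \<le> ?B n" .
    qed
  qed auto
  then show ?thesis using square_integrable_diff[OF s] by (simp add: sine_limit_def)
qed

lemma sine_limit_norm:
  assumes u: "sine_limit c u"
  shows "(\<lambda>k. (c k)\<^sup>2) sums (2 / pi * (\<integral>x. (u x)\<^sup>2 \<partial>Mpi))"
proof -
  have "(\<lambda>n. \<integral>x. (\<Sum>k<n. c k * sine k x)\<^sup>2 \<partial>Mpi) \<longlonglongrightarrow> (\<integral>x. (u x)\<^sup>2 \<partial>Mpi)"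
    using u unfolding sine_limit_def
    by (intro square_integrable_tendsto_norm square_integrable_sine_sum) auto
  then have "(\<lambda>n. 2 / pi * (\<integral>x. (\<Sum>k<n. c k * sine k x)\<^sup>2 \<partial>Mpi)) \<longlonglongrightarrow> 2 / pi * (\<integral>x. (u x)\<^sup>2 \<partial>Mpi)"
    by (rule tendsto_mult_left)
  then show ?thesis by (simp add: sums_def sine_sum_norm)
qed

text \<open>The L^2 sum built from the coefficients and u itself have the same sine coefficients, so
  completeness identifies them almost everywhere.\<close>

lemma sine_limit_expansion:
  assumes u: "square_integrable Mpi u" and c: "summable (\<lambda>k. (c k)\<^sup>2)"
    and coeff: "\<And>n. (\<integral>x. u x * sine n x \<partial>Mpi) = pi / 2 * c n"
  shows "sine_limit c u"
proof -
  obtain w where w: "sine_limit c w" using sine_limit_exists[OF c] by blast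
  then have w_sq: "square_integrable Mpi w" by (simp add: sine_limit_def)
  have "AE x in Mpi. u x - w x = 0"
  proof (rule sine_system_complete[OF square_integrable_diff[OF u w_sq]])
    fix n
    show "(\<integral>x. (u x - w x) * sine n x \<partial>Mpi) = 0"
      using square_integrable_mult[OF u square_integrable_sine, of n]
        square_integrable_mult[OF w_sq square_integrable_sine, of n]
      by (simp add: left_diff_distrib coeff sine_limit_coeff[OF w])
  qed
  then have "(\<integral>x. ((\<Sum>k<n. c k * sine k x) - u x)\<^sup>2 \<partial>Mpi)
      = (\<integral>x. ((\<Sum>k<n. c k * sine k x) - w x)\<^sup>2 \<partial>Mpi)" for n
    using u w_sq square_integrable_sine_sum[of c n]
    by (intro integral_cong_AE) (auto simp: square_integrable_def)
  then show ?thesis using w u by (simp add: sine_limit_def)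
qed

section \<open>Test functions\<close>

text \<open>The regularity half of \<open>test_fun\<close>, separated from the support condition so
  that it passes through products and affine substitutions.\<close>

definition smooth :: "(real \<Rightarrow> real) \<Rightarrow> bool" where
  "smooth f \<longleftrightarrow> (\<forall>k x. ((deriv ^^ k) f) differentiable (at x))"

text \<open>Exhibiting a class of functions closed under differentiation replaces any formula for
  the k-th derivative.\<close>

lemma smooth_coinduct:
  assumes f: "f \<in> S" and S: "\<And>g. g \<in> S \<Longrightarrow> \<exists>g'\<in>S. \<forall>x. (g has_real_derivative g' x) (at x)"
  shows "smooth f"
proof -
  have step: "deriv g \<in> S" "g differentiable (at x)" if "g \<in> S" for g x
  proof -
    obtain g' where g': "g' \<in> S" "\<And>x. (g has_real_derivative g' x) (at x)" using S[OF \<open>g \<in> S\<close>] by blast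
    then have "deriv g = g'" by (intro ext DERIV_imp_deriv)
    then show "deriv g \<in> S" "g differentiable (at x)"
      using g' real_differentiable_def by auto
  qed
  have "(deriv ^^ k) f \<in> S" for k by (induction k) (auto simp: f step)
  then show ?thesis unfolding smooth_def by (auto intro: step)
qed

lemma smooth_DERIV: "smooth f \<Longrightarrow> (f has_real_derivative deriv f x) (at x)"
  unfolding smooth_def by (subst DERIV_deriv_iff_real_differentiable) (metis funpow_0)

lemma smooth_deriv: "smooth f \<Longrightarrow> smooth (deriv f)"
  unfolding smooth_def by (metis comp_apply funpow_Suc_right)

text \<open>The Leibniz rule leaves the class of single products but not that of their finite
  sums.\<close>

inductive_set product_sums :: "(real \<Rightarrow> real) set" where
  prod: "smooth f \<Longrightarrow> smooth g \<Longrightarrow> (\<lambda>x. f x * g x) \<in> product_sums"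
| sum: "u \<in> product_sums \<Longrightarrow> v \<in> product_sums \<Longrightarrow> (\<lambda>x. u x + v x) \<in> product_sums"

lemma smooth_mult:
  assumes "smooth f" "smooth g" shows "smooth (\<lambda>x. f x * g x)"
proof (rule smooth_coinduct[where S = product_sums])
  fix u assume "u \<in> product_sums"
  then show "\<exists>u'\<in>product_sums. \<forall>x. (u has_real_derivative u' x) (at x)"
  proof induction
    case (prod f g)
    show ?case
      by (rule bexI[of _ "\<lambda>x. deriv f x * g x + deriv g x * f x"])
        (auto intro!: derivative_eq_intros smooth_DERIV product_sums.intros smooth_deriv prod)
  next
    case (sum u v)
    then obtain u' v' where "u' \<in> product_sums" "\<forall>x. (u has_real_derivative u' x) (at x)"
      "v' \<in> product_sums" "\<forall>x. (v has_real_derivative v' x) (at x)" by blast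
    then show ?case
      by (intro bexI[of _ "\<lambda>x. u' x + v' x"]) (auto intro!: derivative_eq_intros product_sums.intros)
  qed
qed (rule product_sums.prod[OF assms])

lemma smooth_affine:
  assumes "smooth f" shows "smooth (\<lambda>x. f (c * x + d))"
proof (rule smooth_coinduct[where S = "{\<lambda>x. e * f (c * x + d) | e f. smooth f}"])
  show "(\<lambda>x. f (c * x + d)) \<in> {\<lambda>x. e * f (c * x + d) | e f. smooth f}"
    using assms by (intro CollectI exI[of _ 1] exI[of _ f]) auto
  fix u assume "u \<in> {\<lambda>x. e * f (c * x + d) | e f. smooth f}"
  then obtain e f where u: "u = (\<lambda>x. e * f (c * x + d))" "smooth f" by blast
  show "\<exists>u'\<in>{\<lambda>x. e * f (c * x + d) | e f. smooth f}. \<forall>x. (u has_real_derivative u' x) (at x)"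
  proof (rule bexI[of _ "\<lambda>x. (e * c) * deriv f (c * x + d)"])
    have "((\<lambda>x. f (c * x + d)) has_real_derivative deriv f (c * x + d) * c) (at x)" for x
      by (rule DERIV_chain2[OF smooth_DERIV[OF u(2)]]) (auto intro!: derivative_eq_intros)
    then show "\<forall>x. (u has_real_derivative (e * c) * deriv f (c * x + d)) (at x)"
      unfolding u(1) by (auto intro!: derivative_eq_intros)
    show "(\<lambda>x. (e * c) * deriv f (c * x + d)) \<in> {\<lambda>x. e * f (c * x + d) | e f. smooth f}"
      using smooth_deriv[OF u(2)] by blast
  qed
qed

lemma smooth_trig: "smooth (\<lambda>x. a * sin (n * x) + b * cos (n * x))"
proof (rule smooth_coinduct[where S = "{\<lambda>x. a * sin (n * x) + b * cos (n * x) | a b. True}"])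
  fix u assume "u \<in> {\<lambda>x. a * sin (n * x) + b * cos (n * x) | a b. True}"
  then obtain a b where u: "u = (\<lambda>x. a * sin (n * x) + b * cos (n * x))" by blast
  show "\<exists>u'\<in>{\<lambda>x. a * sin (n * x) + b * cos (n * x) | a b. True}. \<forall>x. (u has_real_derivative u' x) (at x)"
  proof (rule bexI[of _ "\<lambda>x. (- b * n) * sin (n * x) + (a * n) * cos (n * x)"])
    show "\<forall>x. (u has_real_derivative (- b * n) * sin (n * x) + (a * n) * cos (n * x)) (at x)"
      unfolding u by (auto intro!: derivative_eq_intros)
  qed blast
qed blast

section \<open>Functions flat at the origin, smooth steps and cutoffs\<close>

definition flat :: "real poly \<Rightarrow> real \<Rightarrow> real" where
  "flat p x = (if 0 < x then poly p (1 / x) * exp (- (1 / x)) else 0)"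

text \<open>With \<open>y = 1 / x\<close>, differentiating \<open>p y * exp (- y)\<close> in \<open>x\<close> gives \<open>y\<^sup>2 * (p y - p' y) * exp (- y)\<close>.\<close>
definition flat_deriv :: "real poly \<Rightarrow> real poly" where
  "flat_deriv p = monom 1 2 * (p - pderiv p)"

lemma poly_exp_tendsto_0: "((\<lambda>y. poly p y * exp (- y)) \<longlongrightarrow> 0) at_top" for p :: "real poly"
proof -
  have "((\<lambda>y. \<Sum>i\<le>degree p. coeff p i * (y ^ i / exp y)) \<longlongrightarrow> (\<Sum>i\<le>degree p. coeff p i * 0)) at_top"
    by (intro tendsto_intros tendsto_power_div_exp_0)
  then show ?thesis by (simp add: poly_altdef sum_distrib_right exp_minus divide_inverse mult.assoc)
qed

lemma flat_tendsto_0: "(flat p \<longlongrightarrow> 0) (at_right 0)"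
proof -
  have "((\<lambda>x. poly p (inverse x) * exp (- inverse x)) \<longlongrightarrow> 0) (at_right 0)"
    by (rule filterlim_compose[OF poly_exp_tendsto_0 filterlim_inverse_at_top_right])
  moreover have "\<forall>\<^sub>F x in at_right 0. poly p (inverse x) * exp (- inverse x) = flat p x"
    using eventually_at_right_less[of 0] by eventually_elim (simp add: flat_def divide_inverse)
  ultimately show ?thesis by (rule Lim_transform_eventually)
qed

lemma flat_DERIV: "(flat p has_real_derivative flat (flat_deriv p) x) (at x)"
proof -
  consider "x < 0" | "x = 0" | "0 < x" by linarith
  then show ?thesis
  proof cases
    case 1
    have "((\<lambda>_. 0) has_real_derivative 0) (at x)" by simp
    then have "(flat p has_real_derivative 0) (at x)"
      by (rule has_field_derivative_transform_within_open[where S = "{..<0}"]) (use 1 in \<open>auto simp: flat_def\<close>)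
    then show ?thesis using 1 by (simp add: flat_def)
  next
    case 2
    have "((\<lambda>h. (flat p (0 + h) - flat p 0) / h) \<longlongrightarrow> 0) (at_right 0)"
    \<comment> \<open>Dividing by h multiplies the polynomial in 1 / h by its variable, so the right
      difference quotient at 0 is again a flat function.\<close>
    proof (rule Lim_transform_eventually[OF flat_tendsto_0[of "pCons 0 p"]])
      show "\<forall>\<^sub>F h in at_right 0. flat (pCons 0 p) h = (flat p (0 + h) - flat p 0) / h"
        using eventually_at_right_less[of 0] by eventually_elim (simp add: flat_def)
    qed
    moreover have "((\<lambda>h. (flat p (0 + h) - flat p 0) / h) \<longlongrightarrow> 0) (at_left 0)"
    proof (rule Lim_transform_eventually[OF tendsto_const])
      show "\<forall>\<^sub>F h in at_left 0. 0 = (flat p (0 + h) - flat p 0) / h"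
        by (simp add: eventually_at_filter flat_def)
    qed
    ultimately have "((\<lambda>h. (flat p (0 + h) - flat p 0) / h) \<longlongrightarrow> 0) (at 0)"
      by (simp add: filterlim_at_split)
    then show ?thesis using 2 by (simp add: DERIV_def flat_def)
  next
    case 3
    have "((\<lambda>x. poly p (1 / x) * exp (- (1 / x))) has_real_derivative
       poly (pderiv p) (1 / x) * (- (1 / x\<^sup>2)) * exp (- (1 / x)) + poly p (1 / x) * (exp (- (1 / x)) * (1 / x\<^sup>2))) (at x)"
    proof -
      have 1: "((\<lambda>x. 1 / x) has_real_derivative - (1 / x\<^sup>2)) (at x)"
        using 3 by (auto intro!: derivative_eq_intros simp: power2_eq_square)
      have 2: "((\<lambda>x. poly p (1 / x)) has_real_derivative poly (pderiv p) (1 / x) * (- (1 / x\<^sup>2))) (at x)"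
        by (rule DERIV_chain2[OF poly_DERIV 1])
      have 3: "((\<lambda>x. exp (- (1 / x))) has_real_derivative exp (- (1 / x)) * (1 / x\<^sup>2)) (at x)"
        using DERIV_chain2[OF DERIV_exp DERIV_minus[OF 1]] by simp
      show ?thesis using DERIV_mult[OF 2 3] by (simp add: mult_ac add_ac)
    qed
    also have "poly (pderiv p) (1 / x) * (- (1 / x\<^sup>2)) * exp (- (1 / x)) + poly p (1 / x) * (exp (- (1 / x)) * (1 / x\<^sup>2))
        = flat (flat_deriv p) x"
      using 3 by (simp add: flat_def flat_deriv_def poly_monom algebra_simps power_one_over)
    finally show ?thesis
      by (rule has_field_derivative_transform_within_open[where S = "{0<..}"]) (use 3 in \<open>auto simp: flat_def\<close>)
  qed
qed

text \<open>Differentiation maps \<open>flat p\<close> to \<open>flat (flat_deriv p)\<close>, so the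
  range of \<open>flat\<close> is closed; this is why \<open>flat\<close> carries an arbitrary
  polynomial.\<close>

lemma smooth_flat: "smooth (flat p)"
  by (rule smooth_coinduct[where S = "range flat"]) (auto intro!: flat_DERIV)

text \<open>Rises smoothly from 0 on the negative axis towards 1 at infinity without attaining it.
  Its derivative is an explicit nonnegative density of total mass one.\<close>

definition step :: "real \<Rightarrow> real" where
  "step x = flat 1 x"

definition step' :: "real \<Rightarrow> real" where
  "step' x = flat (monom 1 2) x"

lemma step_eq: "step x = (if 0 < x then exp (- (1 / x)) else 0)"
  by (simp add: step_def flat_def)

lemma step'_eq: "step' x = (if 0 < x then (1 / x)\<^sup>2 * exp (- (1 / x)) else 0)"
  by (simp add: step'_def flat_def poly_monom)

lemma step_DERIV: "(step has_real_derivative step' x) (at x)"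
  using flat_DERIV[of 1 x] by (simp add: step_def[abs_def] step'_def flat_deriv_def pderiv_1)

lemma smooth_step: "smooth step"
  unfolding step_def by (rule smooth_flat)

lemma step_nonneg: "0 \<le> step x" and step_le_1: "step x \<le> 1" and step'_nonneg: "0 \<le> step' x"
  by (auto simp: step_eq step'_eq)

lemma continuous_on_step': "continuous_on A step'"
  unfolding step'_def[abs_def] using flat_DERIV by (meson DERIV_isCont continuous_at_imp_continuous_on)

lemma step_tendsto: "(step \<longlongrightarrow> 1) at_top"
proof -
  have "((\<lambda>x. exp (- inverse x)) \<longlongrightarrow> exp (- 0)) (at_top :: real filter)"
    by (intro tendsto_intros tendsto_inverse_0_at_top filterlim_ident)
  then have "((\<lambda>x. exp (- inverse x)) \<longlongrightarrow> 1) (at_top :: real filter)" by simp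
  then show ?thesis
    by (rule Lim_transform_eventually)
      (use eventually_gt_at_top[of 0] in \<open>eventually_elim, simp add: step_eq divide_inverse\<close>)
qed

lemma integrable_step': "integrable lborel step'"
proof (rule integrableI_nonneg)
  have [measurable]: "step' \<in> borel_measurable borel"
    by (rule borel_measurable_continuous_onI[OF continuous_on_step'])
  show "step' \<in> borel_measurable lborel" by simp
  have "(\<integral>\<^sup>+x. ennreal (step' x) \<partial>lborel) = (\<integral>\<^sup>+x. ennreal (step' x) * indicator {0..} x \<partial>lborel)"
    by (intro nn_integral_cong) (auto simp: indicator_def step'_eq)
  also have "\<dots> = ennreal (1 - step 0)"
    by (rule nn_integral_FTC_atLeast) (auto intro: step_DERIV step'_nonneg step_tendsto)
  finally show "(\<integral>\<^sup>+x. ennreal (step' x) \<partial>lborel) < \<infinity>" by simp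
qed (auto simp: step'_nonneg)

text \<open>\<open>x * step' (k * x - 1)\<close> is controlled by \<open>z + z\<^sup>2\<close> times \<open>exp (- z)\<close> with \<open>z = 1 / (k * x - 1)\<close>.\<close>
lemma step'_weighted_le:
  assumes k: "0 < k" shows "x * (k * step' (k * x - 1)) \<le> 3"
proof (cases "0 < k * x - 1")
  case True
  define z where "z = 1 / (k * x - 1)"
  have z: "0 < z" and y: "k * x = 1 / z + 1" using True by (simp_all add: z_def)
  have e: "1 + z + z\<^sup>2 / 2 \<le> exp z" using exp_lower_Taylor_quadratic[of z] z by simp
  have "x * (k * step' (k * x - 1)) = (k * x) * (z\<^sup>2 * exp (- z))"
    using True by (simp add: step'_eq z_def mult_ac)
  also have "\<dots> = (z + z\<^sup>2) / exp z"
    using z by (simp add: y exp_minus field_simps power2_eq_square)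
  also have "\<dots> \<le> 3"
    using e z zero_le_power2[of z] by (subst pos_divide_le_eq) (simp, linarith)
  finally show ?thesis .
next
  case False
  then have "step' (k * x - 1) = 0" unfolding step'_eq by simp
  then show ?thesis by simp
qed

lemma filterlim_affine_at_top:
  "0 < x \<Longrightarrow> filterlim (\<lambda>n. real (Suc n) * x - 1) at_top sequentially"
  by real_asymp

text \<open>With y = (n+1) x - 1 the factor n+1 is (y+1)/x, and (y+1)/y^2 tends to 0 as y
  grows.\<close>

lemma step'_weighted_tendsto:
  assumes x: "0 < x" shows "(\<lambda>n. real (Suc n) * step' (real (Suc n) * x - 1)) \<longlonglongrightarrow> 0"
proof -
  have "((\<lambda>y. ((y + 1) / x) * ((1 / y)\<^sup>2 * exp (- (1 / y)))) \<longlongrightarrow> 0) at_top"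
    using x by real_asymp
  then have "((\<lambda>y. ((y + 1) / x) * step' y) \<longlongrightarrow> 0) at_top"
    by (rule Lim_transform_eventually)
      (use eventually_gt_at_top[of 0] in \<open>eventually_elim, simp add: step'_eq\<close>)
  from filterlim_compose[OF this filterlim_affine_at_top[OF x]]
  show ?thesis using x by simp
qed

text \<open>The rescaled densities concentrate at 0 from the right: substituting y = (n+1) x - 1
  moves the dependence on n into G, whose argument tends to 0 from above, while B * step'
  dominates.\<close>

lemma integral_step'_tendsto_0:
  fixes G :: "real \<Rightarrow> real"
  assumes [measurable]: "G \<in> borel_measurable borel" and B: "\<And>x. \<bar>G x\<bar> \<le> B"
    and lim: "(G \<longlongrightarrow> 0) (at_right 0)"
  shows "(\<lambda>n. LINT x|lborel. G x * (real (Suc n) * step' (real (Suc n) * x - 1))) \<longlonglongrightarrow> 0"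
proof -
  have [measurable]: "step' \<in> borel_measurable borel"
    by (rule borel_measurable_continuous_onI[OF continuous_on_step'])
  have eq: "(LINT x|lborel. G x * (real (Suc n) * step' (real (Suc n) * x - 1)))
      = (LINT y|lborel. G ((1 + y) / real (Suc n)) * step' y)" for n
  proof -
    let ?k = "real (Suc n)"
    have "(LINT x|lborel. G x * (?k * step' (?k * x - 1)))
       = (1 / ?k) * (LINT y|lborel. G (1 / ?k + 1 / ?k * y) * (?k * step' (?k * (1 / ?k + 1 / ?k * y) - 1)))"
      by (subst lborel_integral_real_affine[where c = "1 / ?k" and t = "1 / ?k"]) (simp_all del: of_nat_Suc)
    also have "\<dots> = (LINT y|lborel. (1 / ?k) * (G (1 / ?k + 1 / ?k * y) * (?k * step' (?k * (1 / ?k + 1 / ?k * y) - 1))))"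
      by (rule integral_mult_right_zero[symmetric])
    also have "\<dots> = (LINT y|lborel. G ((1 + y) / ?k) * step' y)"
      by (intro Bochner_Integration.integral_cong refl)
        (simp add: distrib_left add_divide_distrib del: of_nat_Suc)
    finally show ?thesis .
  qed
  have "(\<lambda>n. LINT y|lborel. G ((1 + y) / real (Suc n)) * step' y) \<longlonglongrightarrow> (LINT y|(lborel :: real measure). 0)"
  proof (rule integral_dominated_convergence[where w = "\<lambda>y. B * step' y"])
    show "AE y in lborel. norm (G ((1 + y) / real (Suc n)) * step' y) \<le> B * step' y" for n
      using B step'_nonneg by (auto simp: abs_mult intro!: mult_right_mono)
    show "AE y in lborel. (\<lambda>n. G ((1 + y) / real (Suc n)) * step' y) \<longlonglongrightarrow> 0"
    proof (rule AE_I2)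
      fix y :: real
      show "(\<lambda>n. G ((1 + y) / real (Suc n)) * step' y) \<longlonglongrightarrow> 0"
      proof (cases "0 < y")
        case True
        have "filterlim (\<lambda>n. (1 + y) / real (Suc n)) (at_right 0) sequentially"
          using True by real_asymp
        from tendsto_mult_left_zero[OF filterlim_compose[OF lim this]] show ?thesis .
      qed (simp add: step'_eq)
    qed
  qed (auto intro: integrable_step')
  then show ?thesis unfolding eq by simp
qed

text \<open>The shift by 1 is what makes the support compact inside (0,pi): each factor vanishes
  within distance 1/(n+1) of its endpoint.\<close>

definition cutoff :: "nat \<Rightarrow> real \<Rightarrow> real" where
  "cutoff n x = step (real (Suc n) * x - 1) * step (real (Suc n) * (pi - x) - 1)"

definition cutoff' :: "nat \<Rightarrow> real \<Rightarrow> real" where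
  "cutoff' n x = (real (Suc n) * step' (real (Suc n) * x - 1)) * step (real (Suc n) * (pi - x) - 1)
     - step (real (Suc n) * x - 1) * (real (Suc n) * step' (real (Suc n) * (pi - x) - 1))"

lemma cutoff_DERIV: "(cutoff n has_real_derivative cutoff' n x) (at x)"
proof -
  let ?k = "real (Suc n)"
  have 1: "((\<lambda>x. step (?k * x - 1)) has_real_derivative step' (?k * x - 1) * ?k) (at x)"
    by (rule DERIV_chain2[OF step_DERIV]) (auto intro!: derivative_eq_intros)
  have 2: "((\<lambda>x. step (?k * (pi - x) - 1)) has_real_derivative step' (?k * (pi - x) - 1) * (- ?k)) (at x)"
    by (rule DERIV_chain2[OF step_DERIV]) (auto intro!: derivative_eq_intros simp del: of_nat_Suc)
  show ?thesis
    using DERIV_mult[OF 1 2] unfolding cutoff_def[abs_def] cutoff'_def by (simp add: algebra_simps)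
qed

lemma cutoff_range: "0 \<le> cutoff n x" "cutoff n x \<le> 1"
  using step_nonneg step_le_1 by (auto simp: cutoff_def intro: mult_le_one)

lemma cutoff_tendsto:
  assumes "0 < x" "x < pi" shows "(\<lambda>n. cutoff n x) \<longlonglongrightarrow> 1"
proof -
  have "(\<lambda>n. cutoff n x) \<longlonglongrightarrow> 1 * 1" unfolding cutoff_def
    by (intro tendsto_mult filterlim_compose[OF step_tendsto filterlim_affine_at_top]) (use assms in auto)
  then show ?thesis by simp
qed

lemma cutoff'_abs_le:
  "\<bar>cutoff' n x\<bar> \<le> real (Suc n) * step' (real (Suc n) * x - 1) + real (Suc n) * step' (real (Suc n) * (pi - x) - 1)"
proof -
  have "\<bar>a * b - c * d\<bar> \<le> a + d" if "0 \<le> a" "0 \<le> b" "b \<le> 1" "0 \<le> c" "c \<le> 1" "0 \<le> d" for a b c d :: real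
    using mult_left_le[OF that(3,1)] mult_left_le_one_le[OF that(6,4,5)] mult_nonneg_nonneg[OF that(1,2)]
      mult_nonneg_nonneg[OF that(4,6)] that by linarith
  then show ?thesis unfolding cutoff'_def
    using step_nonneg step_le_1 step'_nonneg by simp
qed

lemma test_fun_cutoff_mult:
  assumes g: "smooth g" shows "test_fun (\<lambda>x. cutoff n x * g x)"
  unfolding test_fun_def
proof (intro conjI exI)
  let ?k = "real (Suc n)"
  have "smooth (\<lambda>x. step (?k * x + (- 1)) * step ((- ?k) * x + (?k * pi - 1)) * g x)"
    by (intro smooth_mult smooth_affine smooth_step g)
  also have "(\<lambda>x. step (?k * x + (- 1)) * step ((- ?k) * x + (?k * pi - 1)) * g x) = (\<lambda>x. cutoff n x * g x)"
    by (simp add: cutoff_def[abs_def] algebra_simps)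
  finally show "\<forall>k x. ((deriv ^^ k) (\<lambda>x. cutoff n x * g x)) differentiable (at x)"
    unfolding smooth_def .
  show "0 < 1 / ?k" "pi - 1 / ?k < pi" by simp_all
  show "\<forall>x. x \<notin> {1 / ?k..pi - 1 / ?k} \<longrightarrow> cutoff n x * g x = 0"
  proof (intro allI impI)
    fix x assume "x \<notin> {1 / ?k..pi - 1 / ?k}"
    then have "?k * x \<le> 1 \<or> ?k * (pi - x) \<le> 1" by (auto simp: field_simps)
    then show "cutoff n x * g x = 0" by (auto simp: cutoff_def step_eq simp del: of_nat_Suc)
  qed
qed

section \<open>Sine coefficients of the Dirichlet Laplacian\<close>

lemma space_Mpi: "space Mpi = {0<..<pi}"
  by (simp add: space_restrict_space)

section \<open>Integrals against cutoffs and their derivatives in the limit\<close>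

lemma integral_Mpi_reflect: "(\<integral>x. h (pi - x) \<partial>Mpi) = (\<integral>x. h x \<partial>Mpi)" for h :: "real \<Rightarrow> real"
proof -
  have "(\<integral>x. h x \<partial>Mpi) = (LINT x|lborel. indicator {0<..<pi} x * h x)"
    by (subst integral_restrict_space) auto
  also have "\<dots> = (LINT x|lborel. indicator {0<..<pi} (pi - x) * h (pi - x))"
    by (subst lborel_integral_real_affine[where c = "- 1" and t = pi]) auto
  also have "\<dots> = (LINT x|lborel. indicator {0<..<pi} x * h (pi - x))"
    by (intro Bochner_Integration.integral_cong) (auto simp: indicator_def)
  also have "\<dots> = (\<integral>x. h (pi - x) \<partial>Mpi)"
    by (subst integral_restrict_space) auto
  finally show ?thesis ..
qed

lemma continuous_on_cutoff: "continuous_on A (cutoff n)"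
  by (intro continuous_at_imp_continuous_on ballI DERIV_isCont[OF cutoff_DERIV])

lemma continuous_on_cutoff': "continuous_on A (cutoff' n)"
proof -
  have c: "continuous_on UNIV step"
    by (intro continuous_at_imp_continuous_on ballI DERIV_isCont[OF step_DERIV])
  show ?thesis unfolding cutoff'_def
    by (intro continuous_on_diff continuous_on_mult continuous_on_const continuous_on_id
        continuous_on_compose2[OF continuous_on_step'[of UNIV]] continuous_on_compose2[OF c]) auto
qed

lemma integral_cutoff_tendsto:
  assumes k: "integrable Mpi k"
  shows "(\<lambda>n. \<integral>x. k x * cutoff n x \<partial>Mpi) \<longlonglongrightarrow> (\<integral>x. k x \<partial>Mpi)"
proof (rule integral_dominated_convergence[where w = "\<lambda>x. \<bar>k x\<bar>"])
  show "(\<lambda>x. k x * cutoff n x) \<in> borel_measurable Mpi" for n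
    by (intro borel_measurable_times borel_measurable_integrable[OF k] measurable_Mpi
        borel_measurable_continuous_onI continuous_on_cutoff)
  show "AE x in Mpi. (\<lambda>n. k x * cutoff n x) \<longlonglongrightarrow> k x"
  proof (rule AE_I2)
    fix x assume "x \<in> space Mpi"
    then have "(\<lambda>n. k x * cutoff n x) \<longlonglongrightarrow> k x * 1"
      by (intro tendsto_mult tendsto_const cutoff_tendsto) (auto simp: space_Mpi)
    then show "(\<lambda>n. k x * cutoff n x) \<longlonglongrightarrow> k x" by simp
  qed
  show "AE x in Mpi. norm (k x * cutoff n x) \<le> \<bar>k x\<bar>" for n
    using cutoff_range[of n] by (auto simp: abs_mult intro!: mult_left_le)
qed (intro borel_measurable_integrable integrable_abs k)+

lemma cutoff'_measurable: "cutoff' n \<in> borel_measurable Mpi"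
  by (intro measurable_Mpi borel_measurable_continuous_onI continuous_on_cutoff')

text \<open>Linear vanishing at the right endpoint, which there compensates the growth of
  \<open>cutoff'\<close>.\<close>

lemma sin_le_dist_pi: "\<bar>sin (real m * x)\<bar> \<le> real m * \<bar>pi - x\<bar>"
proof -
  have "sin (real m * x) = - (cos (real m * pi) * sin (real m * (pi - x)))"
    using sin_diff[of "real m * pi" "real m * (pi - x)"] by (simp add: sin_npi algebra_simps)
  moreover have "\<bar>cos (real m * pi)\<bar> = 1" by (simp add: cos_npi power_abs)
  ultimately have "\<bar>sin (real m * x)\<bar> = \<bar>sin (real m * (pi - x))\<bar>" by (simp add: abs_mult)
  also have "\<dots> \<le> \<bar>real m * (pi - x)\<bar>" by (rule abs_sin_x_le_abs_x)
  finally show ?thesis by (simp add: abs_mult)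
qed

text \<open>The derivative of the cutoff grows at most like the inverse distance to the endpoints,
  and the sine vanishes linearly there. Their product stays below 6 m, a share of 3 m from each end,
  so dominated convergence works whatever k does near the boundary.\<close>

lemma integral_cutoff'_sin_tendsto:
  assumes k: "integrable Mpi k"
  shows "(\<lambda>n. \<integral>x. k x * (cutoff' n x * sin (real m * x)) \<partial>Mpi) \<longlonglongrightarrow> 0"
proof -
  have "(\<lambda>n. \<integral>x. k x * (cutoff' n x * sin (real m * x)) \<partial>Mpi) \<longlonglongrightarrow> (\<integral>x. 0 \<partial>Mpi)"
  proof (rule integral_dominated_convergence[where w = "\<lambda>x. \<bar>k x\<bar> * (6 * real m)"])
    show "(\<lambda>x. k x * (cutoff' n x * sin (real m * x))) \<in> borel_measurable Mpi" for n
      by (intro borel_measurable_times borel_measurable_integrable[OF k] cutoff'_measurable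
          measurable_Mpi) simp
    show "integrable Mpi (\<lambda>x. \<bar>k x\<bar> * (6 * real m))" using k by auto
    show "AE x in Mpi. (\<lambda>n. k x * (cutoff' n x * sin (real m * x))) \<longlonglongrightarrow> 0"
    proof (rule AE_I2)
      fix x assume "x \<in> space Mpi"
      then have x: "0 < x" "0 < pi - x" by (auto simp: space_Mpi)
      have "(\<lambda>n. cutoff' n x) \<longlonglongrightarrow> 0"
      proof (rule Lim_null_comparison)
        show "\<forall>\<^sub>F n in sequentially. norm (cutoff' n x) \<le>
            real (Suc n) * step' (real (Suc n) * x - 1) + real (Suc n) * step' (real (Suc n) * (pi - x) - 1)"
          using cutoff'_abs_le by simp
        show "(\<lambda>n. real (Suc n) * step' (real (Suc n) * x - 1)
            + real (Suc n) * step' (real (Suc n) * (pi - x) - 1)) \<longlonglongrightarrow> 0"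
          using tendsto_add[OF step'_weighted_tendsto[OF x(1)] step'_weighted_tendsto[OF x(2)]]
          by (simp del: of_nat_Suc)
      qed
      then show "(\<lambda>n. k x * (cutoff' n x * sin (real m * x))) \<longlonglongrightarrow> 0"
        by (intro tendsto_mult_right_zero tendsto_mult_left_zero)
    qed
    show "AE x in Mpi. norm (k x * (cutoff' n x * sin (real m * x))) \<le> \<bar>k x\<bar> * (6 * real m)" for n
    proof (rule AE_I2)
      fix x assume "x \<in> space Mpi"
      then have x: "0 < x" "0 < pi - x" by (auto simp: space_Mpi)
      let ?s = "\<bar>sin (real m * x)\<bar>" and ?k = "real (Suc n)"
      have s: "?s \<le> real m * x" "?s \<le> real m * (pi - x)"
        using abs_sin_x_le_abs_x[of "real m * x"] sin_le_dist_pi[of m x] x by (auto simp: abs_mult)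
      have "\<bar>cutoff' n x\<bar> * ?s \<le> (?k * step' (?k * x - 1) + ?k * step' (?k * (pi - x) - 1)) * ?s"
        by (intro mult_right_mono cutoff'_abs_le) simp
      also have "\<dots> \<le> (?k * step' (?k * x - 1)) * (real m * x) + (?k * step' (?k * (pi - x) - 1)) * (real m * (pi - x))"
        unfolding distrib_right by (intro add_mono mult_left_mono s mult_nonneg_nonneg step'_nonneg) auto
      also have "\<dots> = real m * (x * (?k * step' (?k * x - 1))) + real m * ((pi - x) * (?k * step' (?k * (pi - x) - 1)))"
        by (simp only: mult_ac)
      also have "\<dots> \<le> real m * 3 + real m * 3"
        by (intro add_mono mult_left_mono step'_weighted_le) auto
      finally have "\<bar>cutoff' n x * sin (real m * x)\<bar> \<le> 6 * real m" by (simp add: abs_mult)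
      then show "norm (k x * (cutoff' n x * sin (real m * x))) \<le> \<bar>k x\<bar> * (6 * real m)"
        unfolding real_norm_def abs_mult[of "k x"] by (rule mult_left_mono) simp
    qed
  qed auto
  then show ?thesis by simp
qed

lemma integral_Mpi_step'_tendsto_0:
  assumes h: "continuous_on {0..pi} h" "h 0 = 0"
  shows "(\<lambda>n. \<integral>x. \<bar>h x\<bar> * (real (Suc n) * step' (real (Suc n) * x - 1)) \<partial>Mpi) \<longlonglongrightarrow> 0"
proof -
  let ?G = "\<lambda>x. indicator {0<..<pi} x * \<bar>h x\<bar>"
  obtain B where B: "\<forall>x\<in>h ` {0..pi}. norm x \<le> B"
    using compact_imp_bounded[OF compact_continuous_image[OF h(1)]] unfolding bounded_iff by auto
  have "(\<lambda>n. LINT x|lborel. ?G x * (real (Suc n) * step' (real (Suc n) * x - 1))) \<longlonglongrightarrow> 0"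
  proof (rule integral_step'_tendsto_0[where B = "\<bar>B\<bar>"])
    have "(\<lambda>x. indicator {0<..<pi} x *\<^sub>R \<bar>h x\<bar>) \<in> borel_measurable borel"
      by (intro borel_measurable_continuous_on_indicator continuous_intros continuous_on_subset[OF h(1)]) auto
    then show "?G \<in> borel_measurable borel" by simp
    show "\<bar>?G x\<bar> \<le> \<bar>B\<bar>" for x
      using B by (auto simp: indicator_def intro!: order_trans[OF _ abs_ge_self])
    have "(h \<longlongrightarrow> h 0) (at 0 within {0..pi})" using h(1) by (simp add: continuous_on_def)
    then have "(h \<longlongrightarrow> 0) (at_right 0)"
      using h(2) by (simp only: at_within_Icc_at_right[OF pi_gt_zero])
    then have "((\<lambda>x. \<bar>h x\<bar>) \<longlongrightarrow> 0) (at_right 0)" by (rule tendsto_rabs_zero)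
    then show "(?G \<longlongrightarrow> 0) (at_right 0)"
    proof (rule Lim_transform_eventually)
      show "\<forall>\<^sub>F x in at_right 0. \<bar>h x\<bar> = ?G x"
        using eventually_at_right_real[OF pi_gt_zero] by eventually_elim simp
    qed
  qed
  moreover have "(LINT x|lborel. ?G x * q x) = (\<integral>x. \<bar>h x\<bar> * q x \<partial>Mpi)" for q
    by (subst integral_restrict_space) (auto simp: mult.assoc)
  ultimately show ?thesis by simp
qed

text \<open>The derivative of the cutoff concentrates, with mass at most 1 at each end, where \<open>\<phi>\<close> tends to 0.\<close>
lemma integral_cutoff'_boundary_tendsto:
  assumes \<phi>c: "continuous_on {0..pi} \<phi>c" "\<phi>c 0 = 0" "\<phi>c pi = 0" and eq: "AE x in Mpi. \<phi> x = \<phi>c x"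
    and \<phi>: "\<phi> \<in> borel_measurable Mpi" and c: "continuous_on UNIV c" "\<And>x. \<bar>c x\<bar> \<le> 1"
  shows "(\<lambda>n. \<integral>x. \<phi> x * (cutoff' n x * c x) \<partial>Mpi) \<longlonglongrightarrow> 0"
proof (rule Lim_null_comparison)
  let ?A = "\<lambda>n x. real (Suc n) * step' (real (Suc n) * x - 1)"
  let ?B = "\<lambda>n x. real (Suc n) * step' (real (Suc n) * (pi - x) - 1)"
  have \<phi>c_meas: "\<phi>c \<in> borel_measurable Mpi"
    using square_integrable_continuous[OF \<phi>c(1)] by (simp add: square_integrable_def)
  have AB_cont: "continuous_on {0..pi} (?A n)" "continuous_on {0..pi} (?B n)" for n
    by (intro continuous_intros continuous_on_compose2[OF continuous_on_step'[of UNIV]]; simp)+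
  have iA: "integrable Mpi (\<lambda>x. \<bar>\<phi>c x\<bar> * ?A n x)" for n
    by (rule integrable_Mpi_continuous, rule continuous_on_mult[OF continuous_on_rabs[OF \<phi>c(1)] AB_cont(1)])
  have iB: "integrable Mpi (\<lambda>x. \<bar>\<phi>c x\<bar> * ?B n x)" for n
    by (rule integrable_Mpi_continuous, rule continuous_on_mult[OF continuous_on_rabs[OF \<phi>c(1)] AB_cont(2)])
  show "\<forall>\<^sub>F n in sequentially. norm (\<integral>x. \<phi> x * (cutoff' n x * c x) \<partial>Mpi)
      \<le> (\<integral>x. \<bar>\<phi>c x\<bar> * ?A n x \<partial>Mpi) + (\<integral>x. \<bar>\<phi>c x\<bar> * ?B n x \<partial>Mpi)"
  proof (intro always_eventually allI)
    fix n
    have m: "(\<lambda>x. cutoff' n x * c x) \<in> borel_measurable Mpi"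
      by (intro borel_measurable_times cutoff'_measurable measurable_Mpi borel_measurable_continuous_onI c)
    have le: "\<bar>\<phi>c x * (cutoff' n x * c x)\<bar> \<le> \<bar>\<phi>c x\<bar> * ?A n x + \<bar>\<phi>c x\<bar> * ?B n x" for x
    proof -
      have "\<bar>cutoff' n x * c x\<bar> \<le> \<bar>cutoff' n x\<bar>"
        unfolding abs_mult by (rule mult_left_le[OF c(2)]) simp
      also have "\<dots> \<le> ?A n x + ?B n x" by (rule cutoff'_abs_le)
      finally show ?thesis
        unfolding abs_mult[of "\<phi>c x"] distrib_left[symmetric] by (rule mult_left_mono) simp
    qed
    have "(\<integral>x. \<phi> x * (cutoff' n x * c x) \<partial>Mpi) = (\<integral>x. \<phi>c x * (cutoff' n x * c x) \<partial>Mpi)"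
      using eq by (intro integral_cong_AE borel_measurable_times \<phi> \<phi>c_meas m) (auto elim: eventually_mono)
    also have "norm \<dots> \<le> (\<integral>x. norm (\<phi>c x * (cutoff' n x * c x)) \<partial>Mpi)"
      by (rule integral_norm_bound)
    also have "\<dots> \<le> (\<integral>x. \<bar>\<phi>c x\<bar> * ?A n x + \<bar>\<phi>c x\<bar> * ?B n x \<partial>Mpi)"
    proof (rule integral_mono)
      show i: "integrable Mpi (\<lambda>x. \<bar>\<phi>c x\<bar> * ?A n x + \<bar>\<phi>c x\<bar> * ?B n x)"
        by (rule Bochner_Integration.integrable_add[OF iA iB])
      show "integrable Mpi (\<lambda>x. norm (\<phi>c x * (cutoff' n x * c x)))"
        by (intro integrable_norm integrable_Mpi_continuous continuous_on_mult \<phi>c(1) continuous_on_cutoff'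
            continuous_on_subset[OF c(1)]) simp
    qed (use le in simp)
    also have "\<dots> = (\<integral>x. \<bar>\<phi>c x\<bar> * ?A n x \<partial>Mpi) + (\<integral>x. \<bar>\<phi>c x\<bar> * ?B n x \<partial>Mpi)"
      by (rule Bochner_Integration.integral_add[OF iA iB])
    finally show "norm (\<integral>x. \<phi> x * (cutoff' n x * c x) \<partial>Mpi)
      \<le> (\<integral>x. \<bar>\<phi>c x\<bar> * ?A n x \<partial>Mpi) + (\<integral>x. \<bar>\<phi>c x\<bar> * ?B n x \<partial>Mpi)" .
  qed
  \<comment> \<open>The reflection x -> pi - x carries the right endpoint to the left one, so one
    limit lemma serves both.\<close>
  have "(\<integral>x. \<bar>\<phi>c x\<bar> * ?B n x \<partial>Mpi) = (\<integral>x. \<bar>\<phi>c (pi - x)\<bar> * ?A n x \<partial>Mpi)" for n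
    using integral_Mpi_reflect[of "\<lambda>x. \<bar>\<phi>c x\<bar> * ?B n x"] by simp
  moreover have "(\<lambda>n. \<integral>x. \<bar>\<phi>c (pi - x)\<bar> * ?A n x \<partial>Mpi) \<longlonglongrightarrow> 0"
    by (rule integral_Mpi_step'_tendsto_0)
      (auto intro!: continuous_intros continuous_on_compose2[OF \<phi>c(1)] simp: \<phi>c)
  ultimately show "(\<lambda>n. (\<integral>x. \<bar>\<phi>c x\<bar> * ?A n x \<partial>Mpi) + (\<integral>x. \<bar>\<phi>c x\<bar> * ?B n x \<partial>Mpi)) \<longlonglongrightarrow> 0"
    using tendsto_add[OF integral_Mpi_step'_tendsto_0[OF \<phi>c(1,2)]] by (simp only: add_0)
qed

lemma weak_derivD:
  assumes "weak_deriv u g" "test_fun \<psi>" "\<And>x. (\<psi> has_real_derivative \<psi>' x) (at x)"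
  shows "(\<integral>x. u x * \<psi>' x \<partial>Mpi) = - (\<integral>x. g x * \<psi> x \<partial>Mpi)"
proof -
  have "deriv \<psi> = \<psi>'" by (intro ext DERIV_imp_deriv assms(3))
  then show ?thesis using assms(1,2) by (auto simp: weak_deriv_def set_integral_Mpi)
qed

text \<open>Test with cutoff times sine and remove the cutoff; the term with its derivative dies
  because the sine vanishes at the ends. This suits the first derivative of a domain element, about
  whose boundary values nothing is known.\<close>

lemma weak_deriv_test_sin:
  assumes u: "square_integrable Mpi u" and g: "square_integrable Mpi g" and w: "weak_deriv u g"
  shows "real m * (\<integral>x. u x * cos (real m * x) \<partial>Mpi) = - (\<integral>x. g x * sin (real m * x) \<partial>Mpi)"
proof -
  let ?s = "\<lambda>x. sin (real m * x)" and ?c = "\<lambda>x. cos (real m * x)"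
  have iu: "integrable Mpi u"
    using square_integrable_mult[OF u square_integrable_continuous[of "\<lambda>_. 1"]] by simp
  have ic: "integrable Mpi (\<lambda>x. u x * ?c x)" "integrable Mpi (\<lambda>x. g x * ?s x)"
    by (intro square_integrable_mult u g square_integrable_continuous continuous_intros)+
  have eq: "(\<integral>x. u x * (cutoff' n x * ?s x) \<partial>Mpi) + real m * (\<integral>x. (u x * ?c x) * cutoff n x \<partial>Mpi)
      = - (\<integral>x. (g x * ?s x) * cutoff n x \<partial>Mpi)" for n
  proof -
    have "smooth ?s" using smooth_trig[of 1 "real m" 0] by simp
    then have "(\<integral>x. u x * (cutoff' n x * ?s x + cutoff n x * (real m * ?c x)) \<partial>Mpi)
        = - (\<integral>x. g x * (cutoff n x * ?s x) \<partial>Mpi)"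
      by (intro weak_derivD[OF w test_fun_cutoff_mult]) (auto intro!: derivative_eq_intros cutoff_DERIV)
    also have "(\<integral>x. u x * (cutoff' n x * ?s x + cutoff n x * (real m * ?c x)) \<partial>Mpi)
        = (\<integral>x. u x * (cutoff' n x * ?s x) + real m * ((u x * ?c x) * cutoff n x) \<partial>Mpi)"
      by (simp add: algebra_simps)
    also have "\<dots> = (\<integral>x. u x * (cutoff' n x * ?s x) \<partial>Mpi) + real m * (\<integral>x. (u x * ?c x) * cutoff n x \<partial>Mpi)"
      by (subst Bochner_Integration.integral_add)
        (auto simp: mult.assoc intro!: square_integrable_mult u square_integrable_continuous
          continuous_on_cutoff continuous_on_cutoff' continuous_intros)
    finally show ?thesis by (simp add: mult_ac)
  qed
  have "(\<lambda>n. (\<integral>x. u x * (cutoff' n x * ?s x) \<partial>Mpi) + real m * (\<integral>x. (u x * ?c x) * cutoff n x \<partial>Mpi))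
      \<longlonglongrightarrow> 0 + real m * (\<integral>x. u x * ?c x \<partial>Mpi)"
    by (intro tendsto_add tendsto_mult_left integral_cutoff'_sin_tendsto integral_cutoff_tendsto iu ic)
  moreover have "(\<lambda>n. - (\<integral>x. (g x * ?s x) * cutoff n x \<partial>Mpi)) \<longlonglongrightarrow> - (\<integral>x. g x * ?s x \<partial>Mpi)"
    by (intro tendsto_minus integral_cutoff_tendsto ic)
  ultimately show ?thesis unfolding eq by (auto dest: LIMSEQ_unique)
qed

text \<open>The cosine does not vanish at the ends, so here the term with the derivative of the
  cutoff is killed by the zero boundary values of the continuous representative. This is where the
  Dirichlet condition enters.\<close>

lemma weak_deriv_test_cos:
  assumes u: "square_integrable Mpi u" and g: "square_integrable Mpi g" and w: "weak_deriv u g"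
    and uc: "continuous_on {0..pi} uc" "uc 0 = 0" "uc pi = 0" "AE x in Mpi. u x = uc x"
  shows "real m * (\<integral>x. u x * sin (real m * x) \<partial>Mpi) = (\<integral>x. g x * cos (real m * x) \<partial>Mpi)"
proof -
  let ?s = "\<lambda>x. sin (real m * x)" and ?c = "\<lambda>x. cos (real m * x)"
  have ic: "integrable Mpi (\<lambda>x. u x * ?s x)" "integrable Mpi (\<lambda>x. g x * ?c x)"
    by (intro square_integrable_mult u g square_integrable_continuous continuous_intros)+
  have eq: "(\<integral>x. u x * (cutoff' n x * ?c x) \<partial>Mpi) - real m * (\<integral>x. (u x * ?s x) * cutoff n x \<partial>Mpi)
      = - (\<integral>x. (g x * ?c x) * cutoff n x \<partial>Mpi)" for n
  proof -
    have "smooth ?c" using smooth_trig[of 0 "real m" 1] by simp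
    then have "(\<integral>x. u x * (cutoff' n x * ?c x + cutoff n x * (- (real m * ?s x))) \<partial>Mpi)
        = - (\<integral>x. g x * (cutoff n x * ?c x) \<partial>Mpi)"
      by (intro weak_derivD[OF w test_fun_cutoff_mult]) (auto intro!: derivative_eq_intros cutoff_DERIV)
    also have "(\<integral>x. u x * (cutoff' n x * ?c x + cutoff n x * (- (real m * ?s x))) \<partial>Mpi)
        = (\<integral>x. u x * (cutoff' n x * ?c x) - real m * ((u x * ?s x) * cutoff n x) \<partial>Mpi)"
      by (simp add: algebra_simps)
    also have "\<dots> = (\<integral>x. u x * (cutoff' n x * ?c x) \<partial>Mpi) - real m * (\<integral>x. (u x * ?s x) * cutoff n x \<partial>Mpi)"
      by (subst Bochner_Integration.integral_diff)
        (auto simp: mult.assoc intro!: square_integrable_mult u square_integrable_continuous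
          continuous_on_cutoff continuous_on_cutoff' continuous_intros)
    finally show ?thesis by (simp add: mult_ac)
  qed
  have "(\<lambda>n. (\<integral>x. u x * (cutoff' n x * ?c x) \<partial>Mpi) - real m * (\<integral>x. (u x * ?s x) * cutoff n x \<partial>Mpi))
      \<longlonglongrightarrow> 0 - real m * (\<integral>x. u x * ?s x \<partial>Mpi)"
    using u by (intro tendsto_diff tendsto_mult_left integral_cutoff'_boundary_tendsto[OF uc]
        integral_cutoff_tendsto ic) (auto simp: square_integrable_def intro!: continuous_intros)
  moreover have "(\<lambda>n. - (\<integral>x. (g x * ?c x) * cutoff n x \<partial>Mpi)) \<longlonglongrightarrow> - (\<integral>x. g x * ?c x \<partial>Mpi)"
    by (intro tendsto_minus integral_cutoff_tendsto ic)
  ultimately show ?thesis unfolding eq by (auto dest: LIMSEQ_unique)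
qed

text \<open>Two integrations by parts: the sine test moves ch to the first derivative, and the
  cosine test moves that to \<phi>. Each yields a factor Suc n, and one of them the sign.\<close>

lemma A_graph_sine_coeff:
  assumes "A_graph \<phi> ch"
  shows "(\<integral>x. ch x * sine n x \<partial>Mpi) = - (real (Suc n))\<^sup>2 * (\<integral>x. \<phi> x * sine n x \<partial>Mpi)"
proof -
  obtain \<phi>1 \<phi>c where *: "square_integrable Mpi \<phi>" "square_integrable Mpi ch" "square_integrable Mpi \<phi>1"
      "weak_deriv \<phi> \<phi>1" "weak_deriv \<phi>1 ch"
    and c: "continuous_on {0..pi} \<phi>c" "\<phi>c 0 = 0" "\<phi>c pi = 0" "AE x in Mpi. \<phi> x = \<phi>c x"
    using assms unfolding A_graph_def L2_iff L2_eq_iff by blast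
  have "real (Suc n) * (real (Suc n) * (\<integral>x. \<phi> x * sine n x \<partial>Mpi)) = - (\<integral>x. ch x * sine n x \<partial>Mpi)"
    unfolding sine_def weak_deriv_test_cos[OF *(1,3,4) c] by (rule weak_deriv_test_sin[OF *(3,2,5)])
  then show ?thesis by (simp only: power2_eq_square mult.assoc minus_mult_left[symmetric])
qed

section \<open>Sine series in the domain of the Dirichlet Laplacian\<close>

lemma test_fun_DERIV: "test_fun \<psi> \<Longrightarrow> (\<psi> has_real_derivative deriv \<psi> x) (at x)"
  and continuous_on_deriv_test_fun: "test_fun \<psi> \<Longrightarrow> continuous_on A (deriv \<psi>)"
  and continuous_on_test_fun: "test_fun \<psi> \<Longrightarrow> continuous_on A \<psi>"
proof -
  assume "test_fun \<psi>"
  then have s: "smooth \<psi>" by (simp add: test_fun_def smooth_def)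
  show "(\<psi> has_real_derivative deriv \<psi> x) (at x)" by (rule smooth_DERIV[OF s])
  show "continuous_on A (deriv \<psi>)"
    by (intro continuous_at_imp_continuous_on ballI DERIV_isCont[OF smooth_DERIV[OF smooth_deriv[OF s]]])
  show "continuous_on A \<psi>"
    by (intro continuous_at_imp_continuous_on ballI DERIV_isCont[OF smooth_DERIV[OF s]])
qed

lemma integral_by_parts_test_fun:
  assumes \<psi>: "test_fun \<psi>" and u: "\<And>x. (u has_real_derivative u' x) (at x)" "continuous_on {0..pi} u'"
  shows "(\<integral>x. u x * deriv \<psi> x \<partial>Mpi) = - (\<integral>x. u' x * \<psi> x \<partial>Mpi)"
proof -
  have u_cont: "continuous_on {0..pi} u" using u(1) by (auto intro: continuous_at_imp_continuous_on DERIV_isCont)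
  have c: "continuous_on {0..pi} (\<lambda>x. u x * deriv \<psi> x)" "continuous_on {0..pi} (\<lambda>x. u' x * \<psi> x)"
    by (intro continuous_on_mult u_cont u(2) continuous_on_deriv_test_fun[OF \<psi>] continuous_on_test_fun[OF \<psi>])+
  have ends: "\<psi> 0 = 0" "\<psi> pi = 0" using \<psi> unfolding test_fun_def by auto
  have "((\<lambda>x. u x * deriv \<psi> x + u' x * \<psi> x) has_integral u pi * \<psi> pi - u 0 * \<psi> 0) {0..pi}"
  proof (rule fundamental_theorem_of_calculus)
    fix x :: real
    have "((\<lambda>x. u x * \<psi> x) has_real_derivative u x * deriv \<psi> x + u' x * \<psi> x) (at x within {0..pi})"
      using has_field_derivative_at_within[OF DERIV_mult[OF u(1) test_fun_DERIV[OF \<psi>], of x]]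
      by (simp add: add.commute mult.commute)
    then show "((\<lambda>x. u x * \<psi> x) has_vector_derivative u x * deriv \<psi> x + u' x * \<psi> x) (at x within {0..pi})"
      by (simp add: has_real_derivative_iff_has_vector_derivative)
  qed simp
  then have "integral {0..pi} (\<lambda>x. u x * deriv \<psi> x + u' x * \<psi> x) = 0"
    using ends by (simp add: integral_unique)
  then have "(\<integral>x. u x * deriv \<psi> x + u' x * \<psi> x \<partial>Mpi) = 0"
    by (subst integral_Mpi_continuous) (intro continuous_on_add c)
  then show ?thesis
    using integrable_Mpi_continuous[OF c(1)] integrable_Mpi_continuous[OF c(2)] by simp
qed

lemma integral_uniform_limit_tendsto:
  fixes S :: "nat \<Rightarrow> real \<Rightarrow> real"
  assumes S: "\<And>n. continuous_on {0..pi} (S n)" and lim: "uniform_limit {0..pi} S u sequentially"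
    and h: "continuous_on {0..pi} h"
  shows "(\<lambda>n. \<integral>x. S n x * h x \<partial>Mpi) \<longlonglongrightarrow> (\<integral>x. u x * h x \<partial>Mpi)"
proof -
  have u: "continuous_on {0..pi} u"
    by (rule uniform_limit_theorem[OF _ lim]) (auto intro!: always_eventually S)
  have hb: "bounded (h ` {0..pi})" "bounded (u ` {0..pi})"
    by (intro compact_imp_bounded compact_continuous_image h u compact_Icc)+
  have hc: "uniform_limit {0..pi} (\<lambda>n. h) h sequentially" by (rule uniform_limit_const)
  have "uniform_limit {0..pi} (\<lambda>n x. S n x * h x) (\<lambda>x. u x * h x) sequentially"
    by (rule uniform_lim_mult[OF lim hc hb(2,1)])
  then have ul: "uniform_limit (cbox 0 pi) (\<lambda>n x. S n x * h x) (\<lambda>x. u x * h x) sequentially"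
    by simp
  obtain I J where IJ: "\<And>n. ((\<lambda>x. S n x * h x) has_integral I n) (cbox 0 pi)"
      "((\<lambda>x. u x * h x) has_integral J) (cbox 0 pi)" "I \<longlonglongrightarrow> J"
  proof (rule uniform_limit_integral_cbox[OF ul])
    show "continuous_on (cbox 0 pi) (\<lambda>x. S n x * h x)" for n
      using continuous_on_mult[OF S h] by simp
  qed auto
  have "(\<integral>x. S n x * h x \<partial>Mpi) = I n" for n
    using IJ(1)[of n] integral_Mpi_continuous[OF continuous_on_mult[OF S h], of n] by (simp add: integral_unique)
  moreover have "(\<integral>x. u x * h x \<partial>Mpi) = J"
    using IJ(2) integral_Mpi_continuous[OF continuous_on_mult[OF u h]] by (simp add: integral_unique)
  ultimately show ?thesis using IJ(3) by simp
qed

section \<open>Termwise differentiation of sine and cosine series\<close>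

definition cosine :: "nat \<Rightarrow> real \<Rightarrow> real" where
  "cosine n x = cos (real (Suc n) * x)"

lemma sine_DERIV: "(sine n has_real_derivative real (Suc n) * cosine n x) (at x)"
  unfolding sine_def cosine_def by (auto intro!: derivative_eq_intros simp del: of_nat_Suc)

lemma cosine_DERIV: "(cosine n has_real_derivative - real (Suc n) * sine n x) (at x)"
  unfolding sine_def cosine_def by (auto intro!: derivative_eq_intros simp del: of_nat_Suc)

lemma continuous_on_cosine: "continuous_on A (cosine n)"
  unfolding cosine_def by (intro continuous_intros)

lemma sine_le_1: "\<bar>sine n x\<bar> \<le> 1" and cosine_le_1: "\<bar>cosine n x\<bar> \<le> 1"
  by (simp_all add: sine_def cosine_def)

lemma uniform_limit_series:
  fixes e :: "nat \<Rightarrow> real \<Rightarrow> real"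
  assumes "summable (\<lambda>n. \<bar>c n\<bar>)" "\<And>n x. \<bar>e n x\<bar> \<le> 1"
  shows "uniform_limit A (\<lambda>n x. \<Sum>k<n. c k * e k x) (\<lambda>x. \<Sum>k. c k * e k x) sequentially"
  by (rule Weierstrass_m_test[where M = "\<lambda>n. \<bar>c n\<bar>"])
    (use assms in \<open>auto simp: abs_mult intro: mult_left_le\<close>)

lemma continuous_on_series:
  fixes e :: "nat \<Rightarrow> real \<Rightarrow> real"
  assumes "summable (\<lambda>n. \<bar>c n\<bar>)" "\<And>n x. \<bar>e n x\<bar> \<le> 1" "\<And>n. continuous_on A (e n)"
  shows "continuous_on A (\<lambda>x. \<Sum>k. c k * e k x)"
  by (rule uniform_limit_theorem[OF _ uniform_limit_series[OF assms(1,2)]])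
    (auto intro!: always_eventually continuous_intros assms(3))

text \<open>Both the series and its derived series converge uniformly, so integration by parts for
  the partial sums passes to the limit.\<close>

lemma weak_deriv_sine_series:
  assumes c: "summable (\<lambda>n. \<bar>c n\<bar>)" "summable (\<lambda>n. \<bar>c n * real (Suc n)\<bar>)"
  shows "weak_deriv (\<lambda>x. \<Sum>n. c n * sine n x) (\<lambda>x. \<Sum>n. (c n * real (Suc n)) * cosine n x)"
  unfolding weak_deriv_def set_integral_Mpi
proof (intro allI impI)
  fix \<psi> assume \<psi>: "test_fun \<psi>"
  have l1: "(\<lambda>n. \<integral>x. (\<Sum>k<n. c k * sine k x) * deriv \<psi> x \<partial>Mpi)
      \<longlonglongrightarrow> (\<integral>x. (\<Sum>n. c n * sine n x) * deriv \<psi> x \<partial>Mpi)"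
    by (intro integral_uniform_limit_tendsto uniform_limit_series c sine_le_1 continuous_on_sum
        continuous_on_mult continuous_on_const continuous_on_sine continuous_on_deriv_test_fun \<psi>)
  have l2: "(\<lambda>n. \<integral>x. (\<Sum>k<n. (c k * real (Suc k)) * cosine k x) * \<psi> x \<partial>Mpi)
      \<longlonglongrightarrow> (\<integral>x. (\<Sum>n. (c n * real (Suc n)) * cosine n x) * \<psi> x \<partial>Mpi)"
    by (intro integral_uniform_limit_tendsto uniform_limit_series c cosine_le_1 continuous_on_sum
        continuous_on_mult continuous_on_const continuous_on_cosine continuous_on_test_fun \<psi>)
  have eq: "(\<integral>x. (\<Sum>k<n. c k * sine k x) * deriv \<psi> x \<partial>Mpi)
      = - (\<integral>x. (\<Sum>k<n. (c k * real (Suc k)) * cosine k x) * \<psi> x \<partial>Mpi)" for n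
  proof (rule integral_by_parts_test_fun[OF \<psi>])
    show "((\<lambda>x. \<Sum>k<n. c k * sine k x) has_real_derivative (\<Sum>k<n. (c k * real (Suc k)) * cosine k x)) (at x)" for x
      unfolding mult.assoc by (intro DERIV_sum DERIV_cmult sine_DERIV)
    show "continuous_on {0..pi} (\<lambda>x. \<Sum>k<n. (c k * real (Suc k)) * cosine k x)"
      by (intro continuous_on_sum continuous_on_mult continuous_on_const continuous_on_cosine)
  qed
  show "(\<integral>x. (\<Sum>n. c n * sine n x) * deriv \<psi> x \<partial>Mpi)
      = - (\<integral>x. (\<Sum>n. (c n * real (Suc n)) * cosine n x) * \<psi> x \<partial>Mpi)"
    by (rule LIMSEQ_unique[OF l1[unfolded eq] tendsto_minus[OF l2]])
qed

text \<open>The derived series is only known to converge in L^2, so its side of the identity passes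
  to the limit through inner products with the test function.\<close>

lemma weak_deriv_cosine_series:
  assumes c: "summable (\<lambda>n. \<bar>c n\<bar>)" and v: "sine_limit (\<lambda>n. - (c n * real (Suc n))) v"
  shows "weak_deriv (\<lambda>x. \<Sum>n. c n * cosine n x) v"
  unfolding weak_deriv_def set_integral_Mpi
proof (intro allI impI)
  fix \<psi> assume \<psi>: "test_fun \<psi>"
  have sc: "continuous_on {0..pi} (\<lambda>x. cosine k x * deriv \<psi> x)" for k
    by (intro continuous_on_mult continuous_on_cosine continuous_on_deriv_test_fun \<psi>)
  have parts: "(\<integral>x. cosine k x * deriv \<psi> x \<partial>Mpi) = real (Suc k) * (\<integral>x. sine k x * \<psi> x \<partial>Mpi)" for k
  proof -
    have "(\<integral>x. cosine k x * deriv \<psi> x \<partial>Mpi) = - (\<integral>x. (- real (Suc k) * sine k x) * \<psi> x \<partial>Mpi)"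
      by (rule integral_by_parts_test_fun[OF \<psi> cosine_DERIV])
        (intro continuous_on_mult continuous_on_const continuous_on_sine)
    then show ?thesis by (simp add: mult.assoc del: of_nat_Suc)
  qed
  have l1: "(\<lambda>n. \<integral>x. (\<Sum>k<n. c k * cosine k x) * deriv \<psi> x \<partial>Mpi)
      \<longlonglongrightarrow> (\<integral>x. (\<Sum>n. c n * cosine n x) * deriv \<psi> x \<partial>Mpi)"
    by (intro integral_uniform_limit_tendsto uniform_limit_series c cosine_le_1 continuous_on_sum
        continuous_on_mult continuous_on_const continuous_on_cosine continuous_on_deriv_test_fun \<psi>)
  have eq: "(\<integral>x. (\<Sum>k<n. c k * cosine k x) * deriv \<psi> x \<partial>Mpi)
      = - (\<Sum>k<n. - (c k * real (Suc k)) * (\<integral>x. sine k x * \<psi> x \<partial>Mpi))" for n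
    using integrable_Mpi_continuous[OF sc]
    by (simp add: sum_distrib_right mult.assoc Bochner_Integration.integral_sum parts sum_negf
        del: of_nat_Suc)
  have l2: "(\<lambda>n. \<Sum>k<n. - (c k * real (Suc k)) * (\<integral>x. sine k x * \<psi> x \<partial>Mpi)) \<longlonglongrightarrow> (\<integral>x. v x * \<psi> x \<partial>Mpi)"
    using sine_limit_inner[OF v square_integrable_continuous[OF continuous_on_test_fun[OF \<psi>]]]
    by (simp add: sums_def)
  show "(\<integral>x. (\<Sum>n. c n * cosine n x) * deriv \<psi> x \<partial>Mpi) = - (\<integral>x. v x * \<psi> x \<partial>Mpi)"
    by (rule LIMSEQ_unique[OF l1[unfolded eq] tendsto_minus[OF l2]])
qed

text \<open>Uniform convergence makes the sum its own continuous representative, with boundary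
  values read off term by term; only the second derivative is an L^2 limit.\<close>

lemma A_graph_sine_series:
  assumes c: "summable (\<lambda>n. \<bar>c n\<bar>)" "summable (\<lambda>n. \<bar>c n * real (Suc n)\<bar>)"
    and v: "sine_limit (\<lambda>n. - (c n * (real (Suc n))\<^sup>2)) v"
  shows "A_graph (\<lambda>x. \<Sum>n. c n * sine n x) v"
proof -
  let ?W = "\<lambda>x. \<Sum>n. c n * sine n x" and ?W1 = "\<lambda>x. \<Sum>n. (c n * real (Suc n)) * cosine n x"
  have W: "continuous_on {0..pi} ?W"
    by (intro continuous_on_series c sine_le_1 continuous_on_sine)
  have W1: "continuous_on {0..pi} ?W1"
    by (intro continuous_on_series c cosine_le_1 continuous_on_cosine)
  have "sine n 0 = 0" "sine n pi = 0" for n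
    using sin_npi[of "Suc n"] by (simp_all add: sine_def del: of_nat_Suc)
  then have ends: "?W 0 = 0" "?W pi = 0" by simp_all
  have "weak_deriv ?W1 v"
    by (rule weak_deriv_cosine_series[OF c(2)]) (use v in \<open>simp add: power2_eq_square mult.assoc del: of_nat_Suc\<close>)
  moreover have "L2_eq ?W ?W" by (simp add: L2_eq_def)
  ultimately show ?thesis
    unfolding A_graph_def L2_iff
    using weak_deriv_sine_series[OF c] square_integrable_continuous[OF W] square_integrable_continuous[OF W1]
      v ends W unfolding sine_limit_def by blast
qed

lemma sine_limit_series:
  assumes c: "summable (\<lambda>n. \<bar>c n\<bar>)"
  shows "sine_limit c (\<lambda>x. \<Sum>n. c n * sine n x)"
proof (rule sine_limit_expansion)
  let ?W = "\<lambda>x. \<Sum>n. c n * sine n x"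
  show "square_integrable Mpi ?W"
    by (intro square_integrable_continuous continuous_on_series c sine_le_1 continuous_on_sine)
  have "c \<longlonglongrightarrow> 0" using summable_LIMSEQ_zero[OF c] by (simp add: tendsto_rabs_zero_iff)
  then have "\<forall>\<^sub>F n in sequentially. \<bar>c n\<bar> < 1" using tendsto_rabs_zero order_tendstoD(2) zero_less_one by blast
  then have "\<forall>\<^sub>F n in sequentially. norm ((c n)\<^sup>2) \<le> \<bar>c n\<bar>"
  proof eventually_elim
    case (elim n)
    then show ?case using mult_left_le[of "\<bar>c n\<bar>" "\<bar>c n\<bar>"] by (simp add: power2_eq_square)
  qed
  then show "summable (\<lambda>k. (c k)\<^sup>2)" by (rule summable_comparison_test_ev[OF _ c])
  fix n
  have "(\<lambda>m. \<integral>x. (\<Sum>k<m. c k * sine k x) * sine n x \<partial>Mpi) \<longlonglongrightarrow> (\<integral>x. ?W x * sine n x \<partial>Mpi)"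
    by (intro integral_uniform_limit_tendsto uniform_limit_series c sine_le_1 continuous_on_sum
        continuous_on_mult continuous_on_const continuous_on_sine)
  moreover have "(\<integral>x. (\<Sum>k<m. c k * sine k x) * sine n x \<partial>Mpi) = (\<Sum>k<m. if k = n then pi / 2 * c n else 0)" for m
    using square_integrable_mult[OF square_integrable_sine square_integrable_sine]
    by (simp add: sum_distrib_right mult.assoc Bochner_Integration.integral_sum integral_sine_sine
        if_distrib[of "\<lambda>z. _ * z"] mult.commute[of pi] cong: if_cong)
  ultimately have "(\<lambda>k. if k = n then pi / 2 * c n else 0) sums (\<integral>x. ?W x * sine n x \<partial>Mpi)"
    by (simp add: sums_def)
  then show "(\<integral>x. ?W x * sine n x \<partial>Mpi) = pi / 2 * c n"
    using sums_single[of n "\<lambda>_. pi / 2 * c n"] sums_unique2 by blast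
qed

section \<open>Existence and uniqueness\<close>

text \<open>The decay is only of order 1/n because the lift equals 1 at the endpoint 0; the sequence
  is square summable but not summable.\<close>

definition lift_coeff :: "nat \<Rightarrow> real" where
  "lift_coeff n = 2 / (pi * real (Suc n))"

lemma integral_lift_sine: "(\<integral>x. (pi - x) / pi * sine n x \<partial>Mpi) = pi / 2 * lift_coeff n"
proof -
  let ?m = "real (Suc n)"
  have m: "?m \<noteq> 0" by simp
  let ?H = "\<lambda>x. - ((pi - x) / pi * cos (?m * x) / ?m) - sin (?m * x) / (pi * ?m\<^sup>2)"
  have "((\<lambda>x. (pi - x) / pi * sine n x) has_integral ?H pi - ?H 0) {0..pi}"
  proof (rule fundamental_theorem_of_calculus)
    fix x :: real
    have "(?H has_real_derivative (pi - x) / pi * sine n x) (at x within {0..pi})"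
      unfolding sine_def using m
      by (auto intro!: derivative_eq_intros simp del: of_nat_Suc simp: field_simps power2_eq_square)
    then show "(?H has_vector_derivative (pi - x) / pi * sine n x) (at x within {0..pi})"
      by (simp only: has_real_derivative_iff_has_vector_derivative)
  qed simp
  moreover have "?H pi - ?H 0 = 1 / ?m"
    using sin_npi[of "Suc n"] by (simp del: of_nat_Suc)
  ultimately have "integral {0..pi} (\<lambda>x. (pi - x) / pi * sine n x) = 1 / ?m"
    by (simp only: integral_unique)
  then show ?thesis
    by (subst integral_Mpi_continuous) (auto simp: lift_coeff_def intro!: continuous_intros continuous_on_sine)
qed

lemma square_integrable_lift: "square_integrable Mpi (\<lambda>x. (pi - x) / pi)"
  by (intro square_integrable_continuous continuous_intros) simp

lemma lift_coeff_pos: "0 < lift_coeff n"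
  by (simp add: lift_coeff_def)

lemma summable_lift_coeff_squared: "summable (\<lambda>n. (lift_coeff n)\<^sup>2)"
proof -
  have "summable (\<lambda>n. 1 / real (Suc n) ^ 2)"
    using inverse_power_summable[of 2, where ?'a = real] by (subst summable_Suc_iff) (simp add: inverse_eq_divide)
  then have "summable (\<lambda>n. (2 / pi)\<^sup>2 * (1 / real (Suc n) ^ 2))" by (rule summable_mult)
  then show ?thesis by (simp add: lift_coeff_def power_divide power_mult_distrib)
qed

lemma summable_squared_le:
  assumes "\<And>n. \<bar>c n\<bar> \<le> C * lift_coeff n"
  shows "summable (\<lambda>n. (c n)\<^sup>2)"
proof (rule summable_comparison_test'[of _ 0])
  show "summable (\<lambda>n. C\<^sup>2 * (lift_coeff n)\<^sup>2)" by (intro summable_mult summable_lift_coeff_squared)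
  show "norm ((c n)\<^sup>2) \<le> C\<^sup>2 * (lift_coeff n)\<^sup>2" for n
    using power_mono[OF assms[of n] abs_ge_zero, of 2] by (simp add: power_mult_distrib)
qed

section \<open>Continuity in time with values in L^2\<close>

lemma CL2_iff:
  "CL2 T u \<longleftrightarrow> (\<forall>t\<in>{0..T}. square_integrable Mpi (\<lambda>x. u x t)) \<and>
    (\<forall>t\<in>{0..T}. ((\<lambda>s. \<integral>x. (u x s - u x t)\<^sup>2 \<partial>Mpi) \<longlongrightarrow> 0) (at t within {0..T}))"
  by (simp add: CL2_def L2_iff L2_dist2_eq)

lemma CL2_add_separable:
  assumes u: "CL2 T u" and g: "square_integrable Mpi g" and f: "continuous_on {0..T} f"
  shows "CL2 T (\<lambda>x t. u x t + g x * f t)"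
  unfolding CL2_iff
proof (intro conjI ballI)
  have u_sq: "square_integrable Mpi (\<lambda>x. u x t)" if "t \<in> {0..T}" for t using u that by (simp add: CL2_iff)
  have gf: "square_integrable Mpi (\<lambda>x. g x * c)" for c
    using square_integrable_cmult[OF g, of c] by (simp add: mult.commute)
  fix t assume t: "t \<in> {0..T}"
  show "square_integrable Mpi (\<lambda>x. u x t + g x * f t)"
    by (intro square_integrable_add u_sq t gf)
  show "((\<lambda>s. \<integral>x. (u x s + g x * f s - (u x t + g x * f t))\<^sup>2 \<partial>Mpi) \<longlongrightarrow> 0) (at t within {0..T})"
  proof (rule Lim_null_comparison)
    let ?b = "\<lambda>s. 2 * (\<integral>x. (u x s - u x t)\<^sup>2 \<partial>Mpi) + 2 * ((f s - f t)\<^sup>2 * (\<integral>x. (g x)\<^sup>2 \<partial>Mpi))"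
    have "(f \<longlongrightarrow> f t) (at t within {0..T})" using f t by (simp add: continuous_on_def)
    from tendsto_power[OF LIM_zero[OF this], of 2]
    have 1: "((\<lambda>s. (f s - f t)\<^sup>2) \<longlongrightarrow> 0) (at t within {0..T})" by simp
    have 2: "((\<lambda>s. \<integral>x. (u x s - u x t)\<^sup>2 \<partial>Mpi) \<longlongrightarrow> 0) (at t within {0..T})"
      using u t by (simp add: CL2_iff)
    show "(?b \<longlongrightarrow> 0) (at t within {0..T})"
      using tendsto_add[OF tendsto_mult_right_zero[OF 2, of 2]
          tendsto_mult_right_zero[OF tendsto_mult_left_zero[OF 1], of 2]] by simp
    show "\<forall>\<^sub>F s in at t within {0..T}. norm (\<integral>x. (u x s + g x * f s - (u x t + g x * f t))\<^sup>2 \<partial>Mpi) \<le> ?b s"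
      unfolding eventually_at_filter
    proof (intro always_eventually allI impI)
      fix s assume s: "s \<in> {0..T}"
      let ?p = "\<lambda>x. u x s - u x t" and ?q = "\<lambda>x. g x * (f s - f t)"
      have p: "square_integrable Mpi ?p" by (intro square_integrable_diff u_sq s t)
      have q: "square_integrable Mpi ?q" by (rule gf)
      have "norm (\<integral>x. (u x s + g x * f s - (u x t + g x * f t))\<^sup>2 \<partial>Mpi) = (\<integral>x. (?p x + ?q x)\<^sup>2 \<partial>Mpi)"
        by (simp add: algebra_simps)
      also have "\<dots> \<le> (\<integral>x. 2 * (?p x)\<^sup>2 + 2 * (?q x)\<^sup>2 \<partial>Mpi)"
      proof (rule integral_mono)
        show "integrable Mpi (\<lambda>x. (?p x + ?q x)\<^sup>2)"
          using square_integrable_add[OF p q] by (simp add: square_integrable_def)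
        show "integrable Mpi (\<lambda>x. 2 * (?p x)\<^sup>2 + 2 * (?q x)\<^sup>2)"
          using p q unfolding square_integrable_def
          by (intro Bochner_Integration.integrable_add integrable_mult_right) auto
        have "(a + b)\<^sup>2 \<le> 2 * a\<^sup>2 + 2 * b\<^sup>2" for a b :: real
          using zero_le_power2[of "a - b"] by (simp add: power2_eq_square algebra_simps)
        then show "(?p x + ?q x)\<^sup>2 \<le> 2 * (?p x)\<^sup>2 + 2 * (?q x)\<^sup>2" for x .
      qed
      also have "\<dots> = (\<integral>x. 2 * (?p x)\<^sup>2 \<partial>Mpi) + (\<integral>x. 2 * (?q x)\<^sup>2 \<partial>Mpi)"
        using p q unfolding square_integrable_def
        by (intro Bochner_Integration.integral_add integrable_mult_right) auto
      also have "\<dots> = ?b s" by (simp add: power_mult_distrib mult.commute)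
      finally show "norm (\<integral>x. (u x s + g x * f s - (u x t + g x * f t))\<^sup>2 \<partial>Mpi) \<le> ?b s" .
    qed
  qed
qed

lemma continuous_on_CL2_inner:
  assumes u: "CL2 T u" and v: "square_integrable Mpi v"
  shows "continuous_on {0..T} (\<lambda>t. \<integral>x. u x t * v x \<partial>Mpi)"
  unfolding continuous_on_def
proof
  fix t assume t: "t \<in> {0..T}"
  show "((\<lambda>s. \<integral>x. u x s * v x \<partial>Mpi) \<longlongrightarrow> (\<integral>x. u x t * v x \<partial>Mpi)) (at t within {0..T})"
    using u t v by (intro square_integrable_tendsto_inner) (auto simp: CL2_iff eventually_at_filter)
qed

text \<open>By Parseval the squared distance of two time slices is a series whose terms tend to 0
  and are bounded by (2 C g_k)^2 independently of time; Tannery's theorem exchanges limit and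
  sum.\<close>

lemma CL2_sine_limit:
  assumes y: "\<And>n. continuous_on {0..T} (y n)" and bound: "\<And>n t. t \<in> {0..T} \<Longrightarrow> \<bar>y n t\<bar> \<le> C * lift_coeff n"
    and u: "\<And>t. t \<in> {0..T} \<Longrightarrow> sine_limit (\<lambda>n. y n t) (\<lambda>x. u x t)"
  shows "CL2 T u"
  unfolding CL2_iff
proof (intro conjI ballI)
  fix t assume t: "t \<in> {0..T}"
  show "square_integrable Mpi (\<lambda>x. u x t)" using u[OF t] by (simp add: sine_limit_def)
  show "((\<lambda>s. \<integral>x. (u x s - u x t)\<^sup>2 \<partial>Mpi) \<longlongrightarrow> 0) (at t within {0..T})"
  \<comment> \<open>Tannery's theorem needs a nontrivial filter; if t is isolated, every limit
    statement holds.\<close>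
  proof (cases "at t within {0..T} = bot")
    case False
    let ?F = "at t within {0..T}"
    have "((\<lambda>s. \<Sum>k. (y k s - y k t)\<^sup>2) \<longlongrightarrow> (\<Sum>k. 0)) ?F"
    proof (rule tannerys_theorem[THEN conjunct2, THEN conjunct2])
      fix k
      have "(y k \<longlongrightarrow> y k t) ?F" using y t by (simp add: continuous_on_def)
      from tendsto_power[OF LIM_zero[OF this], of 2]
      show "((\<lambda>s. (y k s - y k t)\<^sup>2) \<longlongrightarrow> 0) ?F" by simp
    next
      have "norm ((y k s - y k t)\<^sup>2) \<le> (2 * C * lift_coeff k)\<^sup>2" if "s \<in> {0..T}" for k s
      proof -
        have "\<bar>y k s - y k t\<bar> \<le> 2 * C * lift_coeff k"
          using bound[OF that, of k] bound[OF t, of k] by linarith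
        from power_mono[OF this abs_ge_zero, of 2] show ?thesis by simp
      qed
      moreover have "\<forall>\<^sub>F s in ?F. s \<in> {0..T}" by (simp add: eventually_at_filter)
      ultimately show "\<forall>\<^sub>F (k, s) in at_top \<times>\<^sub>F ?F. norm ((y k s - y k t)\<^sup>2) \<le> (2 * C * lift_coeff k)\<^sup>2"
        by (auto intro!: eventually_mono[OF eventually_prodI[OF eventually_True]])
      show "summable (\<lambda>k. (2 * C * lift_coeff k)\<^sup>2)"
        using summable_mult[OF summable_lift_coeff_squared, of "(2 * C)\<^sup>2"] by (simp add: power_mult_distrib)
    qed (rule False)
    then have "((\<lambda>s. pi / 2 * (\<Sum>k. (y k s - y k t)\<^sup>2)) \<longlongrightarrow> 0) ?F"
      using tendsto_mult_right_zero by fastforce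
    then show ?thesis
    proof (rule Lim_transform_eventually)
      have "pi / 2 * (\<Sum>k. (y k s - y k t)\<^sup>2) = (\<integral>x. (u x s - u x t)\<^sup>2 \<partial>Mpi)" if "s \<in> {0..T}" for s
        by (subst sums_unique[OF sine_limit_norm[OF sine_limit_diff[OF u[OF that] u[OF t]]], symmetric]) simp
      then show "\<forall>\<^sub>F s in ?F. pi / 2 * (\<Sum>k. (y k s - y k t)\<^sup>2) = (\<integral>x. (u x s - u x t)\<^sup>2 \<partial>Mpi)"
        by (simp add: eventually_at_filter)
    qed
  qed simp
qed

text \<open>Both sides of the defining identity are limits of the same sequence: one through the L^2
  expansion of W, the other by dominated convergence in the time variable.\<close>

lemma is_conv_integral_sine_series:
  fixes a :: "real \<Rightarrow> real"
  assumes a: "continuous_on UNIV a" and y: "\<And>n. continuous_on {0..T} (y n)"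
    and bound: "\<And>n t. t \<in> {0..T} \<Longrightarrow> \<bar>y n t\<bar> \<le> C * lift_coeff n"
    and u: "\<And>t. t \<in> {0..T} \<Longrightarrow> sine_limit (\<lambda>n. y n t) (\<lambda>x. u x t)"
    and t: "t \<in> {0..T}"
    and w: "sine_limit (\<lambda>n. LINT s:{0..t}|lborel. a (t - s) * y n s) W"
  shows "is_conv_integral a u t W"
  unfolding is_conv_integral_def L2_iff set_integral_Mpi
proof (intro conjI allI impI)
  show "square_integrable Mpi W" using w by (simp add: sine_limit_def)
  fix h assume h: "square_integrable Mpi h"
  define b where "b k = (\<integral>x. sine k x * h x \<partial>Mpi)" for k
  define P where "P n s = (\<Sum>k<n. y k s * b k)" for n s
  have sub: "{0..t} \<subseteq> {0..T}" using t by auto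
  have a_cont: "continuous_on S (\<lambda>s. a (t - s))" for S
    by (rule continuous_on_compose2[OF a]) (auto intro!: continuous_intros)
  have y_cont: "continuous_on {0..t} (y k)" for k by (rule continuous_on_subset[OF y sub])
  have int: "integrable lborel (\<lambda>s. indicator {0..t} s *\<^sub>R (a (t - s) * y k s))" for k
    using borel_integrable_atLeastAtMost'[OF continuous_on_mult[OF a_cont y_cont]]
    by (simp add: set_integrable_def)
  have P_int: "(LINT s:{0..t}|lborel. a (t - s) * P n s)
      = (\<Sum>k<n. (LINT s:{0..t}|lborel. a (t - s) * y k s) * b k)" for n
  proof -
    have "indicator {0..t} s *\<^sub>R (a (t - s) * P n s)
        = (\<Sum>k<n. (indicator {0..t} s *\<^sub>R (a (t - s) * y k s)) * b k)" for s
      by (simp add: P_def sum_distrib_left mult.assoc)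
    then show ?thesis
      unfolding set_lebesgue_integral_def using int
      by (simp only: Bochner_Integration.integral_sum integrable_mult_left integral_mult_left_zero)
  qed
  have lhs: "(\<lambda>n. LINT s:{0..t}|lborel. a (t - s) * P n s) \<longlonglongrightarrow> (\<integral>x. W x * h x \<partial>Mpi)"
    unfolding P_int using sine_limit_inner[OF w h] by (simp add: sums_def b_def)
  \<comment> \<open>Cauchy-Schwarz bound for the partial inner products, with the norm of the
    partial sum estimated by Parseval and the bound on the coefficients, hence uniform in n and
    s.\<close>
  define D where "D = sqrt (pi / 2 * (\<Sum>k. (C * lift_coeff k)\<^sup>2) * (\<integral>x. (h x)\<^sup>2 \<partial>Mpi))"
  have P_bound: "\<bar>P n s\<bar> \<le> D" if s: "s \<in> {0..T}" for n s
  proof -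
    let ?S = "\<lambda>x. \<Sum>k<n. y k s * sine k x"
    have "P n s = (\<integral>x. ?S x * h x \<partial>Mpi)"
      using square_integrable_mult[OF square_integrable_sine h]
      by (simp add: P_def b_def sum_distrib_right mult.assoc Bochner_Integration.integral_sum)
    then have "(P n s)\<^sup>2 \<le> (\<integral>x. (?S x)\<^sup>2 \<partial>Mpi) * (\<integral>x. (h x)\<^sup>2 \<partial>Mpi)"
      using square_integrable_Cauchy_Schwarz[OF square_integrable_sine_sum h] by simp
    also have "(\<integral>x. (?S x)\<^sup>2 \<partial>Mpi) = pi / 2 * (\<Sum>k<n. (y k s)\<^sup>2)" by (rule sine_sum_norm) simp
    also have "\<dots> * (\<integral>x. (h x)\<^sup>2 \<partial>Mpi) \<le> pi / 2 * (\<Sum>k. (C * lift_coeff k)\<^sup>2) * (\<integral>x. (h x)\<^sup>2 \<partial>Mpi)"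
    proof (intro mult_right_mono mult_left_mono)
      have "(\<Sum>k<n. (y k s)\<^sup>2) \<le> (\<Sum>k<n. (C * lift_coeff k)\<^sup>2)"
      proof (rule sum_mono)
        fix k show "(y k s)\<^sup>2 \<le> (C * lift_coeff k)\<^sup>2"
          using power_mono[OF bound[OF s, of k] abs_ge_zero, of 2] by simp
      qed
      also have "\<dots> \<le> (\<Sum>k. (C * lift_coeff k)\<^sup>2)"
        using summable_mult[OF summable_lift_coeff_squared, of "C\<^sup>2"]
        by (intro sum_le_suminf) (auto simp: power_mult_distrib)
      finally show "(\<Sum>k<n. (y k s)\<^sup>2) \<le> (\<Sum>k. (C * lift_coeff k)\<^sup>2)" .
    qed auto
    finally have "sqrt ((P n s)\<^sup>2) \<le> D" unfolding D_def by (rule real_sqrt_le_mono)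
    then show ?thesis by simp
  qed
  obtain A where A: "\<forall>x\<in>a ` {0..T}. norm x \<le> A"
    using compact_imp_bounded[OF compact_continuous_image[OF continuous_on_subset[OF a subset_UNIV] compact_Icc]]
    unfolding bounded_iff by blast
  have rhs: "(\<lambda>n. LINT s:{0..t}|lborel. a (t - s) * P n s)
      \<longlonglongrightarrow> (LINT s:{0..t}|lborel. a (t - s) * (\<integral>x. u x s * h x \<partial>Mpi))"
    unfolding set_lebesgue_integral_def
  proof (rule integral_dominated_convergence[where w = "\<lambda>s. indicator {0..t} s * (A * D)"])
    have P_lim: "(\<lambda>n. P n s) \<longlonglongrightarrow> (\<integral>x. u x s * h x \<partial>Mpi)" if "s \<in> {0..T}" for s
      using sine_limit_inner[OF u[OF that] h] by (simp add: sums_def P_def b_def)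
    then show "AE s in lborel. (\<lambda>n. indicator {0..t} s *\<^sub>R (a (t - s) * P n s))
        \<longlonglongrightarrow> indicator {0..t} s *\<^sub>R (a (t - s) * (\<integral>x. u x s * h x \<partial>Mpi))"
      using sub by (intro AE_I2) (auto simp: indicator_def intro!: tendsto_mult)
    show meas: "(\<lambda>s. indicator {0..t} s *\<^sub>R (a (t - s) * P n s)) \<in> borel_measurable lborel" for n
    proof -
      have "continuous_on {0..t} (\<lambda>s. a (t - s) * P n s)"
        unfolding P_def by (intro continuous_on_mult continuous_on_sum a_cont y_cont continuous_on_const)
      from borel_integrable_atLeastAtMost'[OF this] show ?thesis
        unfolding set_integrable_def by (rule borel_measurable_integrable)
    qed
    show "(\<lambda>s. indicator {0..t} s *\<^sub>R (a (t - s) * (\<integral>x. u x s * h x \<partial>Mpi))) \<in> borel_measurable lborel"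
    proof (rule borel_measurable_LIMSEQ_metric[OF meas])
      fix s :: real
      show "(\<lambda>n. indicator {0..t} s *\<^sub>R (a (t - s) * P n s))
        \<longlonglongrightarrow> indicator {0..t} s *\<^sub>R (a (t - s) * (\<integral>x. u x s * h x \<partial>Mpi))"
        using sub P_lim by (auto simp: indicator_def intro!: tendsto_mult)
    qed
    show "AE s in lborel. norm (indicator {0..t} s *\<^sub>R (a (t - s) * P n s)) \<le> indicator {0..t} s * (A * D)" for n
    proof (rule AE_I2)
      fix s :: real
      show "norm (indicator {0..t} s *\<^sub>R (a (t - s) * P n s)) \<le> indicator {0..t} s * (A * D)"
      proof (cases "s \<in> {0..t}")
        case True
        then have ts: "t - s \<in> {0..T}" "s \<in> {0..T}" using t by auto
        then have "\<bar>a (t - s)\<bar> \<le> A" using A by auto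
        then have "\<bar>a (t - s)\<bar> * \<bar>P n s\<bar> \<le> A * D"
          by (intro mult_mono P_bound ts) auto
        then show ?thesis using True by (simp add: abs_mult)
      qed simp
    qed
    show "integrable lborel (\<lambda>s. indicator {0..t} s * (A * D))"
      by (intro integrable_mult_left integrable_real_indicator) (auto simp: emeasure_lborel_Icc_eq)
  qed
  show "(\<integral>x. W x * h x \<partial>Mpi) = (LINT s:{0..t}|lborel. a (t - s) * (\<integral>x. u x s * h x \<partial>Mpi))"
    by (rule LIMSEQ_unique[OF lhs rhs])
qed

section \<open>Passage between solutions and their scalar Volterra equations\<close>

definition homogenized :: "(real \<Rightarrow> real) \<Rightarrow> (real \<Rightarrow> real \<Rightarrow> real) \<Rightarrow> real \<Rightarrow> real \<Rightarrow> real" where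
  "homogenized f \<theta> = (\<lambda>x t. \<theta> x t - (pi - x) / pi * f t)"

text \<open>Every clause of the definition of a solution is tested with \<open>sine n\<close>. The
  coefficients are raw inner products, hence the factor pi / 2 with the lift.\<close>

lemma solution_sine_coeff:
  assumes sol: "is_solution N f T \<theta>" and t: "t \<in> {0..T}"
  shows "CL2 T (homogenized f \<theta>)"
    and "(\<integral>x. homogenized f \<theta> x t * sine n x \<partial>Mpi) =
      - (real (Suc n))\<^sup>2 * (LINT s:{0..t}|lborel. kernel_a N (t - s) * (\<integral>x. homogenized f \<theta> x s * sine n x \<partial>Mpi))
      - (pi / 2 * lift_coeff n) * f t"
proof -
  define \<eta> where "\<eta> = homogenized f \<theta>"
  obtain W AW where C: "CL2 T \<eta>" and W: "is_conv_integral (kernel_a N) \<eta> t (\<lambda>x. W x t)"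
    and A: "A_graph (\<lambda>x. W x t) (\<lambda>x. AW x t)" and AW: "CL2 T AW"
    and eq: "L2_eq (\<lambda>x. \<eta> x t) (\<lambda>x. AW x t - (pi - x) / pi * f t)"
    using sol t unfolding is_solution_def Let_def homogenized_def[symmetric] \<eta>_def[symmetric] by blast
  show "CL2 T (homogenized f \<theta>)" using C by (simp add: \<eta>_def)
  let ?g = "\<lambda>x. (pi - x) / pi * f t"
  have g: "square_integrable Mpi ?g"
    using square_integrable_cmult[OF square_integrable_lift, of "f t"] by (simp add: mult.commute)
  have AWt: "square_integrable Mpi (\<lambda>x. AW x t)" and \<eta>t: "square_integrable Mpi (\<lambda>x. \<eta> x t)"
    using AW C t by (simp_all add: CL2_iff)
  have "(\<integral>x. \<eta> x t * sine n x \<partial>Mpi) = (\<integral>x. (AW x t - ?g x) * sine n x \<partial>Mpi)"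
  proof (rule integral_cong_AE)
    show "AE x in Mpi. \<eta> x t * sine n x = (AW x t - ?g x) * sine n x"
      using eq unfolding L2_eq_iff by eventually_elim simp
    show "(\<lambda>x. \<eta> x t * sine n x) \<in> borel_measurable Mpi"
      by (intro borel_measurable_integrable square_integrable_mult \<eta>t square_integrable_sine)
    show "(\<lambda>x. (AW x t - ?g x) * sine n x) \<in> borel_measurable Mpi"
      by (intro borel_measurable_integrable square_integrable_mult square_integrable_diff AWt g square_integrable_sine)
  qed
  also have "\<dots> = (\<integral>x. AW x t * sine n x \<partial>Mpi) - (\<integral>x. ?g x * sine n x \<partial>Mpi)"
    unfolding left_diff_distrib
    by (rule Bochner_Integration.integral_diff) (rule square_integrable_mult AWt g square_integrable_sine)+
  also have "(\<integral>x. ?g x * sine n x \<partial>Mpi) = (pi / 2 * lift_coeff n) * f t"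
  proof -
    have "(\<integral>x. ?g x * sine n x \<partial>Mpi) = (\<integral>x. ((pi - x) / pi * sine n x) * f t \<partial>Mpi)"
      by (intro Bochner_Integration.integral_cong refl) (simp only: mult_ac)
    then show ?thesis by (simp only: integral_mult_left_zero integral_lift_sine)
  qed
  also have "(\<integral>x. AW x t * sine n x \<partial>Mpi) = - (real (Suc n))\<^sup>2 * (\<integral>x. W x t * sine n x \<partial>Mpi)"
    by (rule A_graph_sine_coeff[OF A])
  also have "(\<integral>x. W x t * sine n x \<partial>Mpi)
      = (LINT s:{0..t}|lborel. kernel_a N (t - s) * (\<integral>x. \<eta> x s * sine n x \<partial>Mpi))"
    using W square_integrable_sine[of n] unfolding is_conv_integral_def L2_iff set_integral_Mpi by blast
  finally show "(\<integral>x. homogenized f \<theta> x t * sine n x \<partial>Mpi) =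
      - (real (Suc n))\<^sup>2 * (LINT s:{0..t}|lborel. kernel_a N (t - s) * (\<integral>x. homogenized f \<theta> x s * sine n x \<partial>Mpi))
      - (pi / 2 * lift_coeff n) * f t"
    unfolding \<eta>_def .
qed

lemma solution_unique:
  assumes N: "kernel_assms N" and T: "0 < T"
    and sol: "is_solution N f T \<theta>1" "is_solution N f T \<theta>2" and t: "t \<in> {0..T}"
  shows "L2_eq (\<lambda>x. \<theta>1 x t) (\<lambda>x. \<theta>2 x t)"
proof -
  define z where "z \<theta> n t = (\<integral>x. homogenized f \<theta> x t * sine n x \<partial>Mpi)" for \<theta> n t
  have T0: "0 \<in> {0..T}" using T by simp
  have CL: "CL2 T (homogenized f \<theta>1)" "CL2 T (homogenized f \<theta>2)"
    using solution_sine_coeff(1)[OF sol(1) T0] solution_sine_coeff(1)[OF sol(2) T0] .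
  have z_cont: "continuous_on {0..T} (z \<theta>1 n)" "continuous_on {0..T} (z \<theta>2 n)" for n
    unfolding z_def by (intro continuous_on_CL2_inner CL square_integrable_sine)+
  have "z \<theta>1 n t - z \<theta>2 n t = 0" for n
  proof -
    \<comment> \<open>In the difference the data cancel, so the a priori bound applies with f, f', F
      and c all zero.\<close>
    have "\<bar>z \<theta>1 n t - z \<theta>2 n t\<bar> \<le> 2 * exp T * T * 0 * \<bar>0\<bar>"
    proof (rule volterra_a_priori_bound[OF N, where y = "\<lambda>t. z \<theta>1 n t - z \<theta>2 n t" and f = "\<lambda>_. 0"
          and f' = "\<lambda>_. 0" and lam = "(real (Suc n))\<^sup>2"])
      fix s assume s: "s \<in> {0..T}"
      have sub: "{0..s} \<subseteq> {0..T}" using s by auto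
      have a_cont: "continuous_on {0..s} (\<lambda>r. kernel_a N (s - r))"
        by (rule continuous_on_compose2[OF continuous_on_kernel_a[OF N, of UNIV]])
          (auto intro!: continuous_intros)
      have i: "set_integrable lborel {0..s} (\<lambda>r. kernel_a N (s - r) * z \<theta>1 n r)"
          "set_integrable lborel {0..s} (\<lambda>r. kernel_a N (s - r) * z \<theta>2 n r)"
        by (intro borel_integrable_atLeastAtMost' continuous_on_mult a_cont
            continuous_on_subset[OF z_cont(1) sub] continuous_on_subset[OF z_cont(2) sub])+
      show "z \<theta>1 n s - z \<theta>2 n s = - (real (Suc n))\<^sup>2 *
          (LINT r:{0..s}|lborel. kernel_a N (s - r) * (z \<theta>1 n r - z \<theta>2 n r)) - 0 * 0"
        unfolding right_diff_distrib set_integral_diff(2)[OF i]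
        using solution_sine_coeff(2)[OF sol(1) s, of n] solution_sine_coeff(2)[OF sol(2) s, of n]
        unfolding z_def by (simp add: algebra_simps del: of_nat_Suc)
    qed (use t T in \<open>auto intro!: continuous_on_diff z_cont\<close>)
    then show ?thesis by simp
  qed
  moreover have sq: "square_integrable Mpi (\<lambda>x. homogenized f \<theta>1 x t)" "square_integrable Mpi (\<lambda>x. homogenized f \<theta>2 x t)"
    using CL t by (simp_all add: CL2_iff)
  ultimately have "(\<integral>x. (homogenized f \<theta>1 x t - homogenized f \<theta>2 x t) * sine n x \<partial>Mpi) = 0" for n
    using square_integrable_mult[OF sq(1) square_integrable_sine, of n]
      square_integrable_mult[OF sq(2) square_integrable_sine, of n]
    by (simp add: z_def left_diff_distrib)
  then have "AE x in Mpi. homogenized f \<theta>1 x t - homogenized f \<theta>2 x t = 0"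
    by (intro sine_system_complete square_integrable_diff sq)
  then show ?thesis
    unfolding L2_eq_iff by eventually_elim (simp add: homogenized_def)
qed

lemma solution_exists:
  assumes N: "kernel_assms N" and T: "0 < T"
    and f': "continuous_on {0..T} f'"
    and f: "\<And>t. t \<in> {0..T} \<Longrightarrow> (f has_real_derivative f' t) (at t within {0..T})" "f 0 = 0"
  shows "\<exists>\<theta>. CL2 T \<theta> \<and> is_solution N f T \<theta>"
proof -
  let ?a = "kernel_a N"
  have a: "continuous_on UNIV ?a" by (rule continuous_on_kernel_a[OF N])
  have f_cont: "continuous_on {0..T} f" by (rule DERIV_continuous_on[OF f(1)])
  have T0: "0 \<le> T" using T by simp
  have "\<forall>n. \<exists>y. continuous_on {0..T} y \<and>
      (\<forall>t\<in>{0..T}. y t = - (real (Suc n))\<^sup>2 * (LINT s:{0..t}|lborel. ?a (t - s) * y s) + - lift_coeff n * f t)"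
    by (rule allI, rule volterra_solution_exists[OF T0 _ a kernel_a_neg])
      (simp, simp, rule continuous_on_mult[OF continuous_on_const f_cont])
  from choice[OF this] obtain y where y_sol: "\<forall>n. continuous_on {0..T} (y n) \<and>
      (\<forall>t\<in>{0..T}. y n t = - (real (Suc n))\<^sup>2 * (LINT s:{0..t}|lborel. ?a (t - s) * y n s) + - lift_coeff n * f t)" ..
  then have y: "\<And>n. continuous_on {0..T} (y n)" by blast
  have y_eq: "y n t = - (real (Suc n))\<^sup>2 * (LINT s:{0..t}|lborel. ?a (t - s) * y n s) - lift_coeff n * f t"
    if "t \<in> {0..T}" for n t
    using bspec[OF conjunct2[OF spec[OF y_sol, of n]] that] by (simp only: minus_mult_left[symmetric] diff_conv_add_uminus)
  obtain F where F: "\<forall>x\<in>f' ` {0..T}. norm x \<le> F"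
    using compact_imp_bounded[OF compact_continuous_image[OF f' compact_Icc]] unfolding bounded_iff by blast
  obtain G where G: "\<forall>x\<in>f ` {0..T}. norm x \<le> G"
    using compact_imp_bounded[OF compact_continuous_image[OF f_cont compact_Icc]] unfolding bounded_iff by blast
  define C where "C = 2 * exp T * T * F"
  have bound: "\<bar>y n t\<bar> \<le> C * lift_coeff n" if t: "t \<in> {0..T}" for n t
  proof -
    have "\<bar>y n t\<bar> \<le> 2 * exp T * T * F * \<bar>lift_coeff n\<bar>"
    proof (rule volterra_a_priori_bound[OF N T0 _ y f' _ f y_eq t])
      show "\<bar>f' t\<bar> \<le> F" if "t \<in> {0..T}" for t using F that by auto
    qed simp
    then show ?thesis using lift_coeff_pos[of n] by (simp add: C_def)
  qed
  \<comment> \<open>An L^2 representative is chosen separately for each t; \<open>CL2\<close> and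
    the weak form of the convolution integral only see individual time slices.\<close>
  define \<eta> where "\<eta> x t = (SOME u. sine_limit (\<lambda>n. y n t) u) x" for x t
  have \<eta>: "sine_limit (\<lambda>n. y n t) (\<lambda>x. \<eta> x t)" if t: "t \<in> {0..T}" for t
    unfolding \<eta>_def by (rule someI_ex[OF sine_limit_exists[OF summable_squared_le[OF bound[OF t]]]])
  define \<theta> where "\<theta> x t = \<eta> x t + (pi - x) / pi * f t" for x t
  define w where "w t n = (LINT s:{0..t}|lborel. ?a (t - s) * y n s)" for t n
  define W where "W x t = (\<Sum>n. w t n * sine n x)" for x t
  have CL_\<eta>: "CL2 T \<eta>" by (rule CL2_sine_limit[OF y bound \<eta>])
  have CL_\<theta>: "CL2 T \<theta>"
    unfolding \<theta>_def by (rule CL2_add_separable[OF CL_\<eta> square_integrable_lift f_cont])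
  \<comment> \<open>The Volterra equation read backwards: it expresses n^2 times the convolution by
    quantities of order 1/n. Estimating the convolution directly from y would lose the factor
    n^-2.\<close>
  have w_eq: "- (w t n * (real (Suc n))\<^sup>2) = y n t + lift_coeff n * f t" if "t \<in> {0..T}" for t n
    using y_eq[OF that, of n] by (simp add: w_def mult.commute del: of_nat_Suc)
  have w_bound: "\<bar>w t n * (real (Suc n))\<^sup>2\<bar> \<le> (C + G) * lift_coeff n" if t: "t \<in> {0..T}" for t n
  proof -
    have "\<bar>w t n * (real (Suc n))\<^sup>2\<bar> = \<bar>y n t + lift_coeff n * f t\<bar>"
      using w_eq[OF t, of n] by (metis abs_minus_cancel)
    also have "\<dots> \<le> \<bar>y n t\<bar> + \<bar>lift_coeff n * f t\<bar>" by (rule abs_triangle_ineq)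
    also have "\<bar>lift_coeff n * f t\<bar> \<le> lift_coeff n * G"
      using G t lift_coeff_pos[of n] by (auto simp: abs_mult)
    finally show ?thesis using bound[OF t, of n] by (simp add: algebra_simps)
  qed
  have w_sum: "summable (\<lambda>n. \<bar>w t n * real (Suc n)\<bar>)" "summable (\<lambda>n. \<bar>w t n\<bar>)" if t: "t \<in> {0..T}" for t
  proof -
    \<comment> \<open>The order n^-2 is written through the square of the lift coefficient, using
      lift_coeff n / (n+1) = (pi / 2) (lift_coeff n)^2.\<close>
    have le: "\<bar>w t n * real (Suc n)\<bar> \<le> ((C + G) * (pi / 2)) * (lift_coeff n)\<^sup>2" for n
    proof -
      have "\<bar>w t n * real (Suc n)\<bar> * real (Suc n) \<le> (C + G) * lift_coeff n"
        using w_bound[OF t, of n] by (simp add: abs_mult power2_eq_square mult.assoc)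
      then have "\<bar>w t n * real (Suc n)\<bar> \<le> (C + G) * lift_coeff n / real (Suc n)"
        by (simp add: pos_le_divide_eq del: of_nat_Suc)
      also have "\<dots> = ((C + G) * (pi / 2)) * (lift_coeff n)\<^sup>2"
        by (simp add: lift_coeff_def power2_eq_square field_simps del: of_nat_Suc)
      finally show ?thesis .
    qed
    show 1: "summable (\<lambda>n. \<bar>w t n * real (Suc n)\<bar>)"
      by (rule summable_comparison_test'[of "\<lambda>n. ((C + G) * (pi / 2)) * (lift_coeff n)\<^sup>2" 0])
        (use le in \<open>auto intro!: summable_mult summable_lift_coeff_squared simp del: of_nat_Suc\<close>)
    show "summable (\<lambda>n. \<bar>w t n\<bar>)"
    proof (rule summable_comparison_test'[OF 1, of 0])
      fix n
      have "\<bar>w t n\<bar> * 1 \<le> \<bar>w t n\<bar> * real (Suc n)" by (intro mult_left_mono) auto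
      then show "norm \<bar>w t n\<bar> \<le> \<bar>w t n * real (Suc n)\<bar>" by (simp add: abs_mult del: of_nat_Suc)
    qed
  qed
  \<comment> \<open>The image of W under A is \<theta> itself: the equation says that \<eta> is this
    image minus the lift times f.\<close>
  have W: "A_graph (\<lambda>x. W x t) (\<lambda>x. \<theta> x t)" if t: "t \<in> {0..T}" for t
    unfolding W_def
  proof (rule A_graph_sine_series[OF w_sum(2,1)[OF t]])
    have \<eta>t: "square_integrable Mpi (\<lambda>x. \<eta> x t)" and \<theta>t: "square_integrable Mpi (\<lambda>x. \<theta> x t)"
      using CL_\<eta> CL_\<theta> t by (simp_all add: CL2_iff)
    show "sine_limit (\<lambda>n. - (w t n * (real (Suc n))\<^sup>2)) (\<lambda>x. \<theta> x t)"
    proof (rule sine_limit_expansion[OF \<theta>t])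
      show "summable (\<lambda>k. (- (w t k * (real (Suc k))\<^sup>2))\<^sup>2)"
        by (rule summable_squared_le[where C = "C + G"]) (simp only: abs_minus_cancel w_bound[OF t])
      fix n
      have "(\<integral>x. \<theta> x t * sine n x \<partial>Mpi) = (\<integral>x. \<eta> x t * sine n x + f t * ((pi - x) / pi * sine n x) \<partial>Mpi)"
        by (intro Bochner_Integration.integral_cong refl) (simp add: \<theta>_def distrib_right)
      also have "\<dots> = (\<integral>x. \<eta> x t * sine n x \<partial>Mpi) + (\<integral>x. f t * ((pi - x) / pi * sine n x) \<partial>Mpi)"
        by (intro Bochner_Integration.integral_add integrable_mult_right square_integrable_mult \<eta>t
            square_integrable_sine square_integrable_lift)
      also have "\<dots> = pi / 2 * (y n t + lift_coeff n * f t)"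
        by (simp only: integral_mult_right_zero integral_lift_sine sine_limit_coeff[OF \<eta>[OF t]])
          (simp add: algebra_simps)
      finally show "(\<integral>x. \<theta> x t * sine n x \<partial>Mpi) = pi / 2 * - (w t n * (real (Suc n))\<^sup>2)"
        using w_eq[OF t, of n] by (simp only:)
    qed
  qed
  have conv: "is_conv_integral ?a \<eta> t (\<lambda>x. W x t)" if t: "t \<in> {0..T}" for t
    unfolding W_def
    by (rule is_conv_integral_sine_series[OF a y bound \<eta> t, folded w_def])
      (auto intro: sine_limit_series w_sum(2) t)
  have "(\<lambda>x t. \<theta> x t - (pi - x) / pi * f t) = \<eta>" by (intro ext) (simp add: \<theta>_def)
  then have "is_solution N f T \<theta>"
    unfolding is_solution_def Let_def
    using CL_\<eta> CL_\<theta> conv W by (intro conjI exI[of _ W] exI[of _ \<theta>]) (auto simp: L2_eq_def \<theta>_def)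
  then show ?thesis using CL_\<theta> by blast
qed

theorem mainTheorem1:
  fixes N f :: "real \<Rightarrow> real" and T :: real
  assumes "kernel_assms N"
    and "0 < T"
    and "\<exists>f'. continuous_on {0..T} f' \<and>
            (\<forall>t\<in>{0..T}. (f has_real_derivative f' t) (at t within {0..T}))"
    and "f 0 = 0"
  shows "(\<exists>\<theta>. CL2 T \<theta> \<and> is_solution N f T \<theta>) \<and>
         (\<forall>\<theta>1 \<theta>2. CL2 T \<theta>1 \<and> is_solution N f T \<theta>1 \<and> CL2 T \<theta>2 \<and> is_solution N f T \<theta>2
            \<longrightarrow> (\<forall>t\<in>{0..T}. L2_eq (\<lambda>x. \<theta>1 x t) (\<lambda>x. \<theta>2 x t)))"
  using assms solution_exists[OF assms(1,2)] solution_unique[OF assms(1,2)] by blast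

end
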